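(* Let $\mathcal{X}$ be a class of abelian groups. (i) If $\mathcal{EB}\subseteq\mathcal{X}\subseteq\mathcal{DF}$, then $\mathcal{X}_h=\mathcal{EB}$. (ii) If $\mathcal{B}\subseteq\mathcal{X}\subseteq\mathcal{H}$, then $\mathcal{X}_h=\mathcal{B}$.
   Context: All groups are abelian; a class is closed under isomorphism. $\mathcal{B}$: Bassian groups ($G$ Bassian iff there is no nonzero $H\le G$ with an injective homomorphism $G\to G/H$). $\mathcal{H}$: Hopfian groups ($G$ Hopfian iff $G\not\cong G/H$ for every nonzero subgroup $H$; equivalently every surjective endomorphism is injective). $\mathcal{DF}$: directly finite groups ($G$ not isomorphic to a proper direct summand of itself, i.e. no $G=A\oplus C$ with $C\ne0$, $A\cong G$). $\mathcal{EB}$: Extended Bassian groups, i.e. groups $B\oplus D$ with $B$ Bassian and $D=\bigoplus_{p\ \text{prime}}\mathbb{Z}(p^\infty)^{(n_p)}$, each $n_p$ finite. For a class $\mathcal{X}$, $\mathcal{X}_h=\{G\in\mathcal{X}:\text{every subgroup of }G\text{ is in }\mathcal{X}\}$. *)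

theory Defs
  imports "HOL-Algebra.Algebra" "HOL-Computational_Algebra.Primes"
begin

definition Bassian :: "'a monoid \<Rightarrow> bool" where
  "Bassian G \<longleftrightarrow> comm_group G \<and>
     \<not> (\<exists>H f. subgroup H G \<and> H \<noteq> {\<one>\<^bsub>G\<^esub>} \<and>
              f \<in> hom G (G Mod H) \<and> inj_on f (carrier G))"

definition Hopfian :: "'a monoid \<Rightarrow> bool" where
  "Hopfian G \<longleftrightarrow> comm_group G \<and>
     (\<forall>H. subgroup H G \<and> H \<noteq> {\<one>\<^bsub>G\<^esub>} \<longrightarrow> \<not> (G \<cong> G Mod H))"

definition directly_finite :: "'a monoid \<Rightarrow> bool" where
  "directly_finite G \<longleftrightarrow> comm_group G \<and>
     \<not> (\<exists>A C. subgroup A G \<and> subgroup C G \<and> A \<inter> C = {\<one>\<^bsub>G\<^esub>} \<and>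
              A <#>\<^bsub>G\<^esub> C = carrier G \<and> C \<noteq> {\<one>\<^bsub>G\<^esub>} \<and>
              G\<lparr>carrier := A\<rparr> \<cong> G)"

text \<open>Concrete model of the group  \<oplus>_p Z(p^\<infinity>)^(n p)  : finitely supported families
  f p i (p prime, i < n p) of elements of Z(p^\<infinity>) \<subseteq> Q/Z, where Q/Z is represented by
  the rationals in [0,1) with addition modulo 1.\<close>

definition prufer_sum :: "(nat \<Rightarrow> nat) \<Rightarrow> (nat \<Rightarrow> nat \<Rightarrow> rat) monoid" where
  "prufer_sum n = \<lparr> carrier = {f. finite {(p, i). f p i \<noteq> 0} \<and>
        (\<forall>p i. f p i \<noteq> 0 \<longrightarrow> Factorial_Ring.prime p \<and> i < n p) \<and>
        (\<forall>p i. 0 \<le> f p i \<and> f p i < 1 \<and> (\<exists>k::nat. of_nat p ^ k * f p i \<in> \<int>))},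
     monoid.mult = (\<lambda>f g. \<lambda>p i. frac (f p i + g p i)),
     monoid.one = (\<lambda>p i. 0) \<rparr>"

definition ext_Bassian :: "'a monoid \<Rightarrow> bool" where
  "ext_Bassian G \<longleftrightarrow> comm_group G \<and>
     (\<exists>B D np. subgroup B G \<and> subgroup D G \<and> B \<inter> D = {\<one>\<^bsub>G\<^esub>} \<and>
              B <#>\<^bsub>G\<^esub> D = carrier G \<and>
              Bassian (G\<lparr>carrier := B\<rparr>) \<and> G\<lparr>carrier := D\<rparr> \<cong> prufer_sum np)"

definition hered :: "('a monoid \<Rightarrow> bool) \<Rightarrow> 'a monoid \<Rightarrow> bool" where
  "hered P G \<longleftrightarrow> P G \<and> (\<forall>H. subgroup H G \<longrightarrow> P (G\<lparr>carrier := H\<rparr>))"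

end

(*
Every group in question is characterised by two finiteness conditions. An abelian group is Bassian
iff it has finite torsion-free rank and all its primary components are finite; it is extended
Bassian iff it has finite torsion-free rank and all its socles G[p] are finite. Both conditions
pass to subgroups, which gives one half of each claim. Conversely, a group all of whose subgroups
are directly finite contains neither an infinite direct sum of copies of Z nor of Z/p, hence
satisfies the second pair of conditions; if all subgroups are even Hopfian, then the torsion part
contains no nonzero divisible subgroup, because multiplication by p would be a non-injective
surjection, and finite socles then force finite primary components.

That a Bassian group satisfies the conditions follows from one embedding principle: if M <= G and
pi, psi : G -> D are homomorphisms such that pi maps M onto D with M cap ker pi nontrivial and psi
is injective on M, then G embeds into G / (M cap ker pi). The targets D are countable powers of Q
and of Z(p^infinity), divisible torsion subgroups of G, and bounded direct summands of G.
*)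

theory Submission
  imports Defs "HOL-Library.Countable_Set" "HOL-Library.Nat_Bijection"
begin

section \<open>Integer linear combinations of a sequence\<close>

text \<open>The maps \<open>\<pi>\<close> and \<open>\<psi>\<close> must live on all of
  \<open>G\<close>, although only their values on \<open>M\<close> are prescribed. Hence each target
  is either divisible, so that Baer's extension argument applies, or has bounded exponent
  \<open>q\<close> and receives only maps that kill all \<open>q\<close>-th powers. The target must
  also be small enough to be covered by a countable span and large enough to contain a copy of that
  span; countable powers of Q and of Z(p^infinity) meet both demands. The target is dictated by the
  way in which the conditions fail. Infinite rank calls for powers of Q. If the socle G[p] has
  infinitely many elements of height at least n for every n, there are independent elements of
  orders p, p^2, p^3, ..., which calls for powers of Z(p^infinity); otherwise a bounded summand
  arises just below the height at which the supply becomes finite. Finite socles with an infinite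
  primary component produce a divisible torsion subgroup. One notion of independence, relative to a
  subgroup \<open>Q\<close> and to prescribed orders \<open>r i\<close>, serves all these
  cases.\<close>

primrec lincomb :: "('a, 'm) monoid_scheme \<Rightarrow> (nat \<Rightarrow> 'a) \<Rightarrow> (nat \<Rightarrow> int) \<Rightarrow> nat \<Rightarrow> 'a" where
  "lincomb G b c 0 = \<one>\<^bsub>G\<^esub>"
| "lincomb G b c (Suc n) = lincomb G b c n \<otimes>\<^bsub>G\<^esub> b n [^]\<^bsub>G\<^esub> c n"

definition span_upto :: "('a, 'm) monoid_scheme \<Rightarrow> (nat \<Rightarrow> 'a) \<Rightarrow> nat \<Rightarrow> 'a set" where
  "span_upto G b n = {lincomb G b c n | c. True}"

definition span_all :: "('a, 'm) monoid_scheme \<Rightarrow> (nat \<Rightarrow> 'a) \<Rightarrow> 'a set" where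
  "span_all G b = {lincomb G b c n | c n. True}"

text \<open>For a subgroup \<open>Q\<close>: the direct sum of the cyclic groups
  Z/\<open>r i\<close> embeds along \<open>b\<close> and meets \<open>Q\<close> trivially. The value
  \<open>r i = 0\<close> encodes infinite order, as 0 divides only 0, and \<open>r i = 1\<close> a
  trivial element, which allows a finite independent family to be padded to a sequence.\<close>

definition independent_mod ::
    "('a, 'm) monoid_scheme \<Rightarrow> 'a set \<Rightarrow> (nat \<Rightarrow> int) \<Rightarrow> (nat \<Rightarrow> 'a) \<Rightarrow> bool" where
  "independent_mod G Q r b \<longleftrightarrow>
     (\<forall>i. b i \<in> carrier G \<and> b i [^]\<^bsub>G\<^esub> r i = \<one>\<^bsub>G\<^esub>) \<and>
     (\<forall>c n. lincomb G b c n \<in> Q \<longrightarrow> (\<forall>i<n. r i dvd c i))"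

lemma independent_modD:
  assumes "independent_mod G Q r b"
  shows "b i \<in> carrier G" "b i [^]\<^bsub>G\<^esub> r i = \<one>\<^bsub>G\<^esub>"
    "lincomb G b c n \<in> Q \<Longrightarrow> i < n \<Longrightarrow> r i dvd c i"
  using assms by (auto simp: independent_mod_def)

lemma lincomb_cong:
  "(\<And>i. i < n \<Longrightarrow> b i = b' i) \<Longrightarrow> (\<And>i. i < n \<Longrightarrow> c i = c' i) \<Longrightarrow> lincomb G b c n = lincomb G b' c' n"
  by (induction n) auto

context comm_group
begin

lemma subgroup_comm_group: "subgroup H G \<Longrightarrow> comm_group (G\<lparr>carrier := H\<rparr>)"
  by (rule group.group_comm_groupI)
    (auto simp: subgroup_imp_group subgroup.mem_carrier intro: m_comm)

lemma subgroup_int_pow_eq: "subgroup H G \<Longrightarrow> x \<in> H \<Longrightarrow> x [^]\<^bsub>G\<lparr>carrier := H\<rparr>\<^esub> (k::int) = x [^] k"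
  using int_pow_consistent by metis

lemma subgroup_int_powI: "subgroup H G \<Longrightarrow> x \<in> H \<Longrightarrow> x [^] (k::int) \<in> H"
  by (rule subgroup_int_pow_closed)

lemma set_mult_memI: "x \<in> H \<Longrightarrow> y \<in> K \<Longrightarrow> x \<otimes> y \<in> H <#> K"
  by (auto simp: set_mult_def)

lemma subgroup_subset_set_mult:
  assumes "subgroup H G" "subgroup K G"
  shows "H \<subseteq> H <#> K" "K \<subseteq> H <#> K"
proof -
  have "x \<in> H <#> K" if "x \<in> H" for x
    using set_mult_memI[OF that subgroup.one_closed[OF assms(2)]] subgroup.mem_carrier[OF assms(1) that]
    by simp
  then show "H \<subseteq> H <#> K" by auto
  have "x \<in> H <#> K" if "x \<in> K" for x
    using set_mult_memI[OF subgroup.one_closed[OF assms(1)] that] subgroup.mem_carrier[OF assms(2) that]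
    by simp
  then show "K \<subseteq> H <#> K" by auto
qed

lemma subgroup_int_pow_image:
  "subgroup {x [^] (q::int) | x. x \<in> carrier G} G"
proof (rule subgroupI)
  let ?Q = "{x [^] q | x. x \<in> carrier G}"
  show "?Q \<noteq> {}" by auto
  fix a assume "a \<in> ?Q"
  then obtain x where x: "x \<in> carrier G" "a = x [^] q" by auto
  then show "inv a \<in> ?Q" using int_pow_inv[OF x(1)] by (auto intro!: exI[of _ "inv x"])
  fix a' assume "a' \<in> ?Q"
  then obtain x' where "x' \<in> carrier G" "a' = x' [^] q" by auto
  then show "a \<otimes> a' \<in> ?Q"
    using x by (auto intro!: exI[of _ "x \<otimes> x'"] simp: int_pow_distrib)
qed auto

lemma int_pow_dvd_one:
  assumes "x \<in> carrier G" "x [^] (m::int) = \<one>" "m dvd k"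
  shows "x [^] k = \<one>"
  using assms by (metis dvd_def int_pow_one int_pow_pow)

lemma lincomb_closed [simp]: "(\<And>i. b i \<in> carrier G) \<Longrightarrow> lincomb G b c n \<in> carrier G"
  by (induction n) auto

lemma lincomb_add:
  assumes "\<And>i. b i \<in> carrier G"
  shows "lincomb G b c n \<otimes> lincomb G b c' n = lincomb G b (\<lambda>i. c i + c' i) n"
proof (induction n)
  case (Suc n)
  then show ?case by (simp add: assms int_pow_mult m_ac flip: Suc.IH)
qed simp

lemma lincomb_pow:
  assumes "\<And>i. b i \<in> carrier G"
  shows "lincomb G b c n [^] (k::int) = lincomb G b (\<lambda>i. c i * k) n"
  by (induction n) (auto simp: assms int_pow_distrib int_pow_pow)

lemma lincomb_inv:
  assumes "\<And>i. b i \<in> carrier G"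
  shows "inv (lincomb G b c n) = lincomb G b (\<lambda>i. - c i) n"
  using lincomb_pow[of b, OF assms, where k="-1"] assms by (simp add: int_pow_neg)

lemma lincomb_mult_seq:
  assumes "\<And>i. b i \<in> carrier G" "\<And>i. d i \<in> carrier G"
  shows "lincomb G (\<lambda>i. b i \<otimes> d i) c n = lincomb G b c n \<otimes> lincomb G d c n"
  by (induction n) (auto simp: assms int_pow_distrib m_ac)

lemma lincomb_one:
  "(\<And>i. i < n \<Longrightarrow> b i [^] c i = \<one>) \<Longrightarrow> lincomb G b c n = \<one>"
  by (induction n) auto

lemma lincomb_extend:
  assumes "\<And>i. b i \<in> carrier G" "n \<le> m"
  shows "lincomb G b c n = lincomb G b (\<lambda>i. if i < n then c i else 0) m"
  using assms(2)
proof (induction m rule: dec_induct)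
  case base
  show ?case by (rule lincomb_cong) auto
qed (use assms(1) in auto)

lemma lincomb_single:
  assumes "\<And>i. b i \<in> carrier G" "i < n"
  shows "lincomb G b (\<lambda>j. if j = i then k else 0) n = b i [^] k"
proof -
  have "lincomb G b (\<lambda>j. if j = i then k else 0) (Suc i) = b i [^] k"
    using assms(1) by (simp add: lincomb_one)
  moreover have "lincomb G b (\<lambda>j. if j = i then k else 0) (Suc i)
      = lincomb G b (\<lambda>j. if j = i then k else 0) n"
    by (subst lincomb_extend[of b "Suc i" n]) (use assms in \<open>auto intro!: lincomb_cong\<close>)
  ultimately show ?thesis by simp
qed

lemma lincomb_shift:
  assumes "\<And>i. b i \<in> carrier G"
  shows "lincomb G b c (Suc n) = b 0 [^] c 0 \<otimes> lincomb G (\<lambda>i. b (Suc i)) (\<lambda>i. c (Suc i)) n"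
  by (induction n) (use assms in \<open>auto simp: m_ac\<close>)

lemma subgroup_span_upto:
  assumes "\<And>i. b i \<in> carrier G"
  shows "subgroup (span_upto G b n) G"
proof (rule subgroupI)
  show "span_upto G b n \<subseteq> carrier G" "span_upto G b n \<noteq> {}"
    using assms by (auto simp: span_upto_def)
  show "\<And>a. a \<in> span_upto G b n \<Longrightarrow> inv a \<in> span_upto G b n"
    using assms by (auto simp: span_upto_def lincomb_inv)
  show "\<And>a a'. a \<in> span_upto G b n \<Longrightarrow> a' \<in> span_upto G b n \<Longrightarrow> a \<otimes> a' \<in> span_upto G b n"
    using assms by (auto simp: span_upto_def lincomb_add)
qed

lemma span_upto_mono:
  assumes "\<And>i. b i \<in> carrier G" "n \<le> m"
  shows "span_upto G b n \<subseteq> span_upto G b m"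
  using lincomb_extend[of b, OF assms] by (auto simp: span_upto_def)

lemma span_all_Union: "span_all G b = (\<Union>n. span_upto G b n)"
  by (auto simp: span_upto_def span_all_def)

lemma subgroup_span_all:
  assumes "\<And>i. b i \<in> carrier G"
  shows "subgroup (span_all G b) G"
proof (rule subgroupI)
  show "span_all G b \<subseteq> carrier G" "span_all G b \<noteq> {}"
    using assms by (auto simp: span_all_def)
  show "\<And>a. a \<in> span_all G b \<Longrightarrow> inv a \<in> span_all G b"
    using lincomb_inv[of b, OF assms] unfolding span_all_def by blast
  show "a \<otimes> a' \<in> span_all G b" if "a \<in> span_all G b" "a' \<in> span_all G b" for a a'
  proof -
    obtain n m where "a \<in> span_upto G b n" "a' \<in> span_upto G b m"
      using \<open>a \<in> span_all G b\<close> \<open>a' \<in> span_all G b\<close> by (auto simp: span_all_Union)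
    then have "a \<in> span_upto G b (max n m)" "a' \<in> span_upto G b (max n m)"
      using span_upto_mono[of b, OF assms] by (meson max.cobounded1 max.cobounded2 subsetD)+
    then show ?thesis
      using subgroup.m_closed[OF subgroup_span_upto[of b, OF assms]] by (auto simp: span_all_Union)
  qed
qed

lemma in_span_upto: "(\<And>i. b i \<in> carrier G) \<Longrightarrow> i < n \<Longrightarrow> b i \<in> span_upto G b n"
  using lincomb_single[of b i n 1] by (auto simp: span_upto_def) (metis)

lemma in_span_all: "(\<And>i. b i \<in> carrier G) \<Longrightarrow> b i \<in> span_all G b"
  using in_span_upto[of b i "Suc i"] by (auto simp: span_all_Union)

lemma hom_lincomb:
  assumes "comm_group D" "h \<in> hom G D" "\<And>i. b i \<in> carrier G"
  shows "h (lincomb G b c n) = lincomb D (\<lambda>i. h (b i)) c n"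
proof -
  interpret D: comm_group D by fact
  interpret h: group_hom G D h using assms by unfold_locales auto
  show ?thesis by (induction n) (auto simp: assms(3) h.hom_int_pow)
qed

lemma lincomb_subgroup:
  assumes "subgroup H G" "\<And>i. b i \<in> H"
  shows "lincomb (G\<lparr>carrier := H\<rparr>) b c n = lincomb G b c n"
  by (induction n) (auto simp: subgroup_int_pow_eq assms)

lemma independent_mod_subgroup_iff:
  assumes "subgroup H G" "\<And>i. b i \<in> H"
  shows "independent_mod (G\<lparr>carrier := H\<rparr>) Q r b \<longleftrightarrow> independent_mod G Q r b"
  using assms subgroup.mem_carrier[OF assms(1)]
  by (auto simp: independent_mod_def lincomb_subgroup subgroup_int_pow_eq)

text \<open>By \<open>step\<close> the last coefficient of a relation is divisible by its order, so
  the last term vanishes and the relation becomes shorter.\<close>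

lemma independent_modI:
  assumes b: "\<And>i. b i \<in> carrier G" "\<And>i. b i [^] r i = \<one>"
    and Q: "subgroup Q G"
    and step: "\<And>i k. b i [^] k \<in> span_upto G b i <#> Q \<Longrightarrow> r i dvd k"
  shows "independent_mod G Q r b"
proof -
  have "\<forall>i<n. r i dvd c i" if "lincomb G b c n \<in> Q" for c n
    using that
  proof (induction n)
    case (Suc n)
    let ?x = "lincomb G b c n" and ?y = "b n [^] c n"
    have "?y = inv ?x \<otimes> (?x \<otimes> ?y)"
      using b by (simp add: m_assoc[symmetric])
    moreover have "inv ?x \<in> span_upto G b n"
      using b by (auto simp: lincomb_inv span_upto_def)
    ultimately have "?y \<in> span_upto G b n <#> Q"
      using Suc.prems unfolding set_mult_def by (metis (mono_tags, lifting) UN_iff lincomb.simps(2) singletonI)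
    then have n: "r n dvd c n" by (rule step)
    then have "?y = \<one>"
      using b int_pow_dvd_one by blast
    then have "?x \<in> Q"
      using Suc.prems b by simp
    then show ?case using Suc.IH n less_Suc_eq by auto
  qed simp
  then show ?thesis using b by (auto simp: independent_mod_def)
qed

end

section \<open>Extension of partial homomorphisms\<close>

text \<open>A homomorphism from a subgroup of \<open>G\<close>, encoded by its graph. Because the
  graph is a subgroup, single-valuedness at the identity is enough. In this form unions of chains
  and adjoining a new argument are plain subgroup operations.\<close>

definition partial_hom :: "('a, 'm) monoid_scheme \<Rightarrow> ('b, 'n) monoid_scheme \<Rightarrow> ('a \<times> 'b) set \<Rightarrow> bool" where
  "partial_hom G D \<Gamma> \<longleftrightarrow> subgroup \<Gamma> (G \<times>\<times> D) \<and> (\<forall>d. (\<one>\<^bsub>G\<^esub>, d) \<in> \<Gamma> \<longrightarrow> d = \<one>\<^bsub>D\<^esub>)"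

lemma comm_group_DirProd:
  assumes "comm_group G" "comm_group D"
  shows "comm_group (G \<times>\<times> D)"
proof -
  interpret G: comm_group G by fact
  interpret D: comm_group D by fact
  show ?thesis
    by (rule group.group_comm_groupI[OF DirProd_group[OF G.group_axioms D.group_axioms]])
      (auto simp: G.m_comm D.m_comm)
qed

lemma int_pow_DirProd:
  assumes "group G" "group D" "x \<in> carrier G" "d \<in> carrier D"
  shows "(x, d) [^]\<^bsub>G \<times>\<times> D\<^esub> (k::int) = (x [^]\<^bsub>G\<^esub> k, d [^]\<^bsub>D\<^esub> k)"
proof -
  interpret G: group G by fact
  interpret D: group D by fact
  interpret GD: group "G \<times>\<times> D" by (rule DirProd_group[OF assms(1,2)])
  have nat: "(x, d) [^]\<^bsub>G \<times>\<times> D\<^esub> n = (x [^]\<^bsub>G\<^esub> n, d [^]\<^bsub>D\<^esub> n)" for n :: nat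
    by (induction n) auto
  show ?thesis
  proof (cases k rule: int_cases2)
    case (nonneg n)
    then show ?thesis by (simp add: int_pow_int nat)
  next
    case (nonpos n)
    have "(x, d) [^]\<^bsub>G \<times>\<times> D\<^esub> k = inv\<^bsub>G \<times>\<times> D\<^esub> ((x, d) [^]\<^bsub>G \<times>\<times> D\<^esub> n)"
      using assms nonpos by (simp add: GD.int_pow_neg_int)
    also have "\<dots> = (inv\<^bsub>G\<^esub> (x [^]\<^bsub>G\<^esub> n), inv\<^bsub>D\<^esub> (d [^]\<^bsub>D\<^esub> n))"
      unfolding nat by (rule inv_DirProd) (use assms in auto)
    finally show ?thesis
      using assms nonpos by (simp add: G.int_pow_neg_int D.int_pow_neg_int)
  qed
qed

lemma partial_hom_closed:
  assumes "partial_hom G D \<Gamma>" "group G" "group D"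
  shows "(x, d) \<in> \<Gamma> \<Longrightarrow> x \<in> carrier G" "(x, d) \<in> \<Gamma> \<Longrightarrow> d \<in> carrier D"
    "(x, d) \<in> \<Gamma> \<Longrightarrow> (y, e) \<in> \<Gamma> \<Longrightarrow> (x \<otimes>\<^bsub>G\<^esub> y, d \<otimes>\<^bsub>D\<^esub> e) \<in> \<Gamma>"
    "(x, d) \<in> \<Gamma> \<Longrightarrow> (inv\<^bsub>G\<^esub> x, inv\<^bsub>D\<^esub> d) \<in> \<Gamma>"
    "(x, d) \<in> \<Gamma> \<Longrightarrow> (x [^]\<^bsub>G\<^esub> (k::int), d [^]\<^bsub>D\<^esub> k) \<in> \<Gamma>"
    "(x, d) \<in> \<Gamma> \<Longrightarrow> (x, d') \<in> \<Gamma> \<Longrightarrow> d = d'"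
proof -
  interpret G: group G by fact
  interpret D: group D by fact
  interpret GD: group "G \<times>\<times> D" by (rule DirProd_group[OF assms(2,3)])
  interpret S: subgroup \<Gamma> "G \<times>\<times> D" using assms(1) by (simp add: partial_hom_def)
  have *: "x \<in> carrier G \<and> d \<in> carrier D" if "(x, d) \<in> \<Gamma>" for x d
    using S.subset that by auto
  show "(x, d) \<in> \<Gamma> \<Longrightarrow> x \<in> carrier G" "(x, d) \<in> \<Gamma> \<Longrightarrow> d \<in> carrier D"
    using * by auto
  show m: "(x, d) \<in> \<Gamma> \<Longrightarrow> (y, e) \<in> \<Gamma> \<Longrightarrow> (x \<otimes>\<^bsub>G\<^esub> y, d \<otimes>\<^bsub>D\<^esub> e) \<in> \<Gamma>" for x d y e
    using S.m_closed by fastforce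
  show i: "(x, d) \<in> \<Gamma> \<Longrightarrow> (inv\<^bsub>G\<^esub> x, inv\<^bsub>D\<^esub> d) \<in> \<Gamma>" for x d
    using S.m_inv_closed * inv_DirProd[OF assms(2,3)] by metis
  show "(x, d) \<in> \<Gamma> \<Longrightarrow> (x [^]\<^bsub>G\<^esub> (k::int), d [^]\<^bsub>D\<^esub> k) \<in> \<Gamma>"
    using GD.subgroup_int_pow_closed[OF S.subgroup_axioms, of "(x,d)" k]
      int_pow_DirProd[OF assms(2,3)] * by metis
  show "d = d'" if "(x, d) \<in> \<Gamma>" "(x, d') \<in> \<Gamma>"
  proof -
    have "(\<one>\<^bsub>G\<^esub>, d \<otimes>\<^bsub>D\<^esub> inv\<^bsub>D\<^esub> d') \<in> \<Gamma>"
      using m[OF that(1) i[OF that(2)]] * that by auto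
    then have "d \<otimes>\<^bsub>D\<^esub> inv\<^bsub>D\<^esub> d' = \<one>\<^bsub>D\<^esub>"
      using assms(1) by (simp add: partial_hom_def)
    then show ?thesis using * that D.inv_solve_right[of "\<one>\<^bsub>D\<^esub>" d d'] by simp
  qed
qed

lemma total_partial_hom:
  assumes "partial_hom G D \<Gamma>" "group G" "group D" "\<And>x. x \<in> carrier G \<Longrightarrow> \<exists>d. (x, d) \<in> \<Gamma>"
  shows "\<exists>\<phi>\<in>hom G D. \<forall>(x, d)\<in>\<Gamma>. \<phi> x = d"
proof -
  note * = partial_hom_closed[OF assms(1-3)]
  define \<phi> where "\<phi> x = (SOME d. (x, d) \<in> \<Gamma>)" for x
  have \<phi>: "(x, \<phi> x) \<in> \<Gamma>" if "x \<in> carrier G" for x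
    unfolding \<phi>_def using assms(4)[OF that] by (rule someI_ex)
  have "\<phi> x = d" if "(x, d) \<in> \<Gamma>" for x d
    using *(6)[OF \<phi> that] *(1)[OF that] by blast
  moreover have "\<phi> \<in> hom G D"
  proof (rule homI)
    fix x y assume "x \<in> carrier G" "y \<in> carrier G"
    then show "\<phi> x \<in> carrier D" "\<phi> (x \<otimes>\<^bsub>G\<^esub> y) = \<phi> x \<otimes>\<^bsub>D\<^esub> \<phi> y"
      using *(2)[OF \<phi>] calculation[OF *(3)[OF \<phi> \<phi>]] by auto
  qed
  ultimately show ?thesis by blast
qed

text \<open>Baer's extension argument. Divisibility of the target is only demanded along the
  extensions of the given graph, so that it also covers targets of bounded exponent.\<close>

lemma extend_partial_hom:
  assumes "comm_group G" "comm_group D" "partial_hom G D \<Gamma>\<^sub>0"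
    and div: "\<And>\<Gamma> x k d. partial_hom G D \<Gamma> \<Longrightarrow> \<Gamma>\<^sub>0 \<subseteq> \<Gamma> \<Longrightarrow> x \<in> carrier G \<Longrightarrow> (k::int) > 0 \<Longrightarrow>
      (x [^]\<^bsub>G\<^esub> k, d) \<in> \<Gamma> \<Longrightarrow> \<exists>e\<in>carrier D. e [^]\<^bsub>D\<^esub> k = d"
  shows "\<exists>\<phi>\<in>hom G D. \<forall>(x, d)\<in>\<Gamma>\<^sub>0. \<phi> x = d"
proof -
  interpret G: comm_group G by fact
  interpret D: comm_group D by fact
  interpret GD: comm_group "G \<times>\<times> D" by (rule comm_group_DirProd[OF assms(1,2)])
  define \<A> where "\<A> = {\<Gamma>. partial_hom G D \<Gamma> \<and> \<Gamma>\<^sub>0 \<subseteq> \<Gamma>}"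
  have "\<exists>M\<in>\<A>. \<forall>Y\<in>\<A>. M \<subseteq> Y \<longrightarrow> Y = M"
  proof (rule subset_Zorn_nonempty)
    show "\<A> \<noteq> {}" using assms(3) by (auto simp: \<A>_def)
    fix \<C> assume ne: "\<C> \<noteq> {}" and ch: "subset.chain \<A> \<C>"
    have C: "partial_hom G D Y" "\<Gamma>\<^sub>0 \<subseteq> Y" if "Y \<in> \<C>" for Y
      using ch that by (auto simp: subset.chain_def \<A>_def)
    have sub: "subgroup Y (G \<times>\<times> D)" if "Y \<in> \<C>" for Y
      using C[OF that] by (auto simp: partial_hom_def)
    have "subgroup (\<Union>\<C>) (G \<times>\<times> D)"
    proof (rule GD.subgroupI)
      show "\<Union>\<C> \<subseteq> carrier (G \<times>\<times> D)" using sub subgroup.subset by blast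
      show "\<Union>\<C> \<noteq> {}" using ne subgroup.one_closed[OF sub] by blast
      show "\<And>a. a \<in> \<Union>\<C> \<Longrightarrow> inv\<^bsub>G \<times>\<times> D\<^esub> a \<in> \<Union>\<C>"
        using subgroup.m_inv_closed[OF sub] by blast
      fix a a' assume "a \<in> \<Union>\<C>" "a' \<in> \<Union>\<C>"
      then obtain Y Y' where "Y \<in> \<C>" "Y' \<in> \<C>" "a \<in> Y" "a' \<in> Y'" by auto
      then have "\<exists>Z\<in>\<C>. a \<in> Z \<and> a' \<in> Z"
        using ch unfolding subset.chain_def by blast
      then show "a \<otimes>\<^bsub>G \<times>\<times> D\<^esub> a' \<in> \<Union>\<C>"
        using subgroup.m_closed[OF sub] by blast
    qed
    then show "\<Union>\<C> \<in> \<A>"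
      using C ne unfolding \<A>_def partial_hom_def by blast
  qed
  then obtain \<Gamma> where "\<Gamma> \<in> \<A>" and max\<A>: "\<And>Y. Y \<in> \<A> \<Longrightarrow> \<Gamma> \<subseteq> Y \<Longrightarrow> Y = \<Gamma>"
    by metis
  then have \<Gamma>: "partial_hom G D \<Gamma>" "\<Gamma>\<^sub>0 \<subseteq> \<Gamma>"
    by (simp_all add: \<A>_def)
  have max: "Y = \<Gamma>" if "partial_hom G D Y" "\<Gamma> \<subseteq> Y" for Y
    using max\<A>[of Y] that \<Gamma>(2) by (simp add: \<A>_def)
  note cl = partial_hom_closed[OF \<Gamma>(1) G.group_axioms D.group_axioms]
  have "\<exists>d. (x, d) \<in> \<Gamma>" if x: "x \<in> carrier G" for x
  proof -
    \<comment> \<open>A value \<open>e\<close> for \<open>x\<close> has to respect the values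
      already fixed on powers of \<open>x\<close>. If no positive power lies in the domain, the
      identity will do; otherwise all exponents that occur are multiples of the least positive one,
      \<open>k\<close>, and any \<open>k\<close>-th root of the value \<open>d\<^sub>0\<close> is
      compatible.\<close>
    have "\<exists>e\<in>carrier D. \<forall>j d. (x [^]\<^bsub>G\<^esub> (j::int), d) \<in> \<Gamma> \<longrightarrow> d = e [^]\<^bsub>D\<^esub> j"
    proof (cases "\<exists>k::nat. k > 0 \<and> (\<exists>d. (x [^]\<^bsub>G\<^esub> int k, d) \<in> \<Gamma>)")
      case False
      have "d = \<one>\<^bsub>D\<^esub>" if j: "(x [^]\<^bsub>G\<^esub> (j::int), d) \<in> \<Gamma>" for j d
      proof -
        have "\<not> j > 0" using False j by (metis zero_less_imp_eq_int)
        moreover have "\<not> - j > 0"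
          using False cl(4)[OF j] x by (metis G.int_pow_neg zero_less_imp_eq_int)
        ultimately have "j = 0" by simp
        then show ?thesis using \<Gamma>(1) j by (simp add: partial_hom_def)
      qed
      then have "\<forall>j d. (x [^]\<^bsub>G\<^esub> (j::int), d) \<in> \<Gamma> \<longrightarrow> d = \<one>\<^bsub>D\<^esub> [^]\<^bsub>D\<^esub> j"
        by (metis D.int_pow_one)
      then show ?thesis by blast
    next
      case True
      define k where "k = (LEAST k::nat. k > 0 \<and> (\<exists>d. (x [^]\<^bsub>G\<^esub> int k, d) \<in> \<Gamma>))"
      have k: "k > 0" "\<exists>d. (x [^]\<^bsub>G\<^esub> int k, d) \<in> \<Gamma>"
        using LeastI_ex[OF True] unfolding k_def by simp_all
      have least: "l = 0" if "l < k" "(x [^]\<^bsub>G\<^esub> int l, d) \<in> \<Gamma>" for l d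
        using not_less_Least[OF that(1)[unfolded k_def]] that(2) by (metis gr0I)
      obtain d\<^sub>0 where d\<^sub>0: "(x [^]\<^bsub>G\<^esub> int k, d\<^sub>0) \<in> \<Gamma>" using k by blast
      obtain e where e: "e \<in> carrier D" "e [^]\<^bsub>D\<^esub> int k = d\<^sub>0"
        using div[OF \<Gamma> x _ d\<^sub>0] k by auto
      have "d = e [^]\<^bsub>D\<^esub> j" if j: "(x [^]\<^bsub>G\<^esub> (j::int), d) \<in> \<Gamma>" for j d
      proof -
        define q where "q = j div int k"
        have "(x [^]\<^bsub>G\<^esub> j \<otimes>\<^bsub>G\<^esub> (x [^]\<^bsub>G\<^esub> int k) [^]\<^bsub>G\<^esub> (-q), d \<otimes>\<^bsub>D\<^esub> d\<^sub>0 [^]\<^bsub>D\<^esub> (-q)) \<in> \<Gamma>"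
          by (intro cl(3,5) j d\<^sub>0)
        moreover have "x [^]\<^bsub>G\<^esub> j \<otimes>\<^bsub>G\<^esub> (x [^]\<^bsub>G\<^esub> int k) [^]\<^bsub>G\<^esub> (-q) = x [^]\<^bsub>G\<^esub> (j mod int k)"
          using x by (simp add: G.int_pow_pow q_def minus_mult_div_eq_mod flip: G.int_pow_mult)
        moreover have "j mod int k = int (nat (j mod int k))" "nat (j mod int k) < k"
          using k by (auto simp: nat_less_iff)
        ultimately have mem: "(x [^]\<^bsub>G\<^esub> int (nat (j mod int k)), d \<otimes>\<^bsub>D\<^esub> d\<^sub>0 [^]\<^bsub>D\<^esub> (-q)) \<in> \<Gamma>"
          by simp
        then have "nat (j mod int k) = 0"
          using least \<open>nat (j mod int k) < k\<close> by blast
        then have jk: "j = int k * q"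
          using \<open>j mod int k = int (nat (j mod int k))\<close> mult_div_mod_eq[of "int k" j] by (simp add: q_def)
        have "d \<otimes>\<^bsub>D\<^esub> d\<^sub>0 [^]\<^bsub>D\<^esub> (-q) = \<one>\<^bsub>D\<^esub>"
          using mem \<Gamma>(1) \<open>nat (j mod int k) = 0\<close> by (simp add: partial_hom_def)
        then have "d = d\<^sub>0 [^]\<^bsub>D\<^esub> q"
          using cl(2)[OF j] cl(2)[OF d\<^sub>0] D.inv_solve_right[of "\<one>\<^bsub>D\<^esub>" d "d\<^sub>0 [^]\<^bsub>D\<^esub> q"]
          by (simp add: D.int_pow_neg)
        then show ?thesis using D.int_pow_pow[OF e(1), of "int k" q] e(2) jk by simp
      qed
      then show ?thesis by (intro bexI[OF _ e(1)]) simp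
    qed
    then obtain e where e: "e \<in> carrier D" and eq: "\<And>j d. (x [^]\<^bsub>G\<^esub> (j::int), d) \<in> \<Gamma> \<Longrightarrow> d = e [^]\<^bsub>D\<^esub> j"
      by auto
    have sub: "subgroup \<Gamma> (G \<times>\<times> D)" using \<Gamma>(1) by (simp add: partial_hom_def)
    \<comment> \<open>By the choice of \<open>e\<close>, adjoining the cyclic group generated by
      \<open>(x, e)\<close> keeps the graph single-valued; maximality then shows that
      \<open>x\<close> was in the domain already.\<close>
    define K where "K = generate (G \<times>\<times> D) {(x, e)}"
    have K: "K = {(x [^]\<^bsub>G\<^esub> (j::int), e [^]\<^bsub>D\<^esub> j) | j. True}"
      unfolding K_def using GD.generate_pow[of "(x, e)"] x e
      by (auto simp: int_pow_DirProd[OF G.group_axioms D.group_axioms])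
    have subK: "subgroup K (G \<times>\<times> D)"
      unfolding K_def by (rule GD.generate_is_subgroup) (use x e in auto)
    have "partial_hom G D (\<Gamma> <#>\<^bsub>G \<times>\<times> D\<^esub> K)"
      unfolding partial_hom_def
    proof (intro conjI allI impI)
      show "subgroup (\<Gamma> <#>\<^bsub>G \<times>\<times> D\<^esub> K) (G \<times>\<times> D)" by (rule GD.mult_subgroups[OF sub subK])
      fix y assume "(\<one>\<^bsub>G\<^esub>, y) \<in> \<Gamma> <#>\<^bsub>G \<times>\<times> D\<^esub> K"
      then obtain a d j where ad: "(a, d) \<in> \<Gamma>" and one: "\<one>\<^bsub>G\<^esub> = a \<otimes>\<^bsub>G\<^esub> x [^]\<^bsub>G\<^esub> (j::int)"
        and y: "y = d \<otimes>\<^bsub>D\<^esub> e [^]\<^bsub>D\<^esub> j"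
        by (auto simp: set_mult_def K)
      have "a = x [^]\<^bsub>G\<^esub> (-j)"
        using one cl(1)[OF ad] x G.inv_equality[of a "x [^]\<^bsub>G\<^esub> j"] by (simp add: G.int_pow_neg)
      then have "d = e [^]\<^bsub>D\<^esub> (-j)" using eq ad by blast
      then show "y = \<one>\<^bsub>D\<^esub>" using y e by (simp flip: D.int_pow_mult)
    qed
    moreover have "\<Gamma> \<subseteq> \<Gamma> <#>\<^bsub>G \<times>\<times> D\<^esub> K" "K \<subseteq> \<Gamma> <#>\<^bsub>G \<times>\<times> D\<^esub> K"
      by (rule GD.subgroup_subset_set_mult[OF sub subK])+
    ultimately have "K \<subseteq> \<Gamma>" using max[of "\<Gamma> <#>\<^bsub>G \<times>\<times> D\<^esub> K"] by simp
    moreover have "(x, e) \<in> K"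
      unfolding K_def by (simp add: generate.incl)
    ultimately show ?thesis by (meson subsetD)
  qed
  then obtain \<phi> where "\<phi> \<in> hom G D" "\<forall>(x, d)\<in>\<Gamma>. \<phi> x = d"
    using total_partial_hom[OF \<Gamma>(1) G.group_axioms D.group_axioms] by metis
  then show ?thesis using \<Gamma>(2) by (meson subsetD)
qed

definition divisible_group :: "('a, 'm) monoid_scheme \<Rightarrow> bool" where
  "divisible_group D \<longleftrightarrow> (\<forall>d\<in>carrier D. \<forall>k::int. k > 0 \<longrightarrow> (\<exists>e\<in>carrier D. e [^]\<^bsub>D\<^esub> k = d))"

lemma divisible_extend_hom:
  assumes "comm_group G" "comm_group D" "partial_hom G D \<Gamma>" "divisible_group D"
  shows "\<exists>\<phi>\<in>hom G D. \<forall>(x, d)\<in>\<Gamma>. \<phi> x = d"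
proof (rule extend_partial_hom[OF assms(1-3)])
  interpret G: comm_group G by fact
  interpret D: comm_group D by fact
  fix \<Delta> x d and k :: int assume "partial_hom G D \<Delta>" "k > 0" "(x [^]\<^bsub>G\<^esub> k, d) \<in> \<Delta>"
  then have "d \<in> carrier D"
    using partial_hom_closed(2)[OF _ G.group_axioms D.group_axioms] by simp
  then show "\<exists>e\<in>carrier D. e [^]\<^bsub>D\<^esub> k = d"
    using assms(4) \<open>k > 0\<close> by (simp add: divisible_group_def)
qed

text \<open>Single-valuedness: a combination of the \<open>b i\<close> that falls into
  \<open>Q\<close> has coefficients divisible by the \<open>r i\<close>, and these annihilate the
  \<open>d i\<close>.\<close>

lemma partial_hom_lincomb:
  assumes "comm_group G" "comm_group D" "subgroup Q G" "independent_mod G Q r b"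
    and d: "\<And>i. d i \<in> carrier D" "\<And>i. d i [^]\<^bsub>D\<^esub> r i = \<one>\<^bsub>D\<^esub>"
  shows "partial_hom G D {(lincomb G b c n \<otimes>\<^bsub>G\<^esub> q, lincomb D d c n) | c n q. q \<in> Q}"
    (is "partial_hom G D ?\<Gamma>")
proof -
  interpret G: comm_group G by fact
  interpret D: comm_group D by fact
  interpret Q: subgroup Q G by fact
  interpret GD: comm_group "G \<times>\<times> D" by (rule comm_group_DirProd[OF assms(1,2)])
  note b = independent_modD[OF assms(4)]
  have "subgroup ?\<Gamma> (G \<times>\<times> D)"
  proof (rule GD.subgroupI)
    show "?\<Gamma> \<subseteq> carrier (G \<times>\<times> D)" using b d by auto
    show "?\<Gamma> \<noteq> {}" using Q.one_closed by blast
  next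
    fix a assume "a \<in> ?\<Gamma>"
    then obtain c n q where a: "a = (lincomb G b c n \<otimes>\<^bsub>G\<^esub> q, lincomb D d c n)" and q: "q \<in> Q"
      by auto
    have "inv\<^bsub>G \<times>\<times> D\<^esub> a = (inv\<^bsub>G\<^esub> (lincomb G b c n \<otimes>\<^bsub>G\<^esub> q), inv\<^bsub>D\<^esub> lincomb D d c n)"
      unfolding a by (rule inv_DirProd) (use b d q in auto)
    also have "\<dots> = (lincomb G b (\<lambda>i. - c i) n \<otimes>\<^bsub>G\<^esub> inv\<^bsub>G\<^esub> q, lincomb D d (\<lambda>i. - c i) n)"
      using b d q by (simp add: G.inv_mult G.lincomb_inv D.lincomb_inv)
    finally show "inv\<^bsub>G \<times>\<times> D\<^esub> a \<in> ?\<Gamma>"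
      using Q.m_inv_closed[OF q] by (auto intro!: exI)
  next
    fix a a' assume "a \<in> ?\<Gamma>" "a' \<in> ?\<Gamma>"
    then obtain c n q c' n' q' where
      a: "a = (lincomb G b c n \<otimes>\<^bsub>G\<^esub> q, lincomb D d c n)" and q: "q \<in> Q"
      and a': "a' = (lincomb G b c' n' \<otimes>\<^bsub>G\<^esub> q', lincomb D d c' n')" and q': "q' \<in> Q"
      by auto
    define m where "m = max n n'"
    define e where "e i = (if i < n then c i else 0)" for i
    define e' where "e' i = (if i < n' then c' i else 0)" for i
    have "lincomb G b c n = lincomb G b e m" "lincomb D d c n = lincomb D d e m"
      unfolding e_def m_def using b d by (auto intro!: G.lincomb_extend D.lincomb_extend)
    moreover have "lincomb G b c' n' = lincomb G b e' m" "lincomb D d c' n' = lincomb D d e' m"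
      unfolding e'_def m_def using b d by (auto intro!: G.lincomb_extend D.lincomb_extend)
    ultimately have "a \<otimes>\<^bsub>G \<times>\<times> D\<^esub> a' =
        (lincomb G b e m \<otimes>\<^bsub>G\<^esub> lincomb G b e' m \<otimes>\<^bsub>G\<^esub> (q \<otimes>\<^bsub>G\<^esub> q'), lincomb D d e m \<otimes>\<^bsub>D\<^esub> lincomb D d e' m)"
      using b q q' by (simp add: a a' G.m_ac)
    also have "\<dots> = (lincomb G b (\<lambda>i. e i + e' i) m \<otimes>\<^bsub>G\<^esub> (q \<otimes>\<^bsub>G\<^esub> q'), lincomb D d (\<lambda>i. e i + e' i) m)"
      using b d by (simp add: G.lincomb_add D.lincomb_add)
    finally show "a \<otimes>\<^bsub>G \<times>\<times> D\<^esub> a' \<in> ?\<Gamma>"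
      using Q.m_closed[OF q q'] by (auto intro!: exI)
  qed
  moreover have "y = \<one>\<^bsub>D\<^esub>" if "(\<one>\<^bsub>G\<^esub>, y) \<in> ?\<Gamma>" for y
  proof -
    from that obtain c n q where one: "\<one>\<^bsub>G\<^esub> = lincomb G b c n \<otimes>\<^bsub>G\<^esub> q" and y: "y = lincomb D d c n"
      and q: "q \<in> Q"
      by auto
    have "lincomb G b c n = inv\<^bsub>G\<^esub> q"
      using one q b by (intro G.inv_equality[symmetric]) auto
    then have "lincomb G b c n \<in> Q" using q by simp
    then show ?thesis
      unfolding y by (intro D.lincomb_one) (rule D.int_pow_dvd_one[OF d b(3)])
  qed
  ultimately show ?thesis by (simp add: partial_hom_def)
qed

lemma lincomb_graph_memI:
  assumes "comm_group G" "comm_group D" "subgroup Q G" "\<And>i. b i \<in> carrier G" "\<And>i. d i \<in> carrier D"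
  shows "(b i, d i) \<in> {(lincomb G b c n \<otimes>\<^bsub>G\<^esub> q, lincomb D d c n) | c n q. q \<in> Q}"
    "q \<in> Q \<Longrightarrow> (q, \<one>\<^bsub>D\<^esub>) \<in> {(lincomb G b c n \<otimes>\<^bsub>G\<^esub> q, lincomb D d c n) | c n q. q \<in> Q}"
proof -
  interpret G: comm_group G by fact
  interpret D: comm_group D by fact
  interpret Q: subgroup Q G by fact
  let ?c = "\<lambda>j. if j = i then 1 else 0 :: int"
  have "b i = lincomb G b ?c (Suc i) \<otimes>\<^bsub>G\<^esub> \<one>\<^bsub>G\<^esub>"
    using assms(4) G.lincomb_single[of b i "Suc i" 1] by (simp del: lincomb.simps)
  moreover have "d i = lincomb D d ?c (Suc i)"
    using assms(5) D.lincomb_single[of d i "Suc i" 1] by (simp del: lincomb.simps)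
  ultimately show "(b i, d i) \<in> {(lincomb G b c n \<otimes>\<^bsub>G\<^esub> q, lincomb D d c n) | c n q. q \<in> Q}"
    using Q.one_closed by blast
  assume q: "q \<in> Q"
  have "q = lincomb G b c 0 \<otimes>\<^bsub>G\<^esub> q" "\<one>\<^bsub>D\<^esub> = lincomb D d c 0" for c
    using q by auto
  with q show "(q, \<one>\<^bsub>D\<^esub>) \<in> {(lincomb G b c n \<otimes>\<^bsub>G\<^esub> q, lincomb D d c n) | c n q. q \<in> Q}"
    by blast
qed

text \<open>All extensions met in \<open>div\<close> still send \<open>Q\<close> to the identity.
  Roots are thus only needed for values compatible with killing \<open>Q\<close>, which is how a
  target of bounded exponent becomes admissible.\<close>

lemma hom_of_independent:
  assumes "comm_group G" "comm_group D" "subgroup Q G" "independent_mod G Q r b"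
    and d: "\<And>i. d i \<in> carrier D" "\<And>i. d i [^]\<^bsub>D\<^esub> r i = \<one>\<^bsub>D\<^esub>"
    and div: "\<And>\<Gamma> x k y. partial_hom G D \<Gamma> \<Longrightarrow> Q \<times> {\<one>\<^bsub>D\<^esub>} \<subseteq> \<Gamma> \<Longrightarrow> x \<in> carrier G \<Longrightarrow> (k::int) > 0 \<Longrightarrow>
      (x [^]\<^bsub>G\<^esub> k, y) \<in> \<Gamma> \<Longrightarrow> \<exists>e\<in>carrier D. e [^]\<^bsub>D\<^esub> k = y"
  shows "\<exists>\<phi>\<in>hom G D. (\<forall>i. \<phi> (b i) = d i) \<and> (\<forall>q\<in>Q. \<phi> q = \<one>\<^bsub>D\<^esub>)"
proof -
  let ?\<Gamma> = "{(lincomb G b c n \<otimes>\<^bsub>G\<^esub> q, lincomb D d c n) | c n q. q \<in> Q}"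
  note mem = lincomb_graph_memI[of G D Q b d, OF assms(1-3) independent_modD(1)[OF assms(4)] d(1)]
  have "Q \<times> {\<one>\<^bsub>D\<^esub>} \<subseteq> ?\<Gamma>" using mem(2) by blast
  then have "\<exists>\<phi>\<in>hom G D. \<forall>(x, y)\<in>?\<Gamma>. \<phi> x = y"
    by (intro extend_partial_hom[OF assms(1,2) partial_hom_lincomb[OF assms(1-4) d]])
      (rule div, auto)
  then obtain \<phi> where "\<phi> \<in> hom G D" and \<phi>: "\<forall>(x, y)\<in>?\<Gamma>. \<phi> x = y" by auto
  moreover have "\<phi> (b i) = d i" for i using bspec[OF \<phi> mem(1)] by simp
  moreover have "\<phi> q = \<one>\<^bsub>D\<^esub>" if "q \<in> Q" for q using bspec[OF \<phi> mem(2)[OF that]] by simp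
  ultimately show ?thesis by blast
qed

lemma divisible_hom_of_independent:
  assumes "comm_group G" "comm_group D" "independent_mod G {\<one>\<^bsub>G\<^esub>} r b" "divisible_group D"
    and "\<And>i. d i \<in> carrier D" "\<And>i. d i [^]\<^bsub>D\<^esub> r i = \<one>\<^bsub>D\<^esub>"
  shows "\<exists>\<phi>\<in>hom G D. \<forall>i. \<phi> (b i) = d i"
proof -
  interpret G: comm_group G by fact
  interpret D: comm_group D by fact
  have "\<exists>\<phi>\<in>hom G D. (\<forall>i. \<phi> (b i) = d i) \<and> (\<forall>q\<in>{\<one>\<^bsub>G\<^esub>}. \<phi> q = \<one>\<^bsub>D\<^esub>)"
  proof (rule hom_of_independent[OF assms(1,2) G.triv_subgroup assms(3,5,6)])
    fix \<Gamma> x y and k :: int assume "partial_hom G D \<Gamma>" "k > 0" "(x [^]\<^bsub>G\<^esub> k, y) \<in> \<Gamma>"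
    then have "y \<in> carrier D"
      using partial_hom_closed(2)[OF _ G.group_axioms D.group_axioms] by simp
    then show "\<exists>e\<in>carrier D. e [^]\<^bsub>D\<^esub> k = y"
      using assms(4) \<open>k > 0\<close> by (simp add: divisible_group_def)
  qed
  then show ?thesis by auto
qed

section \<open>Obstructions to being Bassian\<close>

text \<open>The embedding of \<open>G\<close> into \<open>G / (M \<inter> ker \<pi>)\<close> sends \<open>g\<close> to the coset
  of those \<open>x \<in> g + M\<close> with \<open>\<pi> x = \<psi> g\<close>.\<close>

lemma not_BassianI:
  assumes "comm_group G" "comm_group D" "subgroup M G" "\<pi> \<in> hom G D" "\<psi> \<in> hom G D"
    and surj: "\<And>y. y \<in> carrier D \<Longrightarrow> \<exists>m\<in>M. \<pi> m = y"
    and h: "h \<in> M" "h \<noteq> \<one>\<^bsub>G\<^esub>" "\<pi> h = \<one>\<^bsub>D\<^esub>"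
    and inj: "\<And>m. m \<in> M \<Longrightarrow> \<psi> m = \<one>\<^bsub>D\<^esub> \<Longrightarrow> m = \<one>\<^bsub>G\<^esub>"
  shows "\<not> Bassian G"
proof -
  interpret G: comm_group G by fact
  interpret D: comm_group D by fact
  interpret M: subgroup M G by fact
  interpret \<pi>: group_hom G D \<pi> using assms by unfold_locales
  interpret \<psi>: group_hom G D \<psi> using assms by unfold_locales
  define H where "H = {m \<in> M. \<pi> m = \<one>\<^bsub>D\<^esub>}"
  have subH: "subgroup H G"
  proof (rule G.subgroupI)
    have "\<one>\<^bsub>G\<^esub> \<in> H" by (simp add: H_def)
    then show "H \<noteq> {}" by blast
  qed (auto simp: H_def)
  interpret H: normal H G using G.normal_iff_subgroup subH by simp
  interpret GH: group "G Mod H" by (rule H.factorgroup_is_group)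
  \<comment> \<open>\<open>\<mu> g\<close> corrects \<open>g\<close> inside \<open>M\<close> so that
    \<open>\<pi>\<close> maps \<open>T g\<close> to \<open>\<psi> g\<close>. Two possible
    corrections differ by an element of \<open>H\<close>, so the coset of \<open>T g\<close> does
    not depend on the choice.\<close>
  define \<mu> where "\<mu> g = (SOME m. m \<in> M \<and> \<pi> m = \<psi> g \<otimes>\<^bsub>D\<^esub> inv\<^bsub>D\<^esub> \<pi> g)" for g
  have \<mu>: "\<mu> g \<in> M" "\<pi> (\<mu> g) = \<psi> g \<otimes>\<^bsub>D\<^esub> inv\<^bsub>D\<^esub> \<pi> g" if "g \<in> carrier G" for g
  proof -
    have "\<exists>m. m \<in> M \<and> \<pi> m = \<psi> g \<otimes>\<^bsub>D\<^esub> inv\<^bsub>D\<^esub> \<pi> g"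
      using surj[of "\<psi> g \<otimes>\<^bsub>D\<^esub> inv\<^bsub>D\<^esub> \<pi> g"] that by auto
    then show "\<mu> g \<in> M" "\<pi> (\<mu> g) = \<psi> g \<otimes>\<^bsub>D\<^esub> inv\<^bsub>D\<^esub> \<pi> g"
      unfolding \<mu>_def by (auto dest!: someI_ex)
  qed
  define T where "T g = \<mu> g \<otimes>\<^bsub>G\<^esub> g" for g
  have T: "T g \<in> carrier G" "\<pi> (T g) = \<psi> g" if "g \<in> carrier G" for g
    using \<mu>[OF that] that by (auto simp: T_def D.m_assoc)
  have eqI: "H #>\<^bsub>G\<^esub> x = H #>\<^bsub>G\<^esub> y" if "x \<otimes>\<^bsub>G\<^esub> inv\<^bsub>G\<^esub> y \<in> H" "x \<in> carrier G" "y \<in> carrier G" for x y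
  proof -
    have "x = (x \<otimes>\<^bsub>G\<^esub> inv\<^bsub>G\<^esub> y) \<otimes>\<^bsub>G\<^esub> y" using that by (simp add: G.m_assoc)
    then have "x \<in> H #>\<^bsub>G\<^esub> y" using that(1) unfolding r_coset_def by blast
    then show ?thesis using G.repr_independence[OF _ that(3) H.subgroup_axioms] by simp
  qed
  have "(\<lambda>g. H #>\<^bsub>G\<^esub> T g) \<in> hom G (G Mod H)"
  proof (rule homI)
    fix x y assume x: "x \<in> carrier G" and y: "y \<in> carrier G"
    show "H #>\<^bsub>G\<^esub> T x \<in> carrier (G Mod H)" using T[OF x] by (auto simp: carrier_FactGroup)
    \<comment> \<open>The factors \<open>x\<close> and \<open>y\<close> cancel, so this quotient
      lies in \<open>M\<close>; it is killed by \<open>\<pi>\<close> because \<open>\<pi>\<close>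
      composed with \<open>T\<close> is the homomorphism \<open>\<psi>\<close>.\<close>
    have "T (x \<otimes>\<^bsub>G\<^esub> y) \<otimes>\<^bsub>G\<^esub> inv\<^bsub>G\<^esub> (T x \<otimes>\<^bsub>G\<^esub> T y) = \<mu> (x \<otimes>\<^bsub>G\<^esub> y) \<otimes>\<^bsub>G\<^esub> inv\<^bsub>G\<^esub> (\<mu> x \<otimes>\<^bsub>G\<^esub> \<mu> y)"
    proof -
      have "T x \<otimes>\<^bsub>G\<^esub> T y = (\<mu> x \<otimes>\<^bsub>G\<^esub> \<mu> y) \<otimes>\<^bsub>G\<^esub> (x \<otimes>\<^bsub>G\<^esub> y)"
        using \<mu>[OF x] \<mu>[OF y] x y by (simp add: T_def G.m_ac)
      then show ?thesis
        using \<mu>[OF x] \<mu>[OF y] \<mu>(1)[of "x \<otimes>\<^bsub>G\<^esub> y"] x y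
        by (simp add: T_def G.inv_mult_group G.m_assoc[symmetric]) (simp add: G.m_assoc)
    qed
    moreover have "\<pi> (T (x \<otimes>\<^bsub>G\<^esub> y) \<otimes>\<^bsub>G\<^esub> inv\<^bsub>G\<^esub> (T x \<otimes>\<^bsub>G\<^esub> T y)) = \<one>\<^bsub>D\<^esub>"
      using T[OF x] T[OF y] T[of "x \<otimes>\<^bsub>G\<^esub> y"] x y by simp
    ultimately have "T (x \<otimes>\<^bsub>G\<^esub> y) \<otimes>\<^bsub>G\<^esub> inv\<^bsub>G\<^esub> (T x \<otimes>\<^bsub>G\<^esub> T y) \<in> H"
      using \<mu>(1)[OF x] \<mu>(1)[OF y] \<mu>(1)[of "x \<otimes>\<^bsub>G\<^esub> y"] x y by (simp add: H_def)
    then have "H #>\<^bsub>G\<^esub> T (x \<otimes>\<^bsub>G\<^esub> y) = H #>\<^bsub>G\<^esub> (T x \<otimes>\<^bsub>G\<^esub> T y)"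
      using T x y by (intro eqI) auto
    then show "H #>\<^bsub>G\<^esub> T (x \<otimes>\<^bsub>G\<^esub> y) = (H #>\<^bsub>G\<^esub> T x) \<otimes>\<^bsub>G Mod H\<^esub> (H #>\<^bsub>G\<^esub> T y)"
      using T x y by (simp add: H.rcos_sum)
  qed
  moreover have "inj_on (\<lambda>g. H #>\<^bsub>G\<^esub> T g) (carrier G)"
  proof -
    interpret \<theta>: group_hom G "G Mod H" "\<lambda>g. H #>\<^bsub>G\<^esub> T g" using calculation by unfold_locales
    \<comment> \<open>From \<open>T g\<close> in \<open>H\<close> it follows that \<open>g\<close>
      lies in \<open>M\<close>, as \<open>\<mu> g\<close> does, and that \<open>\<psi> g\<close>,
      being the image of \<open>T g\<close> under \<open>\<pi>\<close>, is trivial. So injectivity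
      of \<open>\<psi>\<close> on \<open>M\<close> applies.\<close>
    have "g = \<one>\<^bsub>G\<^esub>" if g: "g \<in> carrier G" "H #>\<^bsub>G\<^esub> T g = H" for g
    proof -
      have "T g \<in> H" using G.coset_join1[OF g(2) T(1)[OF g(1)] H.subgroup_axioms] .
      then have "T g \<in> M" "\<psi> g = \<one>\<^bsub>D\<^esub>" using T(2)[OF g(1)] by (auto simp: H_def)
      then have "inv\<^bsub>G\<^esub> \<mu> g \<otimes>\<^bsub>G\<^esub> T g \<in> M" using \<mu>[OF g(1)] by simp
      then have "g \<in> M" using \<mu>(1)[OF g(1)] g(1) by (simp add: T_def G.m_assoc[symmetric])
      then show ?thesis using inj \<open>\<psi> g = \<one>\<^bsub>D\<^esub>\<close> by simp
    qed
    then show ?thesis by (subst \<theta>.inj_on_one_iff) simp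
  qed
  moreover have "H \<noteq> {\<one>\<^bsub>G\<^esub>}" using h by (auto simp: H_def)
  ultimately show ?thesis using subH unfolding Bassian_def by blast
qed

text \<open>Needed for two exponents: \<open>j = 1\<close> gives a retraction of \<open>G\<close>
  onto \<open>N\<close>, and larger \<open>j\<close> an extension of a surjective power map of
  \<open>N\<close> that may have a kernel.\<close>

lemma divisible_subgroup_extend_int_pow:
  assumes "comm_group G" "subgroup N G" "divisible_group (G\<lparr>carrier := N\<rparr>)"
  shows "\<exists>\<phi>\<in>hom G (G\<lparr>carrier := N\<rparr>). \<forall>x\<in>N. \<phi> x = x [^]\<^bsub>G\<^esub> (j::int)"
proof -
  interpret G: comm_group G by fact
  interpret N: subgroup N G by fact
  let ?N = "G\<lparr>carrier := N\<rparr>"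
  have cN: "comm_group ?N" by (rule G.subgroup_comm_group[OF assms(2)])
  interpret GN: comm_group "G \<times>\<times> ?N" by (rule comm_group_DirProd[OF assms(1) cN])
  let ?\<Gamma> = "(\<lambda>x. (x, x [^]\<^bsub>G\<^esub> j)) ` N"
  have "subgroup ?\<Gamma> (G \<times>\<times> ?N)"
  proof (rule GN.subgroupI)
    show "?\<Gamma> \<subseteq> carrier (G \<times>\<times> ?N)"
      using G.subgroup_int_powI[OF assms(2)] by auto
    show "?\<Gamma> \<noteq> {}" using N.one_closed by blast
    fix a assume "a \<in> ?\<Gamma>"
    then obtain x where a: "a = (x, x [^]\<^bsub>G\<^esub> j)" and x: "x \<in> N" by auto
    have "inv\<^bsub>G \<times>\<times> ?N\<^esub> a = (inv\<^bsub>G\<^esub> x, inv\<^bsub>?N\<^esub> (x [^]\<^bsub>G\<^esub> j))"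
      unfolding a by (rule inv_DirProd)
        (use x cN G.subgroup_int_powI[OF assms(2)] comm_group.axioms(2) in auto)
    then show "inv\<^bsub>G \<times>\<times> ?N\<^esub> a \<in> ?\<Gamma>"
      using x G.m_inv_consistent[OF assms(2)] G.subgroup_int_powI[OF assms(2) x]
      by (auto simp: G.int_pow_inv intro!: image_eqI[where x="inv\<^bsub>G\<^esub> x"])
    fix a' assume "a' \<in> ?\<Gamma>"
    then obtain x' where "a' = (x', x' [^]\<^bsub>G\<^esub> j)" "x' \<in> N" by auto
    then show "a \<otimes>\<^bsub>G \<times>\<times> ?N\<^esub> a' \<in> ?\<Gamma>"
      using a x by (auto simp: G.int_pow_distrib)
  qed
  then have "partial_hom G ?N ?\<Gamma>" by (auto simp: partial_hom_def)
  from divisible_extend_hom[OF assms(1) cN this assms(3)] show ?thesis by auto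
qed

text \<open>The embedding principle with \<open>M = N\<close>: \<open>\<pi>\<close> extends the
  \<open>k\<close>-th power map, which is onto \<open>N\<close> by divisibility and kills
  \<open>h\<close>, while \<open>\<psi>\<close> extends the identity.\<close>

lemma not_Bassian_divisible_subgroup:
  assumes "comm_group G" "subgroup N G" "divisible_group (G\<lparr>carrier := N\<rparr>)"
    and k: "(k::int) > 0" and h: "h \<in> N" "h \<noteq> \<one>\<^bsub>G\<^esub>" "h [^]\<^bsub>G\<^esub> k = \<one>\<^bsub>G\<^esub>"
  shows "\<not> Bassian G"
proof -
  interpret G: comm_group G by fact
  interpret N: subgroup N G by fact
  let ?N = "G\<lparr>carrier := N\<rparr>"
  have cN: "comm_group ?N" by (rule G.subgroup_comm_group[OF assms(2)])
  note ext = divisible_subgroup_extend_int_pow[OF assms(1-3)]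
  obtain \<pi> where \<pi>: "\<pi> \<in> hom G ?N" "\<forall>x\<in>N. \<pi> x = x [^]\<^bsub>G\<^esub> k" using ext by blast
  obtain \<psi> where \<psi>: "\<psi> \<in> hom G ?N" "\<forall>x\<in>N. \<psi> x = x [^]\<^bsub>G\<^esub> (1::int)" using ext by blast
  show ?thesis
  proof (rule not_BassianI[OF assms(1) cN assms(2) \<pi>(1) \<psi>(1) _ h(1,2)])
    show "\<exists>m\<in>N. \<pi> m = y" if "y \<in> carrier ?N" for y
      using assms(3) k that \<pi>(2) G.subgroup_int_pow_eq[OF assms(2)]
      by (auto simp: divisible_group_def)
    show "\<pi> h = \<one>\<^bsub>?N\<^esub>" using \<pi>(2) h by simp
    show "m = \<one>\<^bsub>G\<^esub>" if "m \<in> N" "\<psi> m = \<one>\<^bsub>?N\<^esub>" for m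
      using \<psi>(2) that by simp
  qed
qed

text \<open>\<open>\<pi>\<close> sends the \<open>b i\<close> onto all of \<open>D\<close>, and
  \<open>\<psi>\<close> sends them to the \<open>d i\<close>. Since \<open>b i\<close> can only go
  to elements annihilated by \<open>r i\<close>, the assumption \<open>ev\<close> is what makes each
  element of \<open>D\<close> available as a value at late indices.\<close>

lemma not_Bassian_independent_divisible:
  assumes "comm_group G" "independent_mod G {\<one>\<^bsub>G\<^esub>} r b" "\<not> r 0 dvd 1"
    and D: "comm_group D" "divisible_group D" "countable (carrier D)"
    and d: "independent_mod D {\<one>\<^bsub>D\<^esub>} r d"
    and ev: "\<And>y. y \<in> carrier D \<Longrightarrow> \<exists>a. \<forall>i\<ge>a. y [^]\<^bsub>D\<^esub> r i = \<one>\<^bsub>D\<^esub>"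
  shows "\<not> Bassian G"
proof -
  interpret G: comm_group G by fact
  interpret D: comm_group D by fact
  note b = independent_modD[OF assms(2)]
  note d = independent_modD[OF d]
  define en where "en = from_nat_into (carrier D)"
  have en: "en i \<in> carrier D" for i unfolding en_def by (rule from_nat_into) auto
  have en_surj: "\<exists>i. en i = y" if "y \<in> carrier D" for y
    unfolding en_def using from_nat_into_surj[OF D(3) that] .
  \<comment> \<open>Through the pairing each element of \<open>D\<close> is proposed at infinitely
    many indices, hence also at one late enough for \<open>r i\<close> to annihilate it. Index 0 is
    reserved for the identity, which puts \<open>b 0\<close> into the kernel of
    \<open>\<pi>\<close>.\<close>
  define e where "e i = (let y = en (snd (prod_decode i)) in
      if i > 0 \<and> y [^]\<^bsub>D\<^esub> r i = \<one>\<^bsub>D\<^esub> then y else \<one>\<^bsub>D\<^esub>)" for i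
  have e: "e i \<in> carrier D" "e i [^]\<^bsub>D\<^esub> r i = \<one>\<^bsub>D\<^esub>" for i
    using en by (auto simp: e_def Let_def)
  have e_surj: "\<exists>i. e i = y" if y: "y \<in> carrier D" for y
  proof -
    obtain j where j: "en j = y" using en_surj[OF y] by blast
    obtain a where a: "\<forall>i\<ge>a. y [^]\<^bsub>D\<^esub> r i = \<one>\<^bsub>D\<^esub>" using ev[OF y] by blast
    \<comment> \<open>\<open>Suc a\<close> instead of \<open>a\<close> keeps the index away from the
      reserved value 0.\<close>
    define i where "i = prod_encode (Suc a, j)"
    have "i \<ge> Suc a" unfolding i_def by (rule le_prod_encode_1)
    then have "e i = y" using a j by (auto simp: e_def i_def)
    then show ?thesis by blast
  qed
  obtain \<pi> where \<pi>: "\<pi> \<in> hom G D" "\<And>i. \<pi> (b i) = e i"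
    using divisible_hom_of_independent[OF assms(1) D(1) assms(2) D(2) e] by blast
  obtain \<psi> where \<psi>: "\<psi> \<in> hom G D" "\<And>i. \<psi> (b i) = d i"
    using divisible_hom_of_independent[OF assms(1) D(1) assms(2) D(2) d(1,2)] by blast
  show ?thesis
  proof (rule not_BassianI[OF assms(1) D(1) G.subgroup_span_all \<pi>(1) \<psi>(1), of b "b 0"])
    show "\<exists>m\<in>span_all G b. \<pi> m = y" if "y \<in> carrier D" for y
      using e_surj[OF that] \<pi>(2) G.in_span_all[of b] b(1) by metis
    show "\<pi> (b 0) = \<one>\<^bsub>D\<^esub>" using \<pi>(2) by (simp add: e_def Let_def)
    show "b 0 \<noteq> \<one>\<^bsub>G\<^esub>"
    proof
      assume "b 0 = \<one>\<^bsub>G\<^esub>"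
      then have "lincomb G b (\<lambda>_. 1) 1 \<in> {\<one>\<^bsub>G\<^esub>}" by simp
      then show False using b(3)[of "\<lambda>_. 1" 1 0] assms(3) by simp
    qed
    show "m = \<one>\<^bsub>G\<^esub>" if "m \<in> span_all G b" "\<psi> m = \<one>\<^bsub>D\<^esub>" for m
    proof -
      from that(1) obtain c n where m: "m = lincomb G b c n" by (auto simp: span_all_def)
      have "lincomb D d c n = \<one>\<^bsub>D\<^esub>"
        using that(2) G.hom_lincomb[OF D(1) \<psi>(1) b(1)] by (simp add: m \<psi>(2))
      then have "r i dvd c i" if "i < n" for i using d(3)[OF _ that] by simp
      then show ?thesis unfolding m by (intro G.lincomb_one) (rule G.int_pow_dvd_one[OF b(1,2)])
    qed
  qed (use b G.in_span_all[of b] in auto)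
qed

text \<open>Homomorphisms into the span of \<open>b\<close> that kill all \<open>q\<close>-th powers always extend, so the
  span is a retract of \<open>G\<close>, and \<open>\<pi>\<close> can be taken to be the backward shift.\<close>

lemma not_Bassian_bounded:
  assumes "comm_group G" "(q::int) > 1"
    and "independent_mod G {x [^]\<^bsub>G\<^esub> q | x. x \<in> carrier G} (\<lambda>_. q) b"
  shows "\<not> Bassian G"
proof -
  interpret G: comm_group G by fact
  let ?Q = "{x [^]\<^bsub>G\<^esub> q | x. x \<in> carrier G}"
  have subQ: "subgroup ?Q G" by (rule G.subgroup_int_pow_image)
  note b = independent_modD[OF assms(3)]
  let ?M = "G\<lparr>carrier := span_all G b\<rparr>"
  have subM: "subgroup (span_all G b) G" by (rule G.subgroup_span_all[OF b(1)])
  interpret M: subgroup "span_all G b" G by (rule subM)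
  have cM: "comm_group ?M" by (rule G.subgroup_comm_group[OF subM])
  interpret CM: comm_group ?M by (rule cM)
  have bM: "b i \<in> span_all G b" for i using G.in_span_all[of b] b(1) by blast
  note pow = G.subgroup_int_pow_eq[OF subM]
  have lin: "lincomb ?M b c n = lincomb G b c n" for c n
    by (rule G.lincomb_subgroup[OF subM bM])
  have oneQ: "\<one>\<^bsub>G\<^esub> \<in> ?Q" using subgroup.one_closed[OF subQ] .
  have expo: "y [^]\<^bsub>G\<^esub> q = \<one>\<^bsub>G\<^esub>" if "y \<in> span_all G b" for y
  proof -
    from that obtain c n where y: "y = lincomb G b c n" by (auto simp: span_all_def)
    have "b i [^]\<^bsub>G\<^esub> (c i * q) = \<one>\<^bsub>G\<^esub>" for i
      by (rule G.int_pow_dvd_one[OF b(1,2)]) simp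
    then show ?thesis unfolding y using b(1) by (simp add: G.lincomb_pow G.lincomb_one)
  qed
  \<comment> \<open>The span behaves like a direct sum of copies of Z/q: for
    \<open>q = g * m\<close>, being annihilated by \<open>m\<close> forces all coefficients of
    \<open>y\<close> to be multiples of \<open>g\<close>.\<close>
  have hom_div: "\<exists>e\<in>span_all G b. e [^]\<^bsub>G\<^esub> g = y"
    if y: "y \<in> span_all G b" "y [^]\<^bsub>G\<^esub> m = \<one>\<^bsub>G\<^esub>" and q: "q = g * m" for y g m
  proof -
    obtain c n where c: "y = lincomb G b c n" using y by (auto simp: span_all_def)
    have "lincomb G b (\<lambda>i. c i * m) n \<in> ?Q" using y(2) oneQ b(1) by (simp add: c G.lincomb_pow)
    then have "g * m dvd c i * m" if "i < n" for i using that unfolding q[symmetric] by (rule b(3))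
    moreover have "m \<noteq> 0" using assms(2) q by auto
    ultimately have "\<forall>i<n. g dvd c i" by simp
    then have "y = lincomb G b (\<lambda>i. c i div g * g) n"
      unfolding c by (intro lincomb_cong) auto
    also have "\<dots> = lincomb G b (\<lambda>i. c i div g) n [^]\<^bsub>G\<^esub> g" using b(1) by (simp add: G.lincomb_pow)
    finally show ?thesis by (auto simp: span_all_def)
  qed
  have ext: "\<exists>\<phi>\<in>hom G ?M. \<forall>i. \<phi> (b i) = d i" if d: "\<And>i. d i \<in> span_all G b" for d
  proof -
    have "\<exists>\<phi>\<in>hom G ?M. (\<forall>i. \<phi> (b i) = d i) \<and> (\<forall>q\<in>?Q. \<phi> q = \<one>\<^bsub>?M\<^esub>)"
    proof (rule hom_of_independent[OF assms(1) cM subQ assms(3)])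
      show "d i \<in> carrier ?M" "d i [^]\<^bsub>?M\<^esub> q = \<one>\<^bsub>?M\<^esub>" for i
        using d expo by (auto simp: pow)
      fix \<Gamma> x y and k :: int
      assume ph: "partial_hom G ?M \<Gamma>" and Q: "?Q \<times> {\<one>\<^bsub>?M\<^esub>} \<subseteq> \<Gamma>" and x: "x \<in> carrier G"
        and k: "k > 0" and xy: "(x [^]\<^bsub>G\<^esub> k, y) \<in> \<Gamma>"
      note cl = partial_hom_closed[OF ph G.group_axioms CM.group_axioms]
      have y: "y \<in> span_all G b" using cl(2)[OF xy] by simp
      \<comment> \<open>The \<open>m\<close>-th power of \<open>x [^] k\<close>, with
        \<open>m = q / g\<close>, is a \<open>q\<close>-th power and goes to the identity, so
        \<open>m\<close> annihilates \<open>y\<close> and \<open>y\<close> has a \<open>g\<close>-th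
        root. Bezout turns it into a \<open>k\<close>-th root, since \<open>q\<close> annihilates
        the span.\<close>
      define g where "g = gcd k q"
      obtain m where m: "q = g * m" unfolding g_def by (meson dvd_def gcd_dvd2)
      obtain l where l: "k = g * l" unfolding g_def by (meson dvd_def gcd_dvd1)
      have "(x [^]\<^bsub>G\<^esub> k) [^]\<^bsub>G\<^esub> m = (x [^]\<^bsub>G\<^esub> l) [^]\<^bsub>G\<^esub> q"
        using x by (simp add: G.int_pow_pow m l mult_ac)
      then have "(x [^]\<^bsub>G\<^esub> k) [^]\<^bsub>G\<^esub> m \<in> ?Q" using x by auto
      then have "y [^]\<^bsub>?M\<^esub> m = \<one>\<^bsub>?M\<^esub>" using cl(6)[OF cl(5)[OF xy, of m]] Q by auto
      then obtain e where e: "e \<in> span_all G b" "e [^]\<^bsub>G\<^esub> g = y"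
        using hom_div[OF y _ m] y by (auto simp: pow)
      obtain u v where uv: "u * k + v * q = g" unfolding g_def using bezout_int by blast
      have ec: "e \<in> carrier G" using e(1) by auto
      have "y = e [^]\<^bsub>G\<^esub> (u * k + v * q)" using e(2) uv by simp
      also have "\<dots> = (e [^]\<^bsub>G\<^esub> u) [^]\<^bsub>G\<^esub> k \<otimes>\<^bsub>G\<^esub> (e [^]\<^bsub>G\<^esub> q) [^]\<^bsub>G\<^esub> v"
        using ec by (simp add: G.int_pow_mult G.int_pow_pow mult_ac)
      also have "\<dots> = (e [^]\<^bsub>G\<^esub> u) [^]\<^bsub>G\<^esub> k" using expo[OF e(1)] ec by simp
      finally have "(e [^]\<^bsub>G\<^esub> u) [^]\<^bsub>?M\<^esub> k = y"
        using pow[OF G.subgroup_int_powI[OF subM e(1)], of u k] by simp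
      then show "\<exists>e\<in>carrier ?M. e [^]\<^bsub>?M\<^esub> k = y"
        using G.subgroup_int_powI[OF subM e(1), of u] by auto
    qed
    then show ?thesis by blast
  qed
  obtain \<psi> where \<psi>: "\<psi> \<in> hom G ?M" "\<And>i. \<psi> (b i) = b i" using ext[of b] bM by blast
  obtain \<pi> where \<pi>: "\<pi> \<in> hom G ?M" "\<And>i. \<pi> (b i) = (case i of 0 \<Rightarrow> \<one>\<^bsub>G\<^esub> | Suc j \<Rightarrow> b j)"
  proof -
    have "(case i of 0 \<Rightarrow> \<one>\<^bsub>G\<^esub> | Suc j \<Rightarrow> b j) \<in> span_all G b" for i
      using bM by (simp split: nat.split)
    from ext[of "case_nat \<one>\<^bsub>G\<^esub> b", OF this] show ?thesis using that by blast
  qed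
  show ?thesis
  proof (rule not_BassianI[OF assms(1) cM subM \<pi>(1) \<psi>(1), of "b 0"])
    show "\<exists>m\<in>span_all G b. \<pi> m = y" if "y \<in> carrier ?M" for y
    proof -
      from that obtain c n where y: "y = lincomb G b c n" by (auto simp: span_all_def)
      \<comment> \<open>Shifting the coefficients forward undoes the backward shift; the coefficient
        of \<open>b 0\<close>, which is killed anyway, is set to 0.\<close>
      let ?c = "case_nat 0 c"
      have "\<pi> (lincomb G b ?c (Suc n)) = lincomb ?M (\<lambda>i. \<pi> (b i)) ?c (Suc n)"
        by (rule G.hom_lincomb[OF cM \<pi>(1) b(1)])
      also have "\<dots> = lincomb ?M b c n"
        by (subst CM.lincomb_shift)
          (use bM independent_modD(1)[OF assms(3)] in \<open>auto simp: \<pi>(2) lin split: nat.splits\<close>)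
      finally have "\<pi> (lincomb G b ?c (Suc n)) = y" unfolding y lin .
      then show ?thesis by (auto simp: span_all_def simp del: lincomb.simps)
    qed
    show "\<pi> (b 0) = \<one>\<^bsub>?M\<^esub>" using \<pi>(2) by simp
    show "b 0 \<noteq> \<one>\<^bsub>G\<^esub>"
    proof
      assume "b 0 = \<one>\<^bsub>G\<^esub>"
      then have "lincomb G b (\<lambda>_. 1) 1 \<in> ?Q" using oneQ by simp
      then show False using b(3)[of "\<lambda>_. 1" 1 0] assms(2) by simp
    qed
    show "m = \<one>\<^bsub>G\<^esub>" if "m \<in> span_all G b" "\<psi> m = \<one>\<^bsub>?M\<^esub>" for m
    proof -
      from that obtain c n where m: "m = lincomb G b c n" by (auto simp: span_all_def)
      have "\<psi> m = m" unfolding m using G.hom_lincomb[OF cM \<psi>(1) b(1)] by (simp add: \<psi>(2) lin)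
      then show ?thesis using that by simp
    qed
  qed (rule bM)
qed

section \<open>Divisible test groups\<close>

text \<open>Z(p^infinity) as the p-primary part of Q/Z, with the same representatives in [0,1) as in
  \<open>prufer_sum\<close>, so that the coordinates of the latter are homomorphisms into this
  group.\<close>

definition prufer :: "nat \<Rightarrow> rat monoid" where
  "prufer p = \<lparr>carrier = {x. 0 \<le> x \<and> x < 1 \<and> (\<exists>k::nat. of_nat p ^ k * x \<in> \<int>)},
     monoid.mult = (\<lambda>x y. frac (x + y)), monoid.one = 0\<rparr>"

definition rat_group :: "rat monoid" where
  "rat_group = \<lparr>carrier = UNIV, monoid.mult = (+), monoid.one = 0\<rparr>"

lemma prufer_simps [simp]:
  "x \<otimes>\<^bsub>prufer p\<^esub> y = frac (x + y)" "\<one>\<^bsub>prufer p\<^esub> = 0"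
  by (simp_all add: prufer_def)

lemma rat_group_simps [simp]:
  "carrier rat_group = UNIV" "x \<otimes>\<^bsub>rat_group\<^esub> y = x + y" "\<one>\<^bsub>rat_group\<^esub> = 0"
  by (simp_all add: rat_group_def)

lemma in_prufer:
  "x \<in> carrier (prufer p) \<longleftrightarrow> 0 \<le> x \<and> x < 1 \<and> (\<exists>k::nat. of_nat p ^ k * x \<in> \<int>)"
  by (simp add: prufer_def)

lemma frac_add_frac_left: "frac (frac x + y) = frac (x + y :: 'a :: floor_ceiling)"
proof -
  have "frac (x + y) = frac (frac x + y + of_int \<lfloor>x\<rfloor>)" by (simp add: frac_def)
  then show ?thesis by simp
qed

lemma frac_eq_frac_iff: "frac x = frac y \<longleftrightarrow> x - y \<in> (\<int> :: 'a :: floor_ceiling set)"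
proof
  assume "frac x = frac y"
  then have "x - y = of_int (\<lfloor>x\<rfloor> - \<lfloor>y\<rfloor>)" by (simp add: frac_def algebra_simps)
  then show "x - y \<in> \<int>" by (metis Ints_of_int)
next
  assume "x - y \<in> \<int>"
  then obtain k where "x = y + of_int k" by (metis Ints_cases add.commute diff_add_cancel)
  then show "frac x = frac y" by simp
qed

lemma mult_frac_in_Ints: "of_nat n * frac x \<in> \<int> \<longleftrightarrow> of_nat n * x \<in> (\<int> :: 'a :: floor_ceiling set)"
proof -
  have "of_nat n * x = of_nat n * frac x + of_int (int n * \<lfloor>x\<rfloor>)" by (simp add: frac_def algebra_simps)
  then show ?thesis
    by (metis Ints_add Ints_diff Ints_of_int add_diff_cancel_right')
qed

lemma frac_in_prufer:
  assumes "of_nat p ^ k * x \<in> \<int>"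
  shows "frac x \<in> carrier (prufer p)"
  using assms mult_frac_in_Ints[of "p ^ k" x] by (auto simp: in_prufer frac_lt_1)

lemma comm_group_prufer: "comm_group (prufer p)"
proof (rule comm_groupI)
  fix x y assume "x \<in> carrier (prufer p)" "y \<in> carrier (prufer p)"
  then obtain k l :: nat where k: "of_nat p ^ k * x \<in> \<int>" and l: "of_nat p ^ l * y \<in> \<int>"
    by (auto simp: in_prufer)
  have "of_nat p ^ (k + l) * (x + y) = of_int (int (p ^ l)) * (of_nat p ^ k * x) + of_int (int (p ^ k)) * (of_nat p ^ l * y)"
    by (simp add: power_add algebra_simps)
  also have "\<dots> \<in> \<int>" by (rule Ints_add[OF Ints_mult[OF Ints_of_int k] Ints_mult[OF Ints_of_int l]])
  finally show "x \<otimes>\<^bsub>prufer p\<^esub> y \<in> carrier (prufer p)"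
    unfolding prufer_simps by (rule frac_in_prufer)
next
  fix x assume x: "x \<in> carrier (prufer p)"
  then obtain k :: nat where k: "of_nat p ^ k * x \<in> \<int>" by (auto simp: in_prufer)
  then have "of_nat p ^ k * (- x) \<in> \<int>" by simp
  then have "frac (- x) \<in> carrier (prufer p)" by (rule frac_in_prufer)
  moreover have "frac (- x) \<otimes>\<^bsub>prufer p\<^esub> x = \<one>\<^bsub>prufer p\<^esub>" by (simp add: frac_add_frac_left)
  ultimately show "\<exists>y\<in>carrier (prufer p). y \<otimes>\<^bsub>prufer p\<^esub> x = \<one>\<^bsub>prufer p\<^esub>" by blast
  show "\<one>\<^bsub>prufer p\<^esub> \<otimes>\<^bsub>prufer p\<^esub> x = x" using x by (simp add: in_prufer frac_eq)
next
  show "\<one>\<^bsub>prufer p\<^esub> \<in> carrier (prufer p)" by (simp add: in_prufer)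
  fix x y z :: rat
  show "x \<otimes>\<^bsub>prufer p\<^esub> y = y \<otimes>\<^bsub>prufer p\<^esub> x" by (simp add: add.commute)
  show "x \<otimes>\<^bsub>prufer p\<^esub> y \<otimes>\<^bsub>prufer p\<^esub> z = x \<otimes>\<^bsub>prufer p\<^esub> (y \<otimes>\<^bsub>prufer p\<^esub> z)"
    by (simp add: frac_add_frac_left add.commute[of x "frac _"]) (simp add: add_ac)
qed

lemma prufer_int_pow:
  assumes "x \<in> carrier (prufer p)"
  shows "x [^]\<^bsub>prufer p\<^esub> (k::int) = frac (of_int k * x)"
proof -
  interpret P: comm_group "prufer p" by (rule comm_group_prufer)
  have nat: "x [^]\<^bsub>prufer p\<^esub> (n::nat) = frac (of_nat n * x)" for n
    by (induction n) (auto simp: frac_add_frac_left algebra_simps)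
  show ?thesis
  proof (cases k rule: int_cases2)
    case (nonneg n)
    then show ?thesis by (simp add: int_pow_int nat)
  next
    case (nonpos n)
    have "frac (of_int k * x) \<in> carrier (prufer p)"
    proof -
      obtain j :: nat where "of_nat p ^ j * x \<in> \<int>" using assms by (auto simp: in_prufer)
      then have "of_int k * (of_nat p ^ j * x) \<in> \<int>" by (rule Ints_mult[OF Ints_of_int])
      then have "of_nat p ^ j * (of_int k * x) \<in> \<int>" by (simp add: mult_ac)
      then show ?thesis by (rule frac_in_prufer)
    qed
    moreover have "frac (of_int k * x) \<otimes>\<^bsub>prufer p\<^esub> x [^]\<^bsub>prufer p\<^esub> n = \<one>\<^bsub>prufer p\<^esub>"
    proof -
      have "frac (of_int k * x + frac (of_nat n * x)) = frac (of_nat n * x + of_int k * x)"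
        by (simp add: add.commute[of _ "frac _"] frac_add_frac_left)
      then show ?thesis using nonpos by (simp add: nat frac_add_frac_left)
    qed
    ultimately show ?thesis
      using P.inv_equality[of "frac (of_int k * x)" "x [^]\<^bsub>prufer p\<^esub> n"] assms nonpos
      by (simp add: P.int_pow_neg_int)
  qed
qed

text \<open>The part \<open>u\<close> of \<open>k\<close> prime to \<open>p\<close> is inverted
  modulo \<open>p ^ j\<close>, so the exponent \<open>u * w\<close> acts as the identity on every
  element annihilated by \<open>p ^ j\<close>. This reduces roots and orders in primary groups to
  powers of \<open>p\<close>.\<close>

lemma ex_prime_power_cofactor:
  assumes "Factorial_Ring.prime p" "(k::int) > 0"
  obtains a u w v where "k = int p ^ a * u" "u * w + int p ^ j * v = 1"
proof -
  have p: "Factorial_Ring.prime (int p)" using assms by simp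
  have p0: "\<not> is_unit (int p)" using p not_prime_unit by blast
  obtain a u where ku: "k = int p ^ a * u" "\<not> int p dvd u"
    using multiplicity_decompose'[of k "int p"] assms(2) p0 by (metis less_irrefl)
  have "coprime u (int p ^ j)"
    using prime_imp_coprime[OF p ku(2)] by (simp add: coprime_commute)
  then have "gcd u (int p ^ j) = 1" by simp
  then obtain w v where "w * u + v * int p ^ j = 1" using bezout_int[of u "int p ^ j"] by auto
  then show ?thesis using that[of a u w v] ku(1) by (simp add: mult.commute)
qed

lemma divisible_prufer:
  assumes "Factorial_Ring.prime p"
  shows "divisible_group (prufer p)"
  unfolding divisible_group_def
proof (intro ballI allI impI)
  fix d and k :: int assume d: "d \<in> carrier (prufer p)" and k: "k > 0"
  obtain j :: nat where "of_nat p ^ j * d \<in> \<int>" using d by (auto simp: in_prufer)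
  then obtain a where a: "of_nat p ^ j * d = of_int a" by (auto elim: Ints_cases)
  have p0: "p > 0" using prime_gt_0_nat[OF assms] .
  obtain m u v w where ku: "k = int p ^ m * u" and "u * v + int p ^ j * w = 1"
    by (rule ex_prime_power_cofactor[OF assms k])
  then have vw: "v * u + w * int p ^ j = 1" by (simp add: mult.commute)
  \<comment> \<open>Division by \<open>p ^ m\<close> takes place in the rationals, division by
    \<open>u\<close> through its inverse \<open>v\<close> modulo \<open>p ^ j\<close>, which works
    because \<open>p ^ j\<close> annihilates \<open>d\<close> modulo the integers.\<close>
  define e where "e = of_int v * d / of_nat p ^ m"
  have "of_nat p ^ (j + m) * e = of_int v * (of_nat p ^ j * d)"
    using p0 by (simp add: e_def power_add)
  then have "of_nat p ^ (j + m) * e \<in> \<int>" by (simp add: a)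
  then have e: "frac e \<in> carrier (prufer p)" by (rule frac_in_prufer)
  have "of_int k * e = of_int (v * u) * d" using p0 by (simp add: e_def ku)
  also have "\<dots> = of_int (1 - w * int p ^ j) * d" by (simp add: vw[symmetric])
  also have "\<dots> = d - of_int (w * a)" using a by (simp add: algebra_simps)
  finally have ke: "of_int k * e = d - of_int (w * a)" .
  have "of_int k * frac e - d = of_int (- k * \<lfloor>e\<rfloor> - w * a)"
    using ke by (simp add: frac_def algebra_simps)
  then have "of_int k * frac e - d \<in> \<int>" by (metis Ints_of_int)
  then have "frac (of_int k * frac e) = frac d" by (simp add: frac_eq_frac_iff)
  also have "\<dots> = d" using d by (simp add: in_prufer frac_eq)
  finally show "\<exists>e\<in>carrier (prufer p). e [^]\<^bsub>prufer p\<^esub> k = d"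
    using e prufer_int_pow[OF e] by metis
qed

lemma comm_group_rat_group: "comm_group rat_group"
  by (rule comm_groupI) (auto simp: add_ac intro: exI[of _ "- _"])

lemma rat_group_int_pow: "x [^]\<^bsub>rat_group\<^esub> (k::int) = of_int k * x"
proof -
  interpret P: comm_group rat_group by (rule comm_group_rat_group)
  have nat: "x [^]\<^bsub>rat_group\<^esub> (n::nat) = of_nat n * x" for n
    by (induction n) (auto simp: algebra_simps)
  show ?thesis
  proof (cases k rule: int_cases2)
    case (nonneg n)
    then show ?thesis by (simp add: int_pow_int nat)
  next
    case (nonpos n)
    then show ?thesis
      using P.inv_equality[of "of_int k * x" "x [^]\<^bsub>rat_group\<^esub> n"]
      by (simp add: P.int_pow_neg_int nat)
  qed
qed

lemma divisible_rat_group: "divisible_group rat_group"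
  unfolding divisible_group_def
proof (intro ballI allI impI)
  fix d and k :: int assume "k > 0"
  then show "\<exists>e\<in>carrier rat_group. e [^]\<^bsub>rat_group\<^esub> k = d"
    by (intro bexI[of _ "d / of_int k"]) (auto simp: rat_group_int_pow)
qed

section \<open>Countable direct powers\<close>

abbreviation dsum :: "('a, 'm) monoid_scheme \<Rightarrow> (nat \<Rightarrow> 'a) monoid" where
  "dsum E \<equiv> sum_group UNIV (\<lambda>_. E)"

lemma carrier_dsum:
  "group E \<Longrightarrow> f \<in> carrier (dsum E) \<longleftrightarrow> (\<forall>i. f i \<in> carrier E) \<and> finite {i. f i \<noteq> \<one>\<^bsub>E\<^esub>}"
  by (auto simp: carrier_sum_group)

lemma comm_group_dsum:
  assumes "comm_group E" shows "comm_group (dsum E)"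
proof -
  interpret E: comm_group E by fact
  show ?thesis
    by (rule group.group_comm_groupI)
      (auto simp: carrier_dsum[OF E.group_axioms] E.m_comm E.group_axioms)
qed

lemma proj_dsum_hom: "group E \<Longrightarrow> (\<lambda>f. f i) \<in> hom (dsum E) E"
  by (auto simp: hom_def carrier_dsum)

lemma dsum_int_pow:
  assumes "comm_group E" "f \<in> carrier (dsum E)"
  shows "(f [^]\<^bsub>dsum E\<^esub> (k::int)) i = f i [^]\<^bsub>E\<^esub> k"
proof -
  interpret E: comm_group E by fact
  interpret S: comm_group "dsum E" by (rule comm_group_dsum) fact
  show ?thesis
    using hom_int_pow[OF proj_dsum_hom[OF E.group_axioms] assms(2) S.group_axioms E.group_axioms] .
qed

lemma divisible_dsum:
  assumes "comm_group E" "divisible_group E"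
  shows "divisible_group (dsum E)"
  unfolding divisible_group_def
proof (intro ballI allI impI)
  interpret E: comm_group E by fact
  interpret S: comm_group "dsum E" by (rule comm_group_dsum) fact
  fix f and k :: int assume f: "f \<in> carrier (dsum E)" and k: "k > 0"
  have "\<exists>e. e \<in> carrier E \<and> e [^]\<^bsub>E\<^esub> k = f i \<and> (f i = \<one>\<^bsub>E\<^esub> \<longrightarrow> e = \<one>\<^bsub>E\<^esub>)" for i
  proof (cases "f i = \<one>\<^bsub>E\<^esub>")
    case False
    then show ?thesis
      using assms(2) k f unfolding divisible_group_def carrier_dsum[OF E.group_axioms] by metis
  qed auto
  then obtain e where e: "e i \<in> carrier E" "e i [^]\<^bsub>E\<^esub> k = f i" "f i = \<one>\<^bsub>E\<^esub> \<longrightarrow> e i = \<one>\<^bsub>E\<^esub>" for i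
    by metis
  have "{i. e i \<noteq> \<one>\<^bsub>E\<^esub>} \<subseteq> {i. f i \<noteq> \<one>\<^bsub>E\<^esub>}" using e(3) by auto
  moreover have "finite {i. f i \<noteq> \<one>\<^bsub>E\<^esub>}" using f by (simp add: carrier_dsum)
  ultimately have "e \<in> carrier (dsum E)" using e(1) by (simp add: carrier_dsum finite_subset)
  moreover have "e [^]\<^bsub>dsum E\<^esub> k = f"
    by (rule ext) (simp add: dsum_int_pow[OF assms(1) calculation] e(2))
  ultimately show "\<exists>e\<in>carrier (dsum E). e [^]\<^bsub>dsum E\<^esub> k = f" by blast
qed

text \<open>By finite support, a family is determined by the list of its values below some
  bound.\<close>

lemma countable_dsum:
  fixes E :: "('a :: countable, 'm) monoid_scheme"
  assumes "group E"
  shows "countable (carrier (dsum E))"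
proof -
  have "f \<in> range (\<lambda>xs i. if i < length xs then xs ! i else \<one>\<^bsub>E\<^esub>)" if "f \<in> carrier (dsum E)" for f
  proof -
    have "finite {i. f i \<noteq> \<one>\<^bsub>E\<^esub>}" using that assms by (simp add: carrier_dsum)
    then obtain n where n: "\<forall>i\<in>{i. f i \<noteq> \<one>\<^bsub>E\<^esub>}. i < n" using finite_nat_set_iff_bounded by auto
    then have "f = (\<lambda>i. if i < length (map f [0..<n]) then map f [0..<n] ! i else \<one>\<^bsub>E\<^esub>)"
      by (intro ext) auto
    then show ?thesis by (rule range_eqI)
  qed
  then have "carrier (dsum E) \<subseteq> range (\<lambda>xs i. if i < length xs then xs ! i else \<one>\<^bsub>E\<^esub>)" by blast
  then show ?thesis by (rule countable_subset) simp
qed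

lemma (in comm_group) lincomb_eq_single:
  assumes "\<And>i. b i \<in> carrier G" "j < n" "\<And>i. i < n \<Longrightarrow> i \<noteq> j \<Longrightarrow> b i [^] c i = \<one>"
  shows "lincomb G b c n = b j [^] c j"
  using assms(2,3)
proof (induction n)
  case (Suc n)
  show ?case
  proof (cases "j = n")
    case True
    then have "lincomb G b c n = \<one>" using Suc.prems by (intro lincomb_one) auto
    then show ?thesis using True assms(1) by simp
  next
    case False
    then show ?thesis using Suc assms(1) by simp
  qed
qed simp

text \<open>The \<open>t i\<close> need not be independent within one copy of \<open>E\<close>, but
  they become so in the direct power, where \<open>t i\<close> is placed in coordinate
  \<open>i\<close>. The power remains countable and divisible, and finite support lets
  \<open>ev\<close> pass from coordinates to families.\<close>

lemma not_Bassian_test_group: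
  fixes E :: "('b :: countable, 'n) monoid_scheme"
  assumes "comm_group G" "independent_mod G {\<one>\<^bsub>G\<^esub>} r b" "\<not> r 0 dvd 1"
    and E: "comm_group E" "divisible_group E"
    and t: "\<And>i. t i \<in> carrier E" "\<And>i k. t i [^]\<^bsub>E\<^esub> (k::int) = \<one>\<^bsub>E\<^esub> \<longleftrightarrow> r i dvd k"
    and ev: "\<And>y. y \<in> carrier E \<Longrightarrow> \<exists>a. \<forall>i\<ge>a. y [^]\<^bsub>E\<^esub> r i = \<one>\<^bsub>E\<^esub>"
  shows "\<not> Bassian G"
proof -
  interpret E: comm_group E by fact
  interpret S: comm_group "dsum E" by (rule comm_group_dsum) fact
  have one: "\<one>\<^bsub>dsum E\<^esub> = (\<lambda>_. \<one>\<^bsub>E\<^esub>)" by (simp add: restrict_def)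
  define d where "d i j = (if j = i then t i else \<one>\<^bsub>E\<^esub>)" for i j :: nat
  have d: "d i \<in> carrier (dsum E)" for i
    using t(1) by (auto simp: carrier_dsum d_def intro: finite_subset[of _ "{i}"])
  have "independent_mod (dsum E) {\<one>\<^bsub>dsum E\<^esub>} r d"
    unfolding independent_mod_def
  proof (intro conjI allI impI d)
    show "d i [^]\<^bsub>dsum E\<^esub> r i = \<one>\<^bsub>dsum E\<^esub>" for i
      unfolding one using t(2)[of i "r i"]
      by (intro ext) (simp add: dsum_int_pow[OF E(1) d], simp add: d_def)
    fix c n i assume lin: "lincomb (dsum E) d c n \<in> {\<one>\<^bsub>dsum E\<^esub>}" and i: "i < n"
    have "lincomb (dsum E) d c n i = lincomb E (\<lambda>j. d j i) c n"
      by (rule S.hom_lincomb[OF E(1) proj_dsum_hom d]) (rule E.group_axioms)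
    also have "\<dots> = d i i [^]\<^bsub>E\<^esub> c i"
      by (rule E.lincomb_eq_single) (use i t in \<open>auto simp: d_def\<close>)
    finally have "t i [^]\<^bsub>E\<^esub> c i = \<one>\<^bsub>E\<^esub>" using lin one by (simp add: d_def)
    then show "r i dvd c i" using t(2) by simp
  qed
  moreover have "\<exists>a. \<forall>i\<ge>a. y [^]\<^bsub>dsum E\<^esub> r i = \<one>\<^bsub>dsum E\<^esub>" if y: "y \<in> carrier (dsum E)" for y
  proof -
    have yc: "y j \<in> carrier E" for j using y by (simp add: carrier_dsum)
    have fin: "finite {j. y j \<noteq> \<one>\<^bsub>E\<^esub>}" using y by (simp add: carrier_dsum)
    obtain a where a: "\<forall>i\<ge>a j. y j [^]\<^bsub>E\<^esub> r i = \<one>\<^bsub>E\<^esub>" for j using ev[OF yc] by metis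
    have "y j [^]\<^bsub>E\<^esub> r i = \<one>\<^bsub>E\<^esub>" if "i \<ge> Max (insert 0 (a ` {j. y j \<noteq> \<one>\<^bsub>E\<^esub>}))" for i j
    proof (cases "y j = \<one>\<^bsub>E\<^esub>")
      case False
      then have "a j \<le> i" using that fin by simp
      then show ?thesis using a by blast
    qed simp
    then show ?thesis unfolding one
      by (intro exI allI impI ext) (simp add: dsum_int_pow[OF E(1) y])
  qed
  ultimately show ?thesis
    using not_Bassian_independent_divisible[OF assms(1-3) S.comm_group_axioms divisible_dsum[OF E]
        countable_dsum[OF E.group_axioms]] by blast
qed

text \<open>The rank itself is never computed; an infinite independent sequence of elements of
  infinite order, encoded by \<open>r i = 0\<close>, is what infinite rank supplies.\<close>

definition torsion_free_rank_finite :: "('a, 'm) monoid_scheme \<Rightarrow> bool" where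
  "torsion_free_rank_finite G \<longleftrightarrow> \<not> (\<exists>b. independent_mod G {\<one>\<^bsub>G\<^esub>} (\<lambda>_. 0) b)"

definition tor :: "('a, 'm) monoid_scheme \<Rightarrow> int \<Rightarrow> 'a set" where
  "tor G n = {x \<in> carrier G. x [^]\<^bsub>G\<^esub> n = \<one>\<^bsub>G\<^esub>}"

text \<open>The test group is Q: the element 1 has infinite order, and the exponent 0 annihilates
  everything, so \<open>ev\<close> is trivial.\<close>

lemma Bassian_torsion_free_rank_finite:
  assumes "Bassian G"
  shows "torsion_free_rank_finite G"
proof -
  have G: "comm_group G" using assms by (simp add: Bassian_def)
  have "\<not> Bassian G" if "independent_mod G {\<one>\<^bsub>G\<^esub>} (\<lambda>_. 0) b" for b
    by (rule not_Bassian_test_group[OF G that _ comm_group_rat_group divisible_rat_group,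
          where t="\<lambda>_. 1"]) (auto simp: rat_group_int_pow)
  then show ?thesis using assms by (auto simp: torsion_free_rank_finite_def)
qed

section \<open>Infinite socles\<close>

context comm_group
begin

lemma subgroup_tor: "subgroup (tor G n) G"
proof (rule subgroupI)
  show "tor G n \<noteq> {}" using one_closed int_pow_one by (fastforce simp: tor_def)
qed (auto simp: tor_def int_pow_inv int_pow_distrib)

lemma finite_span_upto:
  assumes "\<And>i. b i \<in> carrier G" "\<And>i. i < n \<Longrightarrow> b i [^] r i = \<one>" "\<And>i. i < n \<Longrightarrow> (r i :: int) > 0"
  shows "finite (span_upto G b n)"
  using assms(2,3)
proof (induction n)
  case 0
  then show ?case by (simp add: span_upto_def)
next
  case (Suc n)
  have "span_upto G b (Suc n) \<subseteq> (\<lambda>(x, k). x \<otimes> b n [^] k) ` (span_upto G b n \<times> {0..<r n})"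
  proof
    fix x assume "x \<in> span_upto G b (Suc n)"
    then obtain c where x: "x = lincomb G b c n \<otimes> b n [^] c n" by (auto simp: span_upto_def)
    have "b n [^] c n = b n [^] (c n mod r n) \<otimes> b n [^] (r n * (c n div r n))"
      using assms(1) by (simp flip: int_pow_mult)
    also have "\<dots> = b n [^] (c n mod r n)"
      using assms(1) Suc.prems(1) int_pow_dvd_one[of "b n" "r n"] by simp
    finally have "x = lincomb G b c n \<otimes> b n [^] (c n mod r n)" by (simp add: x)
    moreover have "c n mod r n \<in> {0..<r n}" using Suc.prems(2)[of n] by simp
    moreover have "lincomb G b c n \<in> span_upto G b n" by (auto simp: span_upto_def)
    ultimately show "x \<in> (\<lambda>(x, k). x \<otimes> b n [^] k) ` (span_upto G b n \<times> {0..<r n})" by force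
  qed
  moreover have "finite (span_upto G b n)" using Suc by simp
  ultimately show ?case by (rule finite_subset[OF _ finite_imageI[OF finite_cartesian_product]]) simp
qed

lemma span_upto_cong: "(\<And>i. i < n \<Longrightarrow> b i = b' i) \<Longrightarrow> span_upto G b n = span_upto G b' n"
  unfolding span_upto_def using lincomb_cong[of n b b' _ _ G] by metis

text \<open>The \<open>b i\<close> are chosen recursively so that the power \<open>p ^ e i\<close>
  of \<open>b i\<close> is a socle element outside the product of the earlier span with the socle of
  \<open>Q\<close>. That product is finite, so the infinite supply is never exhausted. It is
  essential that only the socle of \<open>Q\<close> has to be avoided, because \<open>Q\<close> may
  be infinite.\<close>

lemma ex_independent_mod:
  assumes p: "Factorial_Ring.prime p" and Q: "subgroup Q G" "finite (tor G (int p) \<inter> Q)"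
    and inf: "\<And>i. infinite (tor G (int p) \<inter> {x [^] (int p ^ e i) | x. x \<in> carrier G})"
  shows "\<exists>b. independent_mod G Q (\<lambda>i. int p ^ Suc (e i)) b"
proof -
  have p0: "int p > 0" using prime_gt_0_nat[OF p] by simp
  define P where "P f i x \<longleftrightarrow> x \<in> carrier G \<and> x [^] (int p ^ e i) \<in> tor G (int p) \<and>
      x [^] (int p ^ e i) \<notin> span_upto G f i <#> (tor G (int p) \<inter> Q)" for f :: "nat \<Rightarrow> 'a" and i x
  have pow: "x [^] (int p ^ Suc (e i)) = \<one>" if "P f i x" for f i x
    using that by (auto simp: P_def tor_def int_pow_pow mult_ac)
  have "\<exists>b. \<forall>i. P b i (b i)"
  proof (rule dependent_wellorder_choice)
    fix r :: 'a and f g :: "nat \<Rightarrow> 'a" and x :: nat assume "\<And>y. y < x \<Longrightarrow> f y = g y"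
    then have "span_upto G f x = span_upto G g x" by (rule span_upto_cong)
    then show "P f x r = P g x r" by (simp add: P_def)
  next
    fix i and f :: "nat \<Rightarrow> 'a" assume f: "\<And>y. y < i \<Longrightarrow> P f y (f y)"
    \<comment> \<open>Nothing is known about \<open>f\<close> from \<open>i\<close> on; replacing
      those values by the identity does not change the span and makes all values torsion elements of
      \<open>G\<close>.\<close>
    define f' where "f' j = (if j < i then f j else \<one>)" for j
    have "span_upto G f i = span_upto G f' i" by (rule span_upto_cong) (simp add: f'_def)
    moreover have "finite (span_upto G f' i)"
      by (rule finite_span_upto[where r="\<lambda>j. int p ^ Suc (e j)"])
        (use f pow p0 in \<open>auto simp: f'_def P_def simp del: power_Suc\<close>)
    ultimately have "finite (span_upto G f i <#> (tor G (int p) \<inter> Q))"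
      using Q(2) by (simp add: set_mult_def)
    then have "\<not> tor G (int p) \<inter> {x [^] (int p ^ e i) | x. x \<in> carrier G} \<subseteq> span_upto G f i <#> (tor G (int p) \<inter> Q)"
      using inf[of i] finite_subset by blast
    then show "\<exists>r. P f i r" by (auto simp: P_def)
  qed
  then obtain b where b: "P b i (b i)" for i by blast
  then have bc: "b i \<in> carrier G" for i by (simp add: P_def)
  have bpow: "b i [^] (int p ^ Suc (e i)) = \<one>" for i by (rule pow[OF b])
  have "\<forall>i<n. int p ^ Suc (e i) dvd c i" if "lincomb G b c n \<in> Q" for c n
    using that
  proof (induction n arbitrary: c)
    case (Suc n)
    let ?q = "int p ^ e n" and ?x = "lincomb G b c n" and ?y = "b n [^] c n"
    have subN: "subgroup (span_upto G b n) G" using bc by (rule subgroup_span_upto)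
    have xN: "?x \<in> span_upto G b n" by (auto simp: span_upto_def)
    have triv: "\<nu> = \<one>" if "\<nu> \<in> span_upto G b n" "\<nu> \<in> Q" for \<nu>
    proof -
      from that(1) obtain c' where \<nu>: "\<nu> = lincomb G b c' n" by (auto simp: span_upto_def)
      have "\<forall>i<n. int p ^ Suc (e i) dvd c' i" using that(2) unfolding \<nu> by (rule Suc.IH)
      then show ?thesis unfolding \<nu>
        by (intro lincomb_one) (use int_pow_dvd_one[OF bc bpow] in blast)
    qed
    have cl: "?x \<in> carrier G" "?y \<in> carrier G" using bc by auto
    have dvd: "int p ^ Suc (e n) dvd c n"
    proof (rule ccontr)
      assume ndvd: "\<not> int p ^ Suc (e n) dvd c n"
      \<comment> \<open>If the full order does not divide the last coefficient, the gcd is a power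
        of \<open>p\<close> dividing \<open>p ^ e n\<close>. Hence the chosen socle element is a
        power of \<open>?y\<close>, and by the relation a product of some \<open>\<nu>\<close> in
        the earlier span and some \<open>\<zeta>\<close> in \<open>Q\<close>.\<close>
      define g where "g = gcd (c n) (int p ^ Suc (e n))"
      have "g dvd int p ^ Suc (e n)" by (simp add: g_def)
      moreover have "prime_elem (int p)" using p by (simp add: prime_imp_prime_elem)
      ultimately obtain j where j: "j \<le> Suc (e n)" "normalize g = normalize (int p ^ j)"
        using divides_primepow_weak[of "int p" g "Suc (e n)"] by auto
      then have gj: "g = int p ^ j" by (simp add: g_def)
      have "j \<noteq> Suc (e n)" using ndvd gj by (metis g_def gcd_dvd1)
      then have "g dvd ?q" using gj j(1) by (simp add: le_imp_power_dvd)
      then obtain l where l: "?q = g * l" by blast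
      obtain u v where uv: "u * c n + v * int p ^ Suc (e n) = g" unfolding g_def using bezout_int by blast
      have q: "?q = c n * (u * l) + int p ^ Suc (e n) * (v * l)"
        by (subst l, subst uv[symmetric]) (simp add: algebra_simps)
      have "b n [^] ?q = b n [^] (c n * (u * l)) \<otimes> b n [^] (int p ^ Suc (e n) * (v * l))"
        by (subst q) (rule int_pow_mult[OF bc])
      also have "b n [^] (int p ^ Suc (e n) * (v * l)) = \<one>"
        by (rule int_pow_dvd_one[OF bc bpow]) simp
      also have "b n [^] (c n * (u * l)) = ?y [^] (u * l)" using bc by (simp add: int_pow_pow)
      finally have s: "b n [^] ?q = ?y [^] (u * l)" using bc by simp
      define \<nu> where "\<nu> = inv ?x [^] (u * l)"
      define \<zeta> where "\<zeta> = (?x \<otimes> ?y) [^] (u * l)"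
      have \<nu>: "\<nu> \<in> span_upto G b n"
        unfolding \<nu>_def using subN xN by (intro subgroup_int_powI subgroup.m_inv_closed)
      have \<zeta>: "\<zeta> \<in> Q"
        unfolding \<zeta>_def using Q(1) Suc.prems by (intro subgroup_int_powI) auto
      have \<nu>c: "\<nu> \<in> carrier G" and \<zeta>c: "\<zeta> \<in> carrier G"
        using subgroup.mem_carrier[OF subN \<nu>] subgroup.mem_carrier[OF Q(1) \<zeta>] by auto
      have "\<nu> \<otimes> \<zeta> = (inv ?x \<otimes> (?x \<otimes> ?y)) [^] (u * l)"
        unfolding \<nu>_def \<zeta>_def using cl by (simp add: int_pow_distrib)
      also have "inv ?x \<otimes> (?x \<otimes> ?y) = ?y" using cl by (simp add: m_assoc[symmetric])
      finally have s': "b n [^] ?q = \<nu> \<otimes> \<zeta>" using s by simp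
      \<comment> \<open>The \<open>p\<close>-th power of \<open>\<nu>\<close> lies in the earlier
        span and in \<open>Q\<close>, so it is trivial by induction. Then \<open>\<zeta>\<close>
        belongs to the socle of \<open>Q\<close>, against the choice of \<open>b n\<close>.\<close>
      have "(\<nu> \<otimes> \<zeta>) [^] int p = \<one>" using b[of n] s' by (auto simp: P_def tor_def)
      then have eq: "\<nu> [^] int p \<otimes> \<zeta> [^] int p = \<one>" using \<nu>c \<zeta>c by (simp add: int_pow_distrib)
      then have "\<nu> [^] int p = inv (\<zeta> [^] int p)"
        using \<nu>c \<zeta>c by (intro inv_equality[symmetric]) auto
      then have "\<nu> [^] int p \<in> Q"
        using subgroup.m_inv_closed[OF Q(1) subgroup_int_powI[OF Q(1) \<zeta>]] by simp
      then have "\<nu> [^] int p = \<one>" using triv subgroup_int_powI[OF subN \<nu>] by blast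
      then have "\<zeta> [^] int p = \<one>" using eq \<zeta>c by simp
      then have "b n [^] ?q \<in> span_upto G b n <#> (tor G (int p) \<inter> Q)"
        unfolding s' using \<nu> \<zeta> \<zeta>c by (intro set_mult_memI) (auto simp: tor_def)
      then show False using b[of n] by (simp add: P_def)
    qed
    then have "?y = \<one>" by (rule int_pow_dvd_one[OF bc bpow])
    then have "?x \<in> Q" using Suc.prems cl by simp
    then show ?case using Suc.IH dvd less_Suc_eq by auto
  qed simp
  then have "independent_mod G Q (\<lambda>i. int p ^ Suc (e i)) b"
    using bc bpow by (simp add: independent_mod_def del: power_Suc)
  then show ?thesis by blast
qed

end

text \<open>Either every height \<open>p ^ n\<close> admits infinitely many socle elements, which yields an
  independent sequence with orders \<open>p ^ (i + 1)\<close>, or there is a last such height, which yields a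
  bounded span that is independent modulo higher powers.\<close>

lemma Bassian_finite_socle:
  assumes B: "Bassian G" and p: "Factorial_Ring.prime p"
  shows "finite (tor G (int p))"
proof (rule ccontr)
  assume inf: "infinite (tor G (int p))"
  have G: "comm_group G" using B by (simp add: Bassian_def)
  interpret G: comm_group G by fact
  \<comment> \<open>The socle elements of \<open>p\<close>-height at least \<open>n\<close>.\<close>
  define S where "S n = tor G (int p) \<inter> {x [^]\<^bsub>G\<^esub> (int p ^ n) | x. x \<in> carrier G}" for n :: nat
  have p1: "int p > 1" using prime_gt_1_nat[OF p] by simp
  show False
  proof (cases "\<forall>n. infinite (S n)")
    case True
    have "\<exists>b. independent_mod G {\<one>\<^bsub>G\<^esub>} (\<lambda>i. int p ^ Suc i) b"
      using G.ex_independent_mod[OF p G.triv_subgroup, of "\<lambda>i. i"] True by (simp add: S_def)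
    then obtain b where b: "independent_mod G {\<one>\<^bsub>G\<^esub>} (\<lambda>i. int p ^ Suc i) b" by blast
    have t: "1 / of_nat p ^ Suc i \<in> carrier (prufer p)" for i
      using p1 by (auto simp: in_prufer divide_simps one_less_power simp del: power_Suc intro!: exI[of _ "Suc i"])
    have "\<not> Bassian G"
    proof (rule not_Bassian_test_group[OF G b _ comm_group_prufer divisible_prufer[OF p],
          where t="\<lambda>i. 1 / of_nat p ^ Suc i"])
      show "\<not> int p ^ Suc 0 dvd 1" using p1 by simp
      show "(1 / of_nat p ^ Suc i) [^]\<^bsub>prufer p\<^esub> k = \<one>\<^bsub>prufer p\<^esub> \<longleftrightarrow> int p ^ Suc i dvd k" for i k
      proof -
        have "(of_int k :: rat) / of_int (int p ^ Suc i) \<in> \<int> \<longleftrightarrow> int p ^ Suc i dvd k"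
          using p1 of_int_div_of_int_in_Ints_iff[of k "int p ^ Suc i"] by auto
        moreover have "of_int (int p ^ Suc i) = (of_nat p ^ Suc i :: rat)" by simp
        ultimately show ?thesis by (simp add: prufer_int_pow[OF t] del: power_Suc)
      qed
      fix y assume y: "y \<in> carrier (prufer p)"
      then obtain a :: nat where a: "of_nat p ^ a * y \<in> \<int>" by (auto simp: in_prufer)
      have "y [^]\<^bsub>prufer p\<^esub> (int p ^ Suc i) = \<one>\<^bsub>prufer p\<^esub>" if "i \<ge> a" for i
      proof -
        have "of_nat p ^ Suc i * y = of_nat (p ^ (Suc i - a)) * (of_nat p ^ a * y)"
          using that by (simp flip: power_add add: mult.assoc[symmetric] del: power_Suc)
        also have "\<dots> \<in> \<int>" by (rule Ints_mult[OF _ a]) simp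
        finally show ?thesis by (simp add: prufer_int_pow[OF y] mult_ac)
      qed
      then show "\<exists>a. \<forall>i\<ge>a. y [^]\<^bsub>prufer p\<^esub> (int p ^ Suc i) = \<one>\<^bsub>prufer p\<^esub>" by blast
    qed (rule t)
    then show False using B by simp
  next
    case False
    \<comment> \<open>With \<open>n = Suc m\<close>, height \<open>m\<close> still offers infinitely
      many socle elements, whereas the subgroup of \<open>p ^ n\<close>-th powers has the finite
      socle \<open>S n\<close>. The orders \<open>p ^ Suc m\<close> then coincide with the exponent
      \<open>p ^ n\<close> defining that subgroup, as the bounded case demands.\<close>
    define n where "n = (LEAST n. finite (S n))"
    have n: "finite (S n)" unfolding n_def using False by (auto intro: LeastI_ex)
    have "S 0 = tor G (int p)" unfolding S_def tor_def using G.int_pow_1 by force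
    then have "n \<noteq> 0" using n inf by metis
    then obtain m where m: "n = Suc m" using not0_implies_Suc by blast
    have "infinite (S m)" using not_less_Least[of m "\<lambda>n. finite (S n)"] m unfolding n_def by auto
    then have "\<exists>b. independent_mod G {x [^]\<^bsub>G\<^esub> (int p ^ n) | x. x \<in> carrier G} (\<lambda>i. int p ^ Suc m) b"
      using G.ex_independent_mod[OF p G.subgroup_int_pow_image, of "int p ^ n" "\<lambda>_. m"] n by (simp add: S_def)
    moreover have "int p ^ n > 1" using p1 m by (intro one_less_power) auto
    ultimately have "\<not> Bassian G"
      using not_Bassian_bounded[OF G, of "int p ^ n"] unfolding m by blast
    then show False using B by simp
  qed
qed

section \<open>Torsion and divisibility\<close>

definition primary :: "('a, 'm) monoid_scheme \<Rightarrow> nat \<Rightarrow> 'a set" where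
  "primary G p = {x \<in> carrier G. \<exists>k::nat. x [^]\<^bsub>G\<^esub> (int p ^ k) = \<one>\<^bsub>G\<^esub>}"

definition torsion_part :: "('a, 'm) monoid_scheme \<Rightarrow> 'a set" where
  "torsion_part G = {x \<in> carrier G. \<exists>m::int. m > 0 \<and> x [^]\<^bsub>G\<^esub> m = \<one>\<^bsub>G\<^esub>}"

text \<open>Roots are sought in \<open>G\<close>, not in the set itself, so in general this is only
  the first Ulm subgroup of the torsion part. Once all socles are finite it is divisible, and then
  it is the largest divisible torsion subgroup.\<close>

definition divisible_part :: "('a, 'm) monoid_scheme \<Rightarrow> 'a set" where
  "divisible_part G =
     {x \<in> torsion_part G. \<forall>k::int. k > 0 \<longrightarrow> (\<exists>y\<in>carrier G. y [^]\<^bsub>G\<^esub> k = x)}"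

definition finite_socles :: "('a, 'm) monoid_scheme \<Rightarrow> bool" where
  "finite_socles G \<longleftrightarrow> (\<forall>p. Factorial_Ring.prime p \<longrightarrow> finite (tor G (int p)))"

definition finite_primary_parts :: "('a, 'm) monoid_scheme \<Rightarrow> bool" where
  "finite_primary_parts G \<longleftrightarrow> (\<forall>p. Factorial_Ring.prime p \<longrightarrow> finite (primary G p))"

lemma tor_subset_primary: "tor G (int p) \<subseteq> primary G p"
  by (auto simp: tor_def primary_def intro!: exI[of _ "1::nat"])

lemma finite_primary_parts_imp_socles: "finite_primary_parts G \<Longrightarrow> finite_socles G"
  using tor_subset_primary finite_subset
  unfolding finite_primary_parts_def finite_socles_def by metis

context comm_group
begin

lemma subgroup_torsion_part: "subgroup (torsion_part G) G"
proof (rule subgroupI)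
  show "torsion_part G \<subseteq> carrier G" by (auto simp: torsion_part_def)
  have "\<one> \<in> torsion_part G" by (auto simp: torsion_part_def intro: exI[of _ 1])
  then show "torsion_part G \<noteq> {}" by blast
  show "\<And>a. a \<in> torsion_part G \<Longrightarrow> inv a \<in> torsion_part G"
    by (auto simp: torsion_part_def int_pow_inv)
  fix a a' assume "a \<in> torsion_part G" "a' \<in> torsion_part G"
  then obtain m m' :: int where a: "a \<in> carrier G" "m > 0" "a [^] m = \<one>"
    and a': "a' \<in> carrier G" "m' > 0" "a' [^] m' = \<one>"
    by (auto simp: torsion_part_def)
  have "a [^] (m * m') = \<one>" "a' [^] (m * m') = \<one>"
    using int_pow_dvd_one[OF a(1,3)] int_pow_dvd_one[OF a'(1,3)] by simp_all
  then have "(a \<otimes> a') [^] (m * m') = \<one>" using a a' by (simp add: int_pow_distrib)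
  moreover have "m * m' > 0" using a a' by simp
  ultimately have "\<exists>k::int. k > 0 \<and> (a \<otimes> a') [^] k = \<one>" by blast
  then show "a \<otimes> a' \<in> torsion_part G" using a a' by (simp add: torsion_part_def)
qed

lemma torsion_part_root:
  assumes "x \<in> carrier G" "(k::int) > 0" "x [^] k \<in> torsion_part G"
  shows "x \<in> torsion_part G"
proof -
  obtain m :: int where "m > 0" "(x [^] k) [^] m = \<one>" using assms(3) by (auto simp: torsion_part_def)
  then have "k * m > 0" "x [^] (k * m) = \<one>" using assms by (auto simp: int_pow_pow)
  then show ?thesis using assms(1) unfolding torsion_part_def by blast
qed

text \<open>For a prime divisor \<open>p\<close> of the order of \<open>x\<close>, the exponent is
  the order divided by \<open>p\<close>.\<close>

lemma torsion_socle_power: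
  assumes "x \<in> torsion_part G" "x \<noteq> \<one>"
  obtains p and j :: int where "Factorial_Ring.prime p" "x [^] j \<noteq> \<one>" "(x [^] j) [^] int p = \<one>"
proof -
  have x: "x \<in> carrier G" using assms by (simp add: torsion_part_def)
  have ex: "\<exists>n::nat. n > 0 \<and> x [^] int n = \<one>"
    using assms unfolding torsion_part_def by (auto dest: zero_less_imp_eq_int)
  define n where "n = (LEAST n::nat. n > 0 \<and> x [^] int n = \<one>)"
  have n: "n > 0" "x [^] int n = \<one>" using LeastI_ex[OF ex] unfolding n_def by simp_all
  have "n \<noteq> 1" using n x assms(2) by auto
  then obtain p where p: "Factorial_Ring.prime p" "p dvd n" using prime_factor_nat by blast
  then obtain m where m: "n = p * m" by blast
  have "m > 0" "m < n" using n m prime_gt_1_nat[OF p(1)] by auto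
  then have "x [^] int m \<noteq> \<one>" using not_less_Least[of m] unfolding n_def by blast
  moreover have "(x [^] int m) [^] int p = \<one>"
    using n(2) x by (simp add: int_pow_pow m mult.commute)
  ultimately show ?thesis using that p(1) by blast
qed

text \<open>If there is a root at all, the roots form a coset of \<open>tor G n\<close>.\<close>

lemma finite_roots:
  assumes "finite (tor G n)"
  shows "finite {z \<in> carrier G. z [^] n = y}"
proof (cases "\<exists>z\<in>carrier G. z [^] n = y")
  case True
  then obtain w where w: "w \<in> carrier G" "w [^] n = y" by blast
  have "{z \<in> carrier G. z [^] n = y} \<subseteq> (\<lambda>t. w \<otimes> t) ` tor G n"
  proof
    fix z assume z: "z \<in> {z \<in> carrier G. z [^] n = y}"
    then have "inv w \<otimes> z \<in> tor G n"
      using w by (auto simp: tor_def int_pow_distrib int_pow_inv)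
    moreover have "z = w \<otimes> (inv w \<otimes> z)" using w z by (simp add: m_assoc[symmetric])
    ultimately show "z \<in> (\<lambda>t. w \<otimes> t) ` tor G n" by blast
  qed
  then show ?thesis using assms finite_subset by blast
next
  case False
  then have none: "{z \<in> carrier G. z [^] n = y} = {}" by blast
  show ?thesis unfolding none by simp
qed

lemma finite_tor:
  assumes "finite_socles G" "n > 0"
  shows "finite (tor G (int n))"
  using assms(2)
proof (induction n rule: less_induct)
  case (less n)
  show ?case
  proof (cases "n = 1")
    case True
    then have "tor G (int n) \<subseteq> {\<one>}" by (auto simp: tor_def)
    then show ?thesis using finite_subset by blast
  next
    case False
    then obtain p where p: "Factorial_Ring.prime p" "p dvd n" using prime_factor_nat by blast
    then obtain m where m: "n = p * m" by blast
    have "finite (tor G (int m))"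
      using less m prime_gt_1_nat[OF p(1)] by auto
    moreover have "finite {z \<in> carrier G. z [^] int p = y}" for y
      using assms(1) p(1) by (intro finite_roots) (simp add: finite_socles_def)
    moreover have "tor G (int n) \<subseteq> (\<Union>y\<in>tor G (int m). {z \<in> carrier G. z [^] int p = y})"
      by (auto simp: tor_def m int_pow_pow)
    ultimately show ?thesis by (auto intro: finite_subset)
  qed
qed

lemma divisible_part_subset: "divisible_part G \<subseteq> carrier G"
  by (auto simp: divisible_part_def torsion_part_def)

lemma subgroup_divisible_part: "subgroup (divisible_part G) G"
proof (rule subgroupI)
  show "divisible_part G \<subseteq> carrier G" by (rule divisible_part_subset)
  have "\<one> \<in> divisible_part G"
    using subgroup.one_closed[OF subgroup_torsion_part] by (auto simp: divisible_part_def intro: bexI[of _ \<one>])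
  then show "divisible_part G \<noteq> {}" by blast
next
  fix a assume a: "a \<in> divisible_part G"
  have "\<exists>y\<in>carrier G. y [^] k = inv a" if k: "k > 0" for k :: int
  proof -
    obtain y where "y \<in> carrier G" "y [^] k = a" using a k by (auto simp: divisible_part_def)
    then show ?thesis by (intro bexI[of _ "inv y"]) (auto simp: int_pow_inv)
  qed
  then show "inv a \<in> divisible_part G"
    using a subgroup.m_inv_closed[OF subgroup_torsion_part] by (auto simp: divisible_part_def)
next
  fix a a' assume a: "a \<in> divisible_part G" "a' \<in> divisible_part G"
  have "\<exists>y\<in>carrier G. y [^] k = a \<otimes> a'" if k: "k > 0" for k :: int
  proof -
    obtain y where "y \<in> carrier G" "y [^] k = a" using a k by (auto simp: divisible_part_def)
    moreover obtain y' where "y' \<in> carrier G" "y' [^] k = a'" using a k by (auto simp: divisible_part_def)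
    ultimately show ?thesis by (intro bexI[of _ "y \<otimes> y'"]) (auto simp: int_pow_distrib)
  qed
  then show "a \<otimes> a' \<in> divisible_part G"
    using a subgroup.m_closed[OF subgroup_torsion_part] by (auto simp: divisible_part_def)
qed

text \<open>An element of the divisible part has only finitely many \<open>n\<close>-th roots; if each of them
  failed to have some \<open>k\<close>-th root, a root of order \<open>n\<close> times the product of these \<open>k\<close>
  would be contradictory.\<close>

lemma divisible_divisible_part:
  assumes "finite_socles G"
  shows "divisible_group (G\<lparr>carrier := divisible_part G\<rparr>)"
  unfolding divisible_group_def
proof (intro ballI allI impI)
  fix x and n :: int
  assume "x \<in> carrier (G\<lparr>carrier := divisible_part G\<rparr>)" and n: "n > 0"
  then have x: "x \<in> divisible_part G" by simp
  let ?R = "{z \<in> carrier G. z [^] n = x}"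
  have fin: "finite ?R" using finite_roots[OF finite_tor[OF assms, of "nat n"]] n by simp
  have "\<exists>z\<in>?R. z \<in> divisible_part G"
  proof (rule ccontr)
    assume no: "\<not> (\<exists>z\<in>?R. z \<in> divisible_part G)"
    have "\<exists>k::int. k > 0 \<and> \<not> (\<exists>y\<in>carrier G. y [^] k = z)" if "z \<in> ?R" for z
    proof -
      have "z \<in> torsion_part G"
        by (rule torsion_part_root[of z n]) (use that n x in \<open>auto simp: divisible_part_def\<close>)
      then show ?thesis using no that by (auto simp: divisible_part_def)
    qed
    then obtain k :: "'a \<Rightarrow> int" where k: "\<And>z. z \<in> ?R \<Longrightarrow> k z > 0 \<and> \<not> (\<exists>y\<in>carrier G. y [^] k z = z)"
      by metis
    define K where "K = prod k ?R"
    have "K > 0" unfolding K_def using k by (intro prod_pos) blast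
    then have "K * n > 0" using n by simp
    then obtain y where y: "y \<in> carrier G" "y [^] (K * n) = x"
      using x by (auto simp: divisible_part_def)
    define z where "z = y [^] K"
    have z: "z \<in> ?R" using y by (simp add: z_def int_pow_pow)
    have "k z dvd K" unfolding K_def using fin z by (rule dvd_prodI)
    then obtain l where "K = k z * l" by blast
    then have "(y [^] l) [^] k z = z" using y(1) by (simp add: z_def int_pow_pow mult.commute)
    then show False using k[OF z] int_pow_closed[OF y(1)] by blast
  qed
  then show "\<exists>e\<in>carrier (G\<lparr>carrier := divisible_part G\<rparr>). e [^]\<^bsub>G\<lparr>carrier := divisible_part G\<rparr>\<^esub> n = x"
    using subgroup_int_pow_eq[OF subgroup_divisible_part] by auto
qed

text \<open>Finite socles make every \<open>tor G (p ^ k)\<close> finite, so an infinite primary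
  component has elements of unbounded order. Powers of these are nontrivial socle elements with
  \<open>p ^ k\<close>-th roots, and finiteness of the socle lets a single one serve all
  \<open>k\<close>.\<close>

lemma infinite_primary_imp_divisible:
  assumes fs: "finite_socles G" and p: "Factorial_Ring.prime p" and inf: "infinite (primary G p)"
  shows "\<exists>s\<in>divisible_part G. s \<noteq> \<one> \<and> s [^] int p = \<one>"
proof -
  have p0: "int p > 0" using prime_gt_0_nat[OF p] by simp
  let ?S = "tor G (int p) - {\<one>}"
  have fin: "finite ?S" using fs p by (simp add: finite_socles_def)
  have ex: "\<exists>s\<in>?S. \<exists>y\<in>carrier G. y [^] (int p ^ k) = s" for k :: nat
  proof -
    have "finite (tor G (int (p ^ k)))" using p0 by (intro finite_tor[OF fs]) simp
    then have "\<not> primary G p \<subseteq> tor G (int p ^ k)" using inf finite_subset by auto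
    then obtain x where x: "x \<in> carrier G" and xk: "x [^] (int p ^ k) \<noteq> \<one>"
      and xp: "\<exists>j::nat. x [^] (int p ^ j) = \<one>"
      by (auto simp: primary_def tor_def)
    define j where "j = (LEAST j::nat. x [^] (int p ^ j) = \<one>)"
    have j: "x [^] (int p ^ j) = \<one>" unfolding j_def using xp by (rule LeastI_ex)
    have "\<not> j \<le> k"
      using xk int_pow_dvd_one[OF x j, of "int p ^ k"] by (auto simp: le_imp_power_dvd)
    then obtain i where i: "j = Suc i" "i \<ge> k" by (cases j) auto
    define s where "s = x [^] (int p ^ i)"
    have "s \<noteq> \<one>"
      using not_less_Least[of i "\<lambda>j. x [^] (int p ^ j) = \<one>"] i(1) unfolding j_def s_def by simp
    moreover have "s [^] int p = \<one>" using j x by (simp add: s_def i int_pow_pow mult.commute)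
    moreover have "(x [^] (int p ^ (i - k))) [^] (int p ^ k) = s"
      using i(2) x by (simp add: s_def int_pow_pow flip: power_add)
    ultimately show ?thesis using x by (auto simp: tor_def s_def)
  qed
  have "\<exists>s\<in>?S. \<forall>k::nat. \<exists>y\<in>carrier G. y [^] (int p ^ k) = s"
  proof (rule ccontr)
    assume "\<not> ?thesis"
    then obtain k :: "'a \<Rightarrow> nat" where k: "\<And>s. s \<in> ?S \<Longrightarrow> \<not> (\<exists>y\<in>carrier G. y [^] (int p ^ k s) = s)"
      by metis
    \<comment> \<open>The sum of all failing exponents dominates each of them, yet some socle
      element has a root for this exponent.\<close>
    obtain s y where s: "s \<in> ?S" and y: "y \<in> carrier G" "y [^] (int p ^ (\<Sum>s\<in>?S. k s)) = s"
      using ex by blast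
    have "k s \<le> (\<Sum>s\<in>?S. k s)" using fin s by (intro member_le_sum) auto
    then have "(y [^] (int p ^ ((\<Sum>s\<in>?S. k s) - k s))) [^] (int p ^ k s) = s"
      using y by (simp add: int_pow_pow flip: power_add)
    then show False using k[OF s] int_pow_closed[OF y(1)] by blast
  qed
  then obtain s where s: "s \<in> carrier G" "s [^] int p = \<one>" "s \<noteq> \<one>"
    and div: "\<And>k::nat. \<exists>y\<in>carrier G. y [^] (int p ^ k) = s"
    by (auto simp: tor_def)
  \<comment> \<open>The part of \<open>k\<close> prime to \<open>p\<close> acts invertibly on
    \<open>s\<close>, which has order \<open>p\<close>; only the \<open>p\<close>-part requires
    \<open>div\<close>.\<close>
  have "\<exists>y\<in>carrier G. y [^] k = s" if k: "k > 0" for k :: int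
  proof -
    obtain a u w v where ku: "k = int p ^ a * u" and uw: "u * w + int p ^ 1 * v = 1"
      by (rule ex_prime_power_cofactor[OF p k])
    obtain y where y: "y \<in> carrier G" "y [^] (int p ^ a) = s" using div by blast
    have "s = s [^] (u * w + int p * v)" using uw s(1) by simp
    also have "\<dots> = s [^] (u * w)" using s int_pow_dvd_one[OF s(1,2), of "int p * v"] by (simp add: int_pow_mult)
    also have "\<dots> = (y [^] w) [^] k" using y(1) by (simp add: int_pow_pow ku mult_ac flip: y(2))
    finally show ?thesis using y(1) by (intro bexI[of _ "y [^] w"]) auto
  qed
  moreover have "s \<in> torsion_part G" using s(1,2) p0 unfolding torsion_part_def by blast
  ultimately show ?thesis using s by (auto simp: divisible_part_def)
qed

lemma torsion_free_rank_finite_subgroup: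
  assumes "torsion_free_rank_finite G" "subgroup H G"
  shows "torsion_free_rank_finite (G\<lparr>carrier := H\<rparr>)"
proof -
  have "independent_mod G {\<one>} (\<lambda>_. 0) b" if b: "independent_mod (G\<lparr>carrier := H\<rparr>) {\<one>} (\<lambda>_. 0) b" for b
    using independent_modD(1)[OF b] b independent_mod_subgroup_iff[OF assms(2)] by simp
  then show ?thesis using assms(1) by (auto simp: torsion_free_rank_finite_def)
qed

lemma tor_subgroup: "subgroup H G \<Longrightarrow> tor (G\<lparr>carrier := H\<rparr>) n = H \<inter> tor G n"
  by (auto simp: tor_def subgroup_int_pow_eq subgroup.mem_carrier)

lemma primary_subgroup: "subgroup H G \<Longrightarrow> primary (G\<lparr>carrier := H\<rparr>) p = H \<inter> primary G p"
  by (auto simp: primary_def subgroup_int_pow_eq subgroup.mem_carrier)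

lemma finite_socles_subgroup: "finite_socles G \<Longrightarrow> subgroup H G \<Longrightarrow> finite_socles (G\<lparr>carrier := H\<rparr>)"
  by (simp add: finite_socles_def tor_subgroup)

lemma finite_primary_parts_subgroup:
  "finite_primary_parts G \<Longrightarrow> subgroup H G \<Longrightarrow> finite_primary_parts (G\<lparr>carrier := H\<rparr>)"
  by (simp add: finite_primary_parts_def primary_subgroup)

end

section \<open>The structure of Bassian groups\<close>

text \<open>The socles being finite already, an infinite primary component would place an element of
  order \<open>p\<close> in the divisible part, which is then a divisible subgroup with
  torsion.\<close>

lemma Bassian_finite_primary_parts:
  assumes "Bassian G"
  shows "finite_primary_parts G"
  unfolding finite_primary_parts_def
proof (intro allI impI, rule ccontr)
  fix p assume p: "Factorial_Ring.prime p" and inf: "infinite (primary G p)"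
  have G: "comm_group G" using assms by (simp add: Bassian_def)
  interpret G: comm_group G by fact
  have fs: "finite_socles G" using Bassian_finite_socle[OF assms] by (simp add: finite_socles_def)
  obtain s where "s \<in> divisible_part G" "s \<noteq> \<one>\<^bsub>G\<^esub>" "s [^]\<^bsub>G\<^esub> int p = \<one>\<^bsub>G\<^esub>"
    using G.infinite_primary_imp_divisible[OF fs p inf] by blast
  then have "\<not> Bassian G"
    using not_Bassian_divisible_subgroup[OF G G.subgroup_divisible_part G.divisible_divisible_part[OF fs], of "int p" s]
      prime_gt_0_nat[OF p] by simp
  then show False using assms by simp
qed

text \<open>If \<open>h \<in> H\<close> has infinite order and \<open>f\<close> embeds \<open>G\<close> into \<open>G / H\<close>, then choosing
  \<open>h\<^sub>0 = h\<close> and representatives \<open>h\<^sub>i\<^sub>+\<^sub>1 \<in> f h\<^sub>i\<close> yields an infinite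
  independent sequence.\<close>

lemma BassianI:
  assumes "comm_group G" "torsion_free_rank_finite G" "finite_primary_parts G"
  shows "Bassian G"
  unfolding Bassian_def
proof (intro conjI assms(1) notI)
  interpret G: comm_group G by fact
  assume "\<exists>H f. subgroup H G \<and> H \<noteq> {\<one>\<^bsub>G\<^esub>} \<and> f \<in> hom G (G Mod H) \<and> inj_on f (carrier G)"
  then obtain H f where subH: "subgroup H G" and H1: "H \<noteq> {\<one>\<^bsub>G\<^esub>}"
    and f: "f \<in> hom G (G Mod H)" and inj: "inj_on f (carrier G)" by blast
  interpret H: normal H G using G.normal_iff_subgroup subH by simp
  have Q: "comm_group (G Mod H)" using G.abelian_FactGroup[OF subH] .
  interpret Q: comm_group "G Mod H" by fact
  define \<kappa> where "\<kappa> x = H #>\<^bsub>G\<^esub> x" for x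
  have \<kappa>: "\<kappa> \<in> hom G (G Mod H)" unfolding \<kappa>_def by (rule H.r_coset_hom_Mod)
  interpret f: group_hom G "G Mod H" f using f by unfold_locales
  interpret \<kappa>: group_hom G "G Mod H" \<kappa> using \<kappa> by unfold_locales
  have ker: "\<kappa> x = \<one>\<^bsub>G Mod H\<^esub> \<longleftrightarrow> x \<in> H" if "x \<in> carrier G" for x
    using that G.coset_join1[OF _ that subH] G.coset_join2[OF that subH] by (auto simp: \<kappa>_def)
  have rep: "\<exists>y. y \<in> carrier G \<and> \<kappa> y = f x" if "x \<in> carrier G" for x
    using f.hom_closed[OF that] by (auto simp: carrier_FactGroup \<kappa>_def)
  have tors: "h \<in> torsion_part G" if h: "h \<in> H" for h
  proof (rule ccontr)
    assume nt: "h \<notin> torsion_part G"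
    have hc: "h \<in> carrier G" using h by simp
    have nt': "k = 0" if k: "h [^]\<^bsub>G\<^esub> k = \<one>\<^bsub>G\<^esub>" for k :: int
    proof (rule ccontr)
      assume "k \<noteq> 0"
      then have "\<bar>k\<bar> > 0" "h [^]\<^bsub>G\<^esub> \<bar>k\<bar> = \<one>\<^bsub>G\<^esub>"
        using G.int_pow_dvd_one[OF hc k, of "\<bar>k\<bar>"] by auto
      then show False using nt hc by (auto simp: torsion_part_def)
    qed
    define hs where "hs = rec_nat h (\<lambda>_ x. SOME y. y \<in> carrier G \<and> \<kappa> y = f x)"
    have hs0: "hs 0 = h" by (simp add: hs_def)
    have hsS: "hs (Suc i) = (SOME y. y \<in> carrier G \<and> \<kappa> y = f (hs i))" for i by (simp add: hs_def)
    have hsc: "hs i \<in> carrier G" for i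
    proof (induction i)
      case (Suc i)
      then show ?case unfolding hsS using someI_ex[OF rep[OF Suc]] by blast
    qed (simp add: hs0 hc)
    have \<kappa>hs: "\<kappa> (hs (Suc i)) = f (hs i)" for i
      unfolding hsS using someI_ex[OF rep[OF hsc[of i]]] by blast
    have "\<forall>i<n. c i = 0" if "lincomb G hs c n = \<one>\<^bsub>G\<^esub>" for c n
      using that
    proof (induction n arbitrary: c)
      case (Suc n)
      let ?c = "\<lambda>i. c (Suc i)"
      have eq: "h [^]\<^bsub>G\<^esub> c 0 \<otimes>\<^bsub>G\<^esub> lincomb G (\<lambda>i. hs (Suc i)) ?c n = \<one>\<^bsub>G\<^esub>"
        using Suc.prems G.lincomb_shift[of hs c n] hsc hs0 by (simp del: lincomb.simps)
      \<comment> \<open>Modulo \<open>H\<close> the first term disappears, and what remains is the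
        image under the injective \<open>f\<close> of a relation with one term fewer.\<close>
      have "\<kappa> (h [^]\<^bsub>G\<^esub> c 0) = \<one>\<^bsub>G Mod H\<^esub>"
        using ker G.subgroup_int_powI[OF subH h] hc by simp
      then have "\<kappa> (lincomb G (\<lambda>i. hs (Suc i)) ?c n) = \<one>\<^bsub>G Mod H\<^esub>"
        using arg_cong[OF eq, of \<kappa>] hc hsc by (simp del: one_FactGroup mult_FactGroup)
      then have "lincomb (G Mod H) (\<lambda>i. f (hs i)) ?c n = \<one>\<^bsub>G Mod H\<^esub>"
        using G.hom_lincomb[OF Q \<kappa>, of "\<lambda>i. hs (Suc i)" ?c n] hsc by (simp add: \<kappa>hs)
      then have "f (lincomb G hs ?c n) = \<one>\<^bsub>G Mod H\<^esub>"
        using G.hom_lincomb[OF Q f, of hs ?c n] hsc by simp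
      then have "lincomb G hs ?c n = \<one>\<^bsub>G\<^esub>"
        using inj f.inj_on_one_iff hsc by simp
      then have c: "\<forall>i<n. c (Suc i) = 0" by (rule Suc.IH)
      then have "lincomb G (\<lambda>i. hs (Suc i)) ?c n = \<one>\<^bsub>G\<^esub>"
        by (intro G.lincomb_one) simp
      then have "c 0 = 0" using eq hc nt' by simp
      then show ?case using c less_Suc_eq_0_disj by auto
    qed simp
    then have "independent_mod G {\<one>\<^bsub>G\<^esub>} (\<lambda>_. 0) hs" using hsc by (simp add: independent_mod_def)
    then show False using assms(2) by (auto simp: torsion_free_rank_finite_def)
  qed
  obtain h where h: "h \<in> H" "h \<noteq> \<one>\<^bsub>G\<^esub>" using H1 H.one_closed by blast
  obtain p j where p: "Factorial_Ring.prime p" and s: "h [^]\<^bsub>G\<^esub> (j::int) \<noteq> \<one>\<^bsub>G\<^esub>" "(h [^]\<^bsub>G\<^esub> j) [^]\<^bsub>G\<^esub> int p = \<one>\<^bsub>G\<^esub>"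
    by (rule G.torsion_socle_power[OF tors[OF h(1)] h(2)])
  \<comment> \<open>As \<open>H\<close> is torsion, \<open>f\<close> maps the finite component
    \<open>T\<close> into the image of \<open>T\<close> in the quotient. Counting then makes
    \<open>\<kappa>\<close> injective on \<open>T\<close>, although \<open>T\<close> contains a
    nontrivial power of \<open>h\<close>, which lies in \<open>H\<close>.\<close>
  define T where "T = primary G p"
  have fin: "finite T" using assms(3) p by (simp add: T_def finite_primary_parts_def)
  have Tc: "T \<subseteq> carrier G" by (auto simp: T_def primary_def)
  have "f ` T \<subseteq> \<kappa> ` T"
  proof
    fix z assume "z \<in> f ` T"
    then obtain x k where x: "x \<in> carrier G" "x [^]\<^bsub>G\<^esub> (int p ^ k) = \<one>\<^bsub>G\<^esub>" and z: "z = f x"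
      by (auto simp: T_def primary_def)
    obtain y where y: "y \<in> carrier G" "\<kappa> y = f x" using rep[OF x(1)] by blast
    have "\<kappa> (y [^]\<^bsub>G\<^esub> (int p ^ k)) = f (x [^]\<^bsub>G\<^esub> (int p ^ k))"
      using x(1) y by (simp add: \<kappa>.hom_int_pow f.hom_int_pow)
    then have "y [^]\<^bsub>G\<^esub> (int p ^ k) \<in> H" using x y ker by simp
    then obtain m :: int where m: "m > 0" "(y [^]\<^bsub>G\<^esub> (int p ^ k)) [^]\<^bsub>G\<^esub> m = \<one>\<^bsub>G\<^esub>"
      using tors by (auto simp: torsion_part_def)
    obtain a u w v where mu: "m = int p ^ a * u" and uw: "u * w + int p ^ k * v = 1"
      by (rule ex_prime_power_cofactor[OF p m(1)])
    \<comment> \<open>Some power of \<open>y\<close> lies in the torsion group \<open>H\<close>, so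
      \<open>y\<close> has finite order. The exponent \<open>u * w\<close> removes the part prime to
      \<open>p\<close> but fixes \<open>x\<close>, whose order divides \<open>p ^ k\<close>; so
      \<open>y'\<close> still represents \<open>f x\<close>.\<close>
    define y' where "y' = y [^]\<^bsub>G\<^esub> (u * w)"
    have "y' [^]\<^bsub>G\<^esub> (int p ^ (k + a)) = ((y [^]\<^bsub>G\<^esub> (int p ^ k)) [^]\<^bsub>G\<^esub> m) [^]\<^bsub>G\<^esub> w"
      using y(1) by (simp add: y'_def G.int_pow_pow mu power_add mult_ac)
    also have "\<dots> = \<one>\<^bsub>G\<^esub>" by (simp add: m(2))
    finally have "y' \<in> T" using y(1) by (auto simp: T_def primary_def y'_def)
    moreover have "\<kappa> y' = z"
    proof -
      have "\<kappa> y' = f (x [^]\<^bsub>G\<^esub> (u * w))"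
        using x(1) y by (simp add: y'_def \<kappa>.hom_int_pow f.hom_int_pow)
      also have "x [^]\<^bsub>G\<^esub> (u * w) = x [^]\<^bsub>G\<^esub> (u * w) \<otimes>\<^bsub>G\<^esub> x [^]\<^bsub>G\<^esub> (int p ^ k * v)"
        using x G.int_pow_dvd_one[OF x, of "int p ^ k * v"] by simp
      also have "\<dots> = x" using x(1) uw by (simp flip: G.int_pow_mult)
      finally show ?thesis by (simp add: z)
    qed
    ultimately show "z \<in> \<kappa> ` T" by blast
  qed
  then have "card (f ` T) \<le> card (\<kappa> ` T)" using fin by (intro card_mono) auto
  moreover have "card (f ` T) = card T" using inj Tc by (intro card_image) (rule inj_on_subset)
  ultimately have "card (\<kappa> ` T) = card T" using card_image_le[OF fin, of \<kappa>] by simp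
  then have "inj_on \<kappa> T" using fin by (rule eq_card_imp_inj_on[rotated])
  moreover have "h [^]\<^bsub>G\<^esub> j \<in> T"
    using s(2) h(1) tor_subset_primary[of G p] by (auto simp: T_def tor_def)
  moreover have "\<one>\<^bsub>G\<^esub> \<in> T" by (auto simp: T_def primary_def)
  moreover have "\<kappa> (h [^]\<^bsub>G\<^esub> j) = \<kappa> \<one>\<^bsub>G\<^esub>"
    using ker[of "h [^]\<^bsub>G\<^esub> j"] G.subgroup_int_powI[OF subH h(1)] h(1) by simp
  ultimately show False using s(1) by (simp add: inj_on_def)
qed

lemma Bassian_iff:
  "Bassian G \<longleftrightarrow> comm_group G \<and> torsion_free_rank_finite G \<and> finite_primary_parts G"
  using BassianI[of G] Bassian_torsion_free_rank_finite[of G] Bassian_finite_primary_parts[of G]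
    Bassian_def[of G] by blast

section \<open>Direct finiteness and Hopficity\<close>

text \<open>The shift \<open>b\<^sub>i \<mapsto> b\<^sub>i\<^sub>+\<^sub>1\<close> maps the span of \<open>b\<close> onto a proper direct summand.\<close>

lemma not_directly_finite_spanI:
  assumes "comm_group G" "independent_mod G {\<one>\<^bsub>G\<^esub>} (\<lambda>_. q) b" "\<not> q dvd 1"
    and span: "carrier G = span_all G b"
  shows "\<not> directly_finite G"
proof -
  interpret G: comm_group G by fact
  note b = independent_modD[OF assms(2)]
  let ?b = "\<lambda>i. b (Suc i)"
  let ?\<Gamma> = "{(lincomb G b c n \<otimes>\<^bsub>G\<^esub> q, lincomb G ?b c n) | c n q. q \<in> {\<one>\<^bsub>G\<^esub>}}"
  have ph: "partial_hom G G ?\<Gamma>"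
    by (rule partial_hom_lincomb[OF assms(1,1) G.triv_subgroup assms(2)]) (use b in auto)
  have mem: "(lincomb G b c n, lincomb G ?b c n) \<in> ?\<Gamma>" for c n
  proof -
    have "lincomb G b c n \<otimes>\<^bsub>G\<^esub> \<one>\<^bsub>G\<^esub> = lincomb G b c n" using b(1) by simp
    then show ?thesis by (metis (mono_tags, lifting) mem_Collect_eq singletonI)
  qed
  have "\<exists>d. (x, d) \<in> ?\<Gamma>" if "x \<in> carrier G" for x
    using that mem unfolding span span_all_def by blast
  then obtain \<sigma> where \<sigma>: "\<sigma> \<in> hom G G" and \<sigma>\<Gamma>: "\<forall>(x, d)\<in>?\<Gamma>. \<sigma> x = d"
    using total_partial_hom[OF ph G.group_axioms G.group_axioms] by blast
  have \<sigma>lin: "\<sigma> (lincomb G b c n) = lincomb G ?b c n" for c n using bspec[OF \<sigma>\<Gamma> mem] by simp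
  interpret \<sigma>: group_hom G G \<sigma> using \<sigma> by unfold_locales
  \<comment> \<open>A power of \<open>b 0\<close> and a combination of the shifted sequence merge
    into one combination of \<open>b\<close>. Independence of \<open>b\<close> then gives both
    injectivity of \<open>\<sigma>\<close> and triviality of \<open>A \<inter> C\<close>.\<close>
  have lin_cases: "b 0 [^]\<^bsub>G\<^esub> k \<otimes>\<^bsub>G\<^esub> lincomb G ?b c n = lincomb G b (case_nat k c) (Suc n)" for k c n
    using G.lincomb_shift[of b "case_nat k c" n] b(1) by simp
  have inj: "inj_on \<sigma> (carrier G)"
    unfolding \<sigma>.inj_on_one_iff
  proof (intro allI impI)
    fix x assume x: "x \<in> carrier G" "\<sigma> x = \<one>\<^bsub>G\<^esub>"
    then obtain c n where c: "x = lincomb G b c n" unfolding span span_all_def by blast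
    have "lincomb G ?b c n = \<one>\<^bsub>G\<^esub>" using x(2) by (simp add: c \<sigma>lin)
    then have "lincomb G b (case_nat 0 c) (Suc n) \<in> {\<one>\<^bsub>G\<^esub>}" using lin_cases[of 0 c n] b(1) by simp
    then have "q dvd case_nat 0 c (Suc i)" if "i < n" for i using b(3)[of "case_nat 0 c" "Suc n" "Suc i"] that by simp
    then show "x = \<one>\<^bsub>G\<^esub>" unfolding c
      by (intro G.lincomb_one) (use G.int_pow_dvd_one[OF b(1,2)] in simp)
  qed
  define A where "A = \<sigma> ` carrier G"
  define C where "C = generate G {b 0}"
  have subA: "subgroup A G" unfolding A_def by (rule \<sigma>.img_is_subgroup)
  have C: "C = {b 0 [^]\<^bsub>G\<^esub> k | k :: int. True}" unfolding C_def using G.generate_pow[OF b(1)] by auto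
  have subC: "subgroup C G" unfolding C_def by (rule G.generate_is_subgroup) (use b(1) in auto)
  have "A \<inter> C \<subseteq> {\<one>\<^bsub>G\<^esub>}"
  proof
    fix x assume "x \<in> A \<inter> C"
    then have "x \<in> A" "x \<in> C" by auto
    from \<open>x \<in> A\<close> obtain c n where "x = \<sigma> (lincomb G b c n)" by (auto simp: A_def span span_all_def)
    moreover from \<open>x \<in> C\<close> obtain k :: int where "x = b 0 [^]\<^bsub>G\<^esub> k" by (auto simp: C)
    ultimately have x: "x = lincomb G ?b c n" "x = b 0 [^]\<^bsub>G\<^esub> k" by (simp_all add: \<sigma>lin)
    have "b 0 [^]\<^bsub>G\<^esub> (-k) \<otimes>\<^bsub>G\<^esub> lincomb G ?b c n = \<one>\<^bsub>G\<^esub>"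
      using b(1) by (simp add: G.int_pow_neg flip: x) (simp add: x(2))
    then have "lincomb G b (case_nat (-k) c) (Suc n) \<in> {\<one>\<^bsub>G\<^esub>}" by (simp only: lin_cases singleton_iff)
    then have "q dvd -k" using b(3)[of "case_nat (-k) c" "Suc n" 0] by simp
    then show "x \<in> {\<one>\<^bsub>G\<^esub>}" using G.int_pow_dvd_one[OF b(1,2)] x(2) by simp
  qed
  then have AC: "A \<inter> C = {\<one>\<^bsub>G\<^esub>}"
    using subgroup.one_closed[OF subA] subgroup.one_closed[OF subC] by blast
  have "carrier G \<subseteq> A <#>\<^bsub>G\<^esub> C"
  proof
    fix x assume "x \<in> carrier G"
    then obtain c n where x: "x = lincomb G b c n" unfolding span span_all_def by blast
    have "x = lincomb G b (\<lambda>i. if i < n then c i else 0) (Suc n)"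
      unfolding x using b(1) by (rule G.lincomb_extend) simp
    also have "\<dots> = lincomb G ?b (\<lambda>i. if Suc i < n then c (Suc i) else 0) n
        \<otimes>\<^bsub>G\<^esub> b 0 [^]\<^bsub>G\<^esub> (if 0 < n then c 0 else 0)"
      by (subst G.lincomb_shift) (use b(1) in \<open>auto simp: G.m_comm\<close>)
    finally have x': "x = lincomb G ?b (\<lambda>i. if Suc i < n then c (Suc i) else 0) n
        \<otimes>\<^bsub>G\<^esub> b 0 [^]\<^bsub>G\<^esub> (if 0 < n then c 0 else 0)" .
    have "lincomb G ?b (\<lambda>i. if Suc i < n then c (Suc i) else 0) n \<in> A"
      unfolding A_def \<sigma>lin[symmetric] using b(1) by (intro imageI) simp
    then show "x \<in> A <#>\<^bsub>G\<^esub> C" unfolding x' by (rule G.set_mult_memI) (unfold C, blast)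
  qed
  then have ACG: "A <#>\<^bsub>G\<^esub> C = carrier G"
    using subgroup.subset[OF G.mult_subgroups[OF subA subC]] by blast
  have "b 0 \<in> C" unfolding C_def by (simp add: generate.incl)
  moreover have "b 0 \<noteq> \<one>\<^bsub>G\<^esub>"
    using b(3)[of "\<lambda>_. 1" 1 0] assms(3) by auto
  ultimately have C1: "C \<noteq> {\<one>\<^bsub>G\<^esub>}" by auto
  have "\<sigma> \<in> iso G (G\<lparr>carrier := A\<rparr>)"
    using \<sigma> inj by (auto simp: iso_def hom_def bij_betw_def A_def)
  then have "G\<lparr>carrier := A\<rparr> \<cong> G" using G.iso_sym by (auto simp: is_iso_def)
  then show ?thesis using subA subC AC ACG C1 unfolding directly_finite_def by blast
qed

lemma not_directly_finite_span:
  fixes G :: "'a monoid"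
  assumes "comm_group G" "independent_mod G {\<one>\<^bsub>G\<^esub>} (\<lambda>_. q) b" "\<not> q dvd 1"
  shows "subgroup (span_all G b) G" "\<not> directly_finite (G\<lparr>carrier := span_all G b\<rparr>)"
proof -
  interpret G: comm_group G by fact
  note b = independent_modD(1)[OF assms(2)]
  show sub: "subgroup (span_all G b) G" using b by (rule G.subgroup_span_all)
  have bs: "b i \<in> span_all G b" for i using G.in_span_all[of b] b by blast
  show "\<not> directly_finite (G\<lparr>carrier := span_all G b\<rparr>)"
  proof (rule not_directly_finite_spanI[OF G.subgroup_comm_group[OF sub] _ assms(3), of b])
    show "independent_mod (G\<lparr>carrier := span_all G b\<rparr>) {\<one>\<^bsub>G\<lparr>carrier := span_all G b\<rparr>\<^esub>} (\<lambda>_. q) b"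
      using assms(2) G.independent_mod_subgroup_iff[OF sub bs] by simp
    have "lincomb (G\<lparr>carrier := span_all G b\<rparr>) b c n = lincomb G b c n" for c n
      by (rule G.lincomb_subgroup[OF sub bs])
    then show "carrier (G\<lparr>carrier := span_all G b\<rparr>) = span_all (G\<lparr>carrier := span_all G b\<rparr>) b"
      by (simp add: span_all_def)
  qed
qed

lemma hereditarily_directly_finite_imp:
  assumes "comm_group G" "\<And>H. subgroup H G \<Longrightarrow> directly_finite (G\<lparr>carrier := H\<rparr>)"
  shows "torsion_free_rank_finite G" "finite_socles G"
proof -
  interpret G: comm_group G by fact
  show "torsion_free_rank_finite G"
    unfolding torsion_free_rank_finite_def
  proof
    assume "\<exists>b. independent_mod G {\<one>\<^bsub>G\<^esub>} (\<lambda>_. 0) b"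
    then obtain b where b: "independent_mod G {\<one>\<^bsub>G\<^esub>} (\<lambda>_. 0) b" by blast
    show False using not_directly_finite_span[OF assms(1) b] assms(2) by simp
  qed
  show "finite_socles G"
    unfolding finite_socles_def
  proof (intro allI impI, rule ccontr)
    fix p assume p: "Factorial_Ring.prime p" and inf: "infinite (tor G (int p))"
    \<comment> \<open>Height 0 is no restriction, so the exponents \<open>e i = 0\<close> turn an
      infinite socle into an independent sequence of elements of order \<open>p\<close>.\<close>
    have "tor G (int p) \<inter> {x [^]\<^bsub>G\<^esub> (int p ^ 0) | x. x \<in> carrier G} = tor G (int p)"
      unfolding tor_def using G.int_pow_1 by force
    then obtain b where b: "independent_mod G {\<one>\<^bsub>G\<^esub>} (\<lambda>_. int p ^ Suc 0) b"
      using G.ex_independent_mod[OF p G.triv_subgroup, of "\<lambda>_. 0"] inf by auto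
    have "\<not> int p ^ Suc 0 dvd 1" using prime_gt_1_nat[OF p] by simp
    then show False using not_directly_finite_span[OF assms(1) b] assms(2) by simp
  qed
qed

text \<open>Projecting onto the summand \<open>A\<close> and applying the isomorphism from
  \<open>A\<close> to \<open>G\<close> is a surjective endomorphism whose kernel contains
  \<open>C\<close>.\<close>

lemma Hopfian_imp_directly_finite:
  assumes "Hopfian G"
  shows "directly_finite G"
  unfolding directly_finite_def
proof (intro conjI notI)
  show G: "comm_group G" using assms by (simp add: Hopfian_def)
  interpret G: comm_group G by fact
  assume "\<exists>A C. subgroup A G \<and> subgroup C G \<and> A \<inter> C = {\<one>\<^bsub>G\<^esub>} \<and> A <#>\<^bsub>G\<^esub> C = carrier G \<and>
      C \<noteq> {\<one>\<^bsub>G\<^esub>} \<and> G\<lparr>carrier := A\<rparr> \<cong> G"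
  then obtain A C f where A: "subgroup A G" and C: "subgroup C G" and AC: "A \<inter> C = {\<one>\<^bsub>G\<^esub>}"
    and ACG: "A <#>\<^bsub>G\<^esub> C = carrier G" and C1: "C \<noteq> {\<one>\<^bsub>G\<^esub>}" and f: "f \<in> iso (G\<lparr>carrier := A\<rparr>) G"
    unfolding is_iso_def by blast
  interpret A: subgroup A G by fact
  interpret C: subgroup C G by fact
  have fhom: "f \<in> hom (G\<lparr>carrier := A\<rparr>) G" and fbij: "bij_betw f A (carrier G)"
    using f by (auto simp: iso_def)
  have CA: "comm_group (G\<lparr>carrier := A\<rparr>)" by (rule G.subgroup_comm_group[OF A])
  interpret f: group_hom "G\<lparr>carrier := A\<rparr>" G f
    using CA fhom by (simp add: group_hom_def group_hom_axioms_def comm_group.axioms(2))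
  have uniq: "a = a'" if "a \<in> A" "a' \<in> A" "c \<in> C" "c' \<in> C" "a \<otimes>\<^bsub>G\<^esub> c = a' \<otimes>\<^bsub>G\<^esub> c'" for a a' c c'
  proof -
    have "inv\<^bsub>G\<^esub> a' \<otimes>\<^bsub>G\<^esub> a = inv\<^bsub>G\<^esub> a' \<otimes>\<^bsub>G\<^esub> (a \<otimes>\<^bsub>G\<^esub> c) \<otimes>\<^bsub>G\<^esub> inv\<^bsub>G\<^esub> c"
      using that(1-4) by (simp add: G.m_assoc)
    also have "\<dots> = c' \<otimes>\<^bsub>G\<^esub> inv\<^bsub>G\<^esub> c"
      unfolding that(5) using that(1-4) by (simp add: G.m_assoc[symmetric])
    finally have "inv\<^bsub>G\<^esub> a' \<otimes>\<^bsub>G\<^esub> a \<in> C" using that(3,4) by simp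
    moreover have "inv\<^bsub>G\<^esub> a' \<otimes>\<^bsub>G\<^esub> a \<in> A" using that(1,2) by simp
    ultimately have "inv\<^bsub>G\<^esub> a' \<otimes>\<^bsub>G\<^esub> a = \<one>\<^bsub>G\<^esub>" using AC by blast
    then show ?thesis using that(1,2) G.inv_solve_left[of "\<one>\<^bsub>G\<^esub>" a' a] by simp
  qed
  define pr where "pr x = (SOME a. a \<in> A \<and> (\<exists>c\<in>C. x = a \<otimes>\<^bsub>G\<^esub> c))" for x
  have pr: "pr (a \<otimes>\<^bsub>G\<^esub> c) = a" if "a \<in> A" "c \<in> C" for a c
    unfolding pr_def by (rule some_equality) (use that uniq in blast)+
  have decomp: "\<exists>a\<in>A. \<exists>c\<in>C. x = a \<otimes>\<^bsub>G\<^esub> c" if "x \<in> carrier G" for x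
    using that unfolding ACG[symmetric] set_mult_def by blast
  have prA: "pr a = a" if "a \<in> A" for a
    using pr[OF that C.one_closed] A.mem_carrier[OF that] by simp
  define h where "h x = f (pr x)" for x
  have "h \<in> hom G G"
  proof (rule homI)
    fix x y assume "x \<in> carrier G" "y \<in> carrier G"
    then obtain a c a' c' where a: "a \<in> A" "c \<in> C" "x = a \<otimes>\<^bsub>G\<^esub> c" and a': "a' \<in> A" "c' \<in> C" "y = a' \<otimes>\<^bsub>G\<^esub> c'"
      using decomp by meson
    show "h x \<in> carrier G" using a f.hom_closed by (simp add: h_def pr)
    have "x \<otimes>\<^bsub>G\<^esub> y = (a \<otimes>\<^bsub>G\<^esub> a') \<otimes>\<^bsub>G\<^esub> (c \<otimes>\<^bsub>G\<^esub> c')" using a a' by (simp add: G.m_ac)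
    then have "pr (x \<otimes>\<^bsub>G\<^esub> y) = a \<otimes>\<^bsub>G\<^esub> a'" using pr a a' by simp
    then show "h (x \<otimes>\<^bsub>G\<^esub> y) = h x \<otimes>\<^bsub>G\<^esub> h y" using a a' f.hom_mult by (simp add: h_def pr)
  qed
  then interpret h: group_hom G G h by unfold_locales
  have "h ` carrier G = carrier G"
  proof
    show "carrier G \<subseteq> h ` carrier G"
    proof
      fix y assume "y \<in> carrier G"
      then have "y \<in> f ` A" using fbij by (simp add: bij_betw_def)
      then obtain a where "a \<in> A" "f a = y" by blast
      then show "y \<in> h ` carrier G" by (intro image_eqI[of _ _ a]) (auto simp: h_def prA)
    qed
  qed auto
  then have "G Mod kernel G G h \<cong> G" by (rule h.FactGroup_iso)
  moreover have "group (G Mod kernel G G h)"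
    by (rule normal.factorgroup_is_group[OF h.normal_kernel])
  ultimately have iso: "G \<cong> G Mod kernel G G h" by (simp add: group.iso_sym)
  have "C \<subseteq> kernel G G h"
  proof
    fix c assume c: "c \<in> C"
    have "pr c = \<one>\<^bsub>G\<^esub>" using pr[OF A.one_closed c] c by simp
    then show "c \<in> kernel G G h" using c f.hom_one by (simp add: kernel_def h_def)
  qed
  then have "kernel G G h \<noteq> {\<one>\<^bsub>G\<^esub>}" using C1 C.one_closed by blast
  then show False using iso assms h.subgroup_kernel unfolding Hopfian_def by blast
qed

lemma hereditarily_Hopfian_imp:
  assumes "comm_group G" "\<And>H. subgroup H G \<Longrightarrow> Hopfian (G\<lparr>carrier := H\<rparr>)"
  shows "Bassian G"
proof (rule BassianI[OF assms(1)])
  interpret G: comm_group G by fact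
  have df: "directly_finite (G\<lparr>carrier := H\<rparr>)" if "subgroup H G" for H
    by (rule Hopfian_imp_directly_finite[OF assms(2)[OF that]])
  show "torsion_free_rank_finite G"
    by (rule hereditarily_directly_finite_imp(1)[OF assms(1) df])
  have fs: "finite_socles G" by (rule hereditarily_directly_finite_imp(2)[OF assms(1) df])
  show "finite_primary_parts G"
    unfolding finite_primary_parts_def
  proof (intro allI impI, rule ccontr)
    fix p assume p: "Factorial_Ring.prime p" and inf: "infinite (primary G p)"
    let ?N = "G\<lparr>carrier := divisible_part G\<rparr>"
    note sub = G.subgroup_divisible_part
    obtain s where s: "s \<in> divisible_part G" "s \<noteq> \<one>\<^bsub>G\<^esub>" "s [^]\<^bsub>G\<^esub> int p = \<one>\<^bsub>G\<^esub>"
      using G.infinite_primary_imp_divisible[OF fs p inf] by blast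
    interpret N: comm_group ?N by (rule G.subgroup_comm_group[OF sub])
    define h where "h x = x [^]\<^bsub>?N\<^esub> int p" for x
    have "h \<in> hom ?N ?N"
      by (rule homI) (simp_all only: h_def N.int_pow_closed N.int_pow_distrib)
    then interpret h: group_hom ?N ?N h by unfold_locales
    have "\<exists>x\<in>carrier ?N. h x = y" if "y \<in> carrier ?N" for y
      using G.divisible_divisible_part[OF fs] prime_gt_0_nat[OF p] that
      by (simp add: divisible_group_def h_def)
    then have "h ` carrier ?N = carrier ?N" using h.hom_closed by blast
    then have "?N Mod kernel ?N ?N h \<cong> ?N" by (rule h.FactGroup_iso)
    moreover have "group (?N Mod kernel ?N ?N h)"
      by (rule normal.factorgroup_is_group[OF h.normal_kernel])
    ultimately have "?N \<cong> ?N Mod kernel ?N ?N h" by (simp only: group.iso_sym)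
    moreover have "s \<in> kernel ?N ?N h"
      using s G.subgroup_int_pow_eq[OF sub s(1)] by (simp add: kernel_def h_def)
    then have "kernel ?N ?N h \<noteq> {\<one>\<^bsub>?N\<^esub>}" using s(2) by auto
    ultimately show False using assms(2)[OF sub] h.subgroup_kernel unfolding Hopfian_def by blast
  qed
qed

section \<open>Extended Bassian groups\<close>

text \<open>Modulo the integers \<open>x\<close> is annihilated by \<open>m\<close> and by a power
  of \<open>p\<close>; these are coprime, so \<open>x\<close> is an integer in [0,1).\<close>

lemma prufer_eq_zero:
  assumes x: "x \<in> carrier (prufer p)" and p: "Factorial_Ring.prime p"
    and m: "of_int m * x \<in> \<int>" "\<not> int p dvd m"
  shows "x = 0"
proof -
  obtain k :: nat where k: "of_nat p ^ k * x \<in> \<int>" using x by (auto simp: in_prufer)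
  have "coprime m (int p ^ k)"
    using prime_imp_coprime[of "int p" m] p m(2) by (simp add: coprime_commute)
  then have "gcd m (int p ^ k) = 1" by simp
  then obtain u v where uv: "u * m + v * int p ^ k = 1" using bezout_int[of m "int p ^ k"] by auto
  have "x = of_int (u * m + v * int p ^ k) * x" by (simp add: uv)
  also have "\<dots> = of_int u * (of_int m * x) + of_int v * (of_nat p ^ k * x)" by (simp add: algebra_simps)
  also have "\<dots> \<in> \<int>" by (rule Ints_add[OF Ints_mult[OF Ints_of_int m(1)] Ints_mult[OF Ints_of_int k]])
  finally obtain i where "x = of_int i" by (auto elim: Ints_cases)
  then show ?thesis using x by (auto simp: in_prufer)
qed

lemma zero_in_prufer [simp]: "0 \<in> carrier (prufer p)"
  by (simp add: in_prufer)

lemma carrier_prufer_sum: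
  "f \<in> carrier (prufer_sum np) \<longleftrightarrow> finite {(p, i). f p i \<noteq> 0} \<and>
    (\<forall>p i. f p i \<noteq> 0 \<longrightarrow> Factorial_Ring.prime p \<and> i < np p) \<and> (\<forall>p i. f p i \<in> carrier (prufer p))"
  by (auto simp: prufer_sum_def in_prufer)

lemma prufer_sum_simps [simp]:
  "f \<otimes>\<^bsub>prufer_sum np\<^esub> g = (\<lambda>p i. frac (f p i + g p i))" "\<one>\<^bsub>prufer_sum np\<^esub> = (\<lambda>p i. 0)"
  by (simp_all add: prufer_sum_def)

lemma comm_group_prufer_sum: "comm_group (prufer_sum np)"
proof (rule comm_groupI)
  fix f g assume f: "f \<in> carrier (prufer_sum np)" and g: "g \<in> carrier (prufer_sum np)"
  have "{(p, i). frac (f p i + g p i) \<noteq> 0} \<subseteq> {(p, i). f p i \<noteq> 0} \<union> {(p, i). g p i \<noteq> 0}" by auto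
  then have "finite {(p, i). frac (f p i + g p i) \<noteq> 0}"
    using f g by (auto simp: carrier_prufer_sum intro: finite_subset)
  moreover have "frac (f p i + g p i) \<in> carrier (prufer p)" for p i
    using comm_groupE(1)[OF comm_group_prufer[of p], of "f p i" "g p i"] f g
    by (simp add: carrier_prufer_sum)
  moreover have "Factorial_Ring.prime p \<and> i < np p" if "frac (f p i + g p i) \<noteq> 0" for p i
  proof -
    have "f p i \<noteq> 0 \<or> g p i \<noteq> 0" using that by auto
    then show ?thesis using f g by (auto simp: carrier_prufer_sum)
  qed
  ultimately show "f \<otimes>\<^bsub>prufer_sum np\<^esub> g \<in> carrier (prufer_sum np)"
    by (simp add: carrier_prufer_sum)
  let ?h = "\<lambda>p i. frac (- f p i)"
  have "{(p, i). ?h p i \<noteq> 0} \<subseteq> {(p, i). f p i \<noteq> 0}" by auto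
  then have "finite {(p, i). ?h p i \<noteq> 0}" using f by (auto simp: carrier_prufer_sum intro: finite_subset)
  moreover have "?h p i \<in> carrier (prufer p)" for p i
  proof -
    have "f p i \<in> carrier (prufer p)" using f by (simp add: carrier_prufer_sum)
    then obtain k :: nat where "of_nat p ^ k * f p i \<in> \<int>" by (auto simp: in_prufer)
    then have "of_nat p ^ k * (- f p i) \<in> \<int>" by simp
    then show ?thesis by (rule frac_in_prufer)
  qed
  moreover have "Factorial_Ring.prime p \<and> i < np p" if "?h p i \<noteq> 0" for p i
  proof -
    have "f p i \<noteq> 0" using that by auto
    then show ?thesis using f by (auto simp: carrier_prufer_sum)
  qed
  ultimately have "?h \<in> carrier (prufer_sum np)" by (simp add: carrier_prufer_sum)
  moreover have "?h \<otimes>\<^bsub>prufer_sum np\<^esub> f = \<one>\<^bsub>prufer_sum np\<^esub>" by (simp add: frac_add_frac_left)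
  ultimately show "\<exists>h\<in>carrier (prufer_sum np). h \<otimes>\<^bsub>prufer_sum np\<^esub> f = \<one>\<^bsub>prufer_sum np\<^esub>" by blast
  show "\<one>\<^bsub>prufer_sum np\<^esub> \<otimes>\<^bsub>prufer_sum np\<^esub> f = f"
    using f by (auto simp: carrier_prufer_sum in_prufer frac_eq intro!: ext)
next
  show "\<one>\<^bsub>prufer_sum np\<^esub> \<in> carrier (prufer_sum np)" by (simp add: carrier_prufer_sum)
  fix f g h :: "nat \<Rightarrow> nat \<Rightarrow> rat"
  show "f \<otimes>\<^bsub>prufer_sum np\<^esub> g = g \<otimes>\<^bsub>prufer_sum np\<^esub> f" by (simp add: add.commute)
  show "f \<otimes>\<^bsub>prufer_sum np\<^esub> g \<otimes>\<^bsub>prufer_sum np\<^esub> h = f \<otimes>\<^bsub>prufer_sum np\<^esub> (g \<otimes>\<^bsub>prufer_sum np\<^esub> h)"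
    by (simp add: frac_add_frac_left add.commute[of "f _ _" "frac _"]) (simp add: add_ac)
qed

lemma prufer_sum_proj_hom: "(\<lambda>f. f p i) \<in> hom (prufer_sum np) (prufer p)"
  by (auto simp: hom_def carrier_prufer_sum)

lemma prufer_sum_int_pow:
  assumes "f \<in> carrier (prufer_sum np)"
  shows "(f [^]\<^bsub>prufer_sum np\<^esub> (k::int)) p i = frac (of_int k * f p i)"
proof -
  interpret P: comm_group "prufer_sum np" by (rule comm_group_prufer_sum)
  interpret C: comm_group "prufer p" by (rule comm_group_prufer)
  have "(f [^]\<^bsub>prufer_sum np\<^esub> k) p i = f p i [^]\<^bsub>prufer p\<^esub> k"
    by (rule hom_int_pow[OF prufer_sum_proj_hom assms P.group_axioms C.group_axioms])
  then show ?thesis using assms by (simp add: prufer_int_pow carrier_prufer_sum)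
qed

lemma prufer_sum_pow_eq_one_iff:
  assumes "f \<in> carrier (prufer_sum np)"
  shows "f [^]\<^bsub>prufer_sum np\<^esub> (k::int) = \<one>\<^bsub>prufer_sum np\<^esub> \<longleftrightarrow> (\<forall>p i. of_int k * f p i \<in> \<int>)"
  using prufer_sum_int_pow[OF assms] by (auto simp: fun_eq_iff)

lemma prufer_sum_torsion: "torsion_part (prufer_sum np) = carrier (prufer_sum np)"
proof
  show "carrier (prufer_sum np) \<subseteq> torsion_part (prufer_sum np)"
  proof
    fix f assume f: "f \<in> carrier (prufer_sum np)"
    let ?S = "{(p, i). f p i \<noteq> 0}"
    have fin: "finite ?S" using f by (simp add: carrier_prufer_sum)
    have "\<exists>k::nat. of_nat p ^ k * f p i \<in> \<int>" for p i
      using f by (auto simp: carrier_prufer_sum in_prufer)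
    then obtain k :: "nat \<Rightarrow> nat \<Rightarrow> nat" where k: "\<And>p i. of_nat p ^ k p i * f p i \<in> \<int>" by metis
    \<comment> \<open>Finite support allows the product of exponents annihilating the nonzero
      coordinates to serve as a common exponent.\<close>
    define m where "m = (\<Prod>(p, i)\<in>?S. p ^ k p i)"
    have "m > 0" unfolding m_def
    proof (rule prod_pos)
      fix x assume "x \<in> ?S"
      then show "0 < (case x of (p, i) \<Rightarrow> p ^ k p i)"
        using f by (auto simp: carrier_prufer_sum prime_gt_0_nat)
    qed
    moreover have "of_int (int m) * f p i \<in> \<int>" for p i
    proof (cases "f p i = 0")
      case False
      then have "(case (p, i) of (p, i) \<Rightarrow> p ^ k p i) dvd m"
        unfolding m_def by (intro dvd_prodI[OF fin]) simp
      then obtain l where "m = p ^ k p i * l" by auto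
      then have eq: "of_int (int m) * f p i = of_int (int l) * (of_nat p ^ k p i * f p i)" by simp
      show ?thesis unfolding eq by (rule Ints_mult[OF Ints_of_int k])
    qed simp
    then have "f [^]\<^bsub>prufer_sum np\<^esub> int m = \<one>\<^bsub>prufer_sum np\<^esub>"
      using prufer_sum_pow_eq_one_iff[OF f] by simp
    ultimately have "\<exists>m::int. m > 0 \<and> f [^]\<^bsub>prufer_sum np\<^esub> m = \<one>\<^bsub>prufer_sum np\<^esub>"
      by (intro exI[of _ "int m"]) simp
    then show "f \<in> torsion_part (prufer_sum np)" using f unfolding torsion_part_def by blast
  qed
qed (auto simp: torsion_part_def)

lemma tor_prufer_sum:
  assumes q: "Factorial_Ring.prime q" and f: "f \<in> tor (prufer_sum np) (int q)"
  shows "p \<noteq> q \<Longrightarrow> f p i = 0" "\<exists>a. f q i = of_nat a / of_nat q \<and> a < q"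
proof -
  have fc: "f \<in> carrier (prufer_sum np)" and "\<forall>p i. of_int (int q) * f p i \<in> \<int>"
    using f prufer_sum_pow_eq_one_iff unfolding tor_def by blast+
  then have qf: "of_nat q * f p i \<in> \<int>" for p i by simp
  have prime: "Factorial_Ring.prime p" if "f p i \<noteq> 0" for p i using fc that by (auto simp: carrier_prufer_sum)
  show "f p i = 0" if "p \<noteq> q"
  proof (rule ccontr)
    assume nz: "f p i \<noteq> 0"
    have "\<not> int p dvd int q" using primes_dvd_imp_eq[OF prime[OF nz] q] that by auto
    then have "f p i = 0"
      using prufer_eq_zero[of "f p i" p "int q"] prime[OF nz] qf fc by (simp add: carrier_prufer_sum)
    then show False using nz by simp
  qed
  obtain b where b: "of_nat q * f q i = of_int b" using qf[of q i] by (auto elim: Ints_cases)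
  have fr: "0 \<le> f q i" "f q i < 1" using fc by (auto simp: carrier_prufer_sum in_prufer)
  have q0: "q > 0" using prime_gt_0_nat[OF q] .
  have "(0::rat) \<le> of_int b" using fr q0 by (simp flip: b)
  then have b0: "b \<ge> 0" by simp
  have "of_int b < (of_nat q :: rat)" using fr q0 by (simp flip: b)
  then have "nat b < q" using b0 by linarith
  moreover have "f q i = of_nat (nat b) / of_nat q" using b b0 q0 by (simp add: field_simps)
  ultimately show "\<exists>a. f q i = of_nat a / of_nat q \<and> a < q" by blast
qed

lemma finite_socles_prufer_sum: "finite_socles (prufer_sum np)"
  unfolding finite_socles_def
proof (intro allI impI)
  fix q :: nat assume q: "Factorial_Ring.prime q"
  \<comment> \<open>A socle element at \<open>q\<close> vanishes outside row \<open>q\<close>, and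
    there it assigns one of \<open>q\<close> fractions to each of \<open>np q\<close>
    indices.\<close>
  let ?A = "(\<lambda>a. of_nat a / of_nat q :: rat) ` {..<q}"
  have "f \<in> (\<lambda>g p i. if p = q \<and> i < np q then g i else 0) ` (PiE {..<np q} (\<lambda>_. ?A))"
    if f: "f \<in> tor (prufer_sum np) (int q)" for f
  proof (rule image_eqI)
    have "f q i = 0" if "\<not> i < np q" for i
      using f that by (auto simp: tor_def carrier_prufer_sum)
    then show "f = (\<lambda>p i. if p = q \<and> i < np q then restrict (f q) {..<np q} i else 0)"
      using tor_prufer_sum(1)[OF q f] by (intro ext) (metis lessThan_iff restrict_apply')
    show "restrict (f q) {..<np q} \<in> PiE {..<np q} (\<lambda>_. ?A)"
      using tor_prufer_sum(2)[OF q f] by (auto simp: image_iff)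
  qed
  then have "tor (prufer_sum np) (int q) \<subseteq>
      (\<lambda>g p i. if p = q \<and> i < np q then g i else 0) ` (PiE {..<np q} (\<lambda>_. ?A))" by blast
  then show "finite (tor (prufer_sum np) (int q))"
    by (rule finite_subset) (auto intro!: finite_imageI finite_PiE)
qed

lemma ext_Bassian_imp:
  assumes "ext_Bassian G"
  shows "torsion_free_rank_finite G" "finite_socles G"
proof -
  have G: "comm_group G" using assms by (simp add: ext_Bassian_def)
  interpret G: comm_group G by fact
  obtain B D np where B: "subgroup B G" and D: "subgroup D G" and BDG: "B <#>\<^bsub>G\<^esub> D = carrier G"
    and BD: "B \<inter> D = {\<one>\<^bsub>G\<^esub>}" and Bass: "Bassian (G\<lparr>carrier := B\<rparr>)" and "G\<lparr>carrier := D\<rparr> \<cong> prufer_sum np"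
    using assms unfolding ext_Bassian_def by blast
  then obtain f where f: "f \<in> iso (G\<lparr>carrier := D\<rparr>) (prufer_sum np)" by (auto simp: is_iso_def)
  interpret B: subgroup B G by fact
  interpret D: subgroup D G by fact
  interpret P: comm_group "prufer_sum np" by (rule comm_group_prufer_sum)
  interpret GD: comm_group "G\<lparr>carrier := D\<rparr>" by (rule G.subgroup_comm_group[OF D])
  have fhom: "f \<in> hom (G\<lparr>carrier := D\<rparr>) (prufer_sum np)" and finj: "inj_on f D"
    using f by (auto simp: iso_def bij_betw_def)
  interpret f: group_hom "G\<lparr>carrier := D\<rparr>" "prufer_sum np" f using fhom by unfold_locales
  have fpow: "f (x [^]\<^bsub>G\<^esub> (k::int)) = f x [^]\<^bsub>prufer_sum np\<^esub> k" if "x \<in> D" for x k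
    using f.hom_int_pow[of x k] that by (simp add: G.subgroup_int_pow_eq[OF D])
  have f1: "f x = \<one>\<^bsub>prufer_sum np\<^esub> \<longleftrightarrow> x = \<one>\<^bsub>G\<^esub>" if "x \<in> D" for x
    using inj_on_eq_iff[OF finj that D.one_closed] f.hom_one by simp
  have fc: "f x \<in> carrier (prufer_sum np)" if "x \<in> D" for x using f.hom_closed that by simp
  have Dpow: "x [^]\<^bsub>G\<^esub> k = \<one>\<^bsub>G\<^esub> \<longleftrightarrow> f x [^]\<^bsub>prufer_sum np\<^esub> k = \<one>\<^bsub>prufer_sum np\<^esub>" if "x \<in> D" for x and k :: int
    using f1[OF G.subgroup_int_powI[OF D that]] fpow[OF that] by simp
  have decomp: "\<exists>b\<in>B. \<exists>d\<in>D. x = b \<otimes>\<^bsub>G\<^esub> d" if "x \<in> carrier G" for x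
    using that unfolding BDG[symmetric] set_mult_def by blast
  show "finite_socles G"
    unfolding finite_socles_def
  proof (intro allI impI)
    fix p :: nat assume p: "Factorial_Ring.prime p"
    have "finite_socles (G\<lparr>carrier := B\<rparr>)"
      using Bassian_finite_primary_parts[OF Bass] finite_primary_parts_imp_socles by blast
    then have finB: "finite (B \<inter> tor G (int p))"
      using p by (simp add: finite_socles_def G.tor_subgroup[OF B])
    have "f ` (D \<inter> tor G (int p)) \<subseteq> tor (prufer_sum np) (int p)"
    proof
      fix y assume "y \<in> f ` (D \<inter> tor G (int p))"
      then obtain x where "x \<in> D" "x [^]\<^bsub>G\<^esub> int p = \<one>\<^bsub>G\<^esub>" "y = f x" by (auto simp: tor_def)
      then show "y \<in> tor (prufer_sum np) (int p)" using fc Dpow unfolding tor_def by blast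
    qed
    moreover have "finite (tor (prufer_sum np) (int p))"
      using finite_socles_prufer_sum p unfolding finite_socles_def by blast
    ultimately have "finite (f ` (D \<inter> tor G (int p)))" by (rule finite_subset)
    then have finD: "finite (D \<inter> tor G (int p))"
      by (rule finite_imageD) (rule inj_on_subset[OF finj], blast)
    have "tor G (int p) \<subseteq> (\<lambda>(b, d). b \<otimes>\<^bsub>G\<^esub> d) ` ((B \<inter> tor G (int p)) \<times> (D \<inter> tor G (int p)))"
    proof
      fix x assume x: "x \<in> tor G (int p)"
      then obtain b d where b: "b \<in> B" and d: "d \<in> D" and xbd: "x = b \<otimes>\<^bsub>G\<^esub> d"
        using decomp[of x] by (auto simp: tor_def)
      have "b [^]\<^bsub>G\<^esub> int p \<otimes>\<^bsub>G\<^esub> d [^]\<^bsub>G\<^esub> int p = \<one>\<^bsub>G\<^esub>"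
        using x b d by (simp add: tor_def xbd G.int_pow_distrib)
      then have eq: "b [^]\<^bsub>G\<^esub> int p = inv\<^bsub>G\<^esub> (d [^]\<^bsub>G\<^esub> int p)"
        using b d by (intro G.inv_equality[symmetric]) auto
      have "b [^]\<^bsub>G\<^esub> int p \<in> B" using G.subgroup_int_powI[OF B b] .
      moreover have "b [^]\<^bsub>G\<^esub> int p \<in> D" unfolding eq using D.m_inv_closed[OF G.subgroup_int_powI[OF D d]] .
      ultimately have bp: "b [^]\<^bsub>G\<^esub> int p = \<one>\<^bsub>G\<^esub>" using BD by blast
      then have "d [^]\<^bsub>G\<^esub> int p = \<one>\<^bsub>G\<^esub>" using eq d by simp
      then show "x \<in> (\<lambda>(b, d). b \<otimes>\<^bsub>G\<^esub> d) ` ((B \<inter> tor G (int p)) \<times> (D \<inter> tor G (int p)))"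
        using b d bp by (intro image_eqI[of _ _ "(b, d)"]) (auto simp: tor_def xbd)
    qed
    then show "finite (tor G (int p))" using finB finD finite_subset by blast
  qed
  show "torsion_free_rank_finite G"
    unfolding torsion_free_rank_finite_def
  proof
    assume "\<exists>b. independent_mod G {\<one>\<^bsub>G\<^esub>} (\<lambda>_. 0) b"
    then obtain b where "independent_mod G {\<one>\<^bsub>G\<^esub>} (\<lambda>_. 0) b" by blast
    note b = independent_modD[OF this]
    \<comment> \<open>The \<open>B\<close>-components inherit independence: a relation among them
      leaves a combination of the \<open>b i\<close> in the torsion group \<open>D\<close>, and a
      suitable power of it is a relation among the \<open>b i\<close>.\<close>
    obtain \<beta> \<delta> where \<beta>: "\<And>i. \<beta> i \<in> B" and \<delta>: "\<And>i. \<delta> i \<in> D" and bi: "\<And>i. b i = \<beta> i \<otimes>\<^bsub>G\<^esub> \<delta> i"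
      using decomp[OF b(1)] by metis
    have bfun: "b = (\<lambda>i. \<beta> i \<otimes>\<^bsub>G\<^esub> \<delta> i)" using bi by blast
    have \<beta>c: "\<beta> i \<in> carrier G" and \<delta>c: "\<delta> i \<in> carrier G" for i using \<beta> \<delta> by auto
    have "c i = 0" if lin: "lincomb G \<beta> c n = \<one>\<^bsub>G\<^esub>" and i: "i < n" for c n i
    proof -
      have eq: "lincomb G b c n = lincomb G \<delta> c n"
        unfolding bfun using lin \<beta>c \<delta>c by (simp add: G.lincomb_mult_seq)
      have "lincomb (G\<lparr>carrier := D\<rparr>) \<delta> c n \<in> carrier (G\<lparr>carrier := D\<rparr>)"
        by (rule GD.lincomb_closed) (simp add: \<delta>)
      then have inD: "lincomb G \<delta> c n \<in> D" by (simp add: G.lincomb_subgroup[OF D \<delta>])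
      then have "f (lincomb G \<delta> c n) \<in> torsion_part (prufer_sum np)" using fc prufer_sum_torsion by simp
      then obtain m :: int where m: "m > 0" "f (lincomb G \<delta> c n) [^]\<^bsub>prufer_sum np\<^esub> m = \<one>\<^bsub>prufer_sum np\<^esub>"
        unfolding torsion_part_def by blast
      then have "lincomb G b c n [^]\<^bsub>G\<^esub> m = \<one>\<^bsub>G\<^esub>" unfolding eq using Dpow[OF inD] by blast
      then have "lincomb G b (\<lambda>i. c i * m) n \<in> {\<one>\<^bsub>G\<^esub>}" using b(1) by (simp add: G.lincomb_pow)
      then have "c i * m = 0" using b(3)[of _ n i] i by fastforce
      then show ?thesis using m(1) by simp
    qed
    then have "independent_mod G {\<one>\<^bsub>G\<^esub>} (\<lambda>_. 0) \<beta>" using \<beta>c by (simp add: independent_mod_def)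
    then have "independent_mod (G\<lparr>carrier := B\<rparr>) {\<one>\<^bsub>G\<lparr>carrier := B\<rparr>\<^esub>} (\<lambda>_. 0) \<beta>"
      by (simp add: G.independent_mod_subgroup_iff[OF B \<beta>])
    then show False
      using Bassian_torsion_free_rank_finite[OF Bass] unfolding torsion_free_rank_finite_def by blast
  qed
qed

section \<open>Coordinates on divisible torsion groups with finite socles\<close>

lemma (in comm_group) ex_socle_basis:
  assumes p: "Factorial_Ring.prime p" and fin: "finite (tor G (int p))"
  shows "\<exists>s n. independent_mod G {\<one>} (\<lambda>i. if s i = \<one> then 1 else int p) s \<and>
    (\<forall>i<n. s i \<noteq> \<one>) \<and> tor G (int p) \<subseteq> span_upto G s n \<and> (\<forall>i. s i \<in> tor G (int p))"
proof -
  let ?T = "tor G (int p)"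
  \<comment> \<open>Greedy choice of a basis of the socle over Z/p. Once the earlier elements span
    it, the sequence continues with the identity, which independence tolerates with order 1.\<close>
  define P where "P f i x \<longleftrightarrow> x \<in> ?T \<and> (if ?T \<subseteq> span_upto G f i then x = \<one> else x \<notin> span_upto G f i)"
    for f :: "nat \<Rightarrow> 'a" and i x
  have "\<exists>s. \<forall>i. P s i (s i)"
  proof (rule dependent_wellorder_choice)
    fix r :: 'a and f g :: "nat \<Rightarrow> 'a" and x :: nat assume "\<And>y. y < x \<Longrightarrow> f y = g y"
    then have "span_upto G f x = span_upto G g x" by (rule span_upto_cong)
    then show "P f x r = P g x r" by (simp add: P_def)
  next
    fix i and f :: "nat \<Rightarrow> 'a"
    show "\<exists>r. P f i r"
      using subgroup.one_closed[OF subgroup_tor] by (cases "?T \<subseteq> span_upto G f i") (auto simp: P_def)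
  qed
  then obtain s where s: "P s i (s i)" for i by blast
  have sT: "s i \<in> ?T" for i using s by (simp add: P_def)
  have sc: "s i \<in> carrier G" "s i [^] int p = \<one>" for i using sT[of i] by (auto simp: tor_def)
  have one: "\<one> \<in> span_upto G s i" for i using subgroup.one_closed[OF subgroup_span_upto[of s i]] sc by blast
  have sp: "s i \<notin> span_upto G s i" if "s i \<noteq> \<one>" for i
    using s[of i] that by (auto simp: P_def split: if_splits)
  have sp': "s i \<notin> span_upto G s i" if "\<not> ?T \<subseteq> span_upto G s i" for i
    using s[of i] that by (auto simp: P_def)
  have ind: "independent_mod G {\<one>} (\<lambda>i. if s i = \<one> then 1 else int p) s"
  proof (rule independent_modI[OF sc(1) _ triv_subgroup])
    show "s i [^] (if s i = \<one> then 1 else int p) = \<one>" for i using sc by simp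
    fix i and k :: int assume "s i [^] k \<in> span_upto G s i <#> {\<one>}"
    then obtain x where x: "x \<in> span_upto G s i" "s i [^] k = x \<otimes> \<one>" by (auto simp: set_mult_def)
    have sub: "subgroup (span_upto G s i) G" using sc(1) by (rule subgroup_span_upto)
    have k: "s i [^] k \<in> span_upto G s i" using x subgroup.mem_carrier[OF sub x(1)] by simp
    show "(if s i = \<one> then 1 else int p) dvd k"
    proof (cases "s i = \<one>")
      case False
      have "int p dvd k"
      proof (rule ccontr)
        assume "\<not> int p dvd k"
        then have "coprime (int p) k" using p by (intro prime_imp_coprime) auto
        then obtain u v where uv: "u * int p + v * k = 1" using bezout_int[of "int p" k] by auto
        have "s i = s i [^] (int p * u + k * v)" using sc(1) uv by (simp add: mult.commute)
        also have "\<dots> = s i [^] (int p * u) \<otimes> (s i [^] k) [^] v" using sc(1) by (simp add: int_pow_mult int_pow_pow)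
        also have "\<dots> = (s i [^] k) [^] v" using int_pow_dvd_one[OF sc, of "int p * u"] sc(1) by simp
        also have "\<dots> \<in> span_upto G s i" by (rule subgroup_int_powI[OF sub k])
        finally show False using sp[OF False] by simp
      qed
      then show ?thesis using False by simp
    qed simp
  qed
  have "\<exists>n. ?T \<subseteq> span_upto G s n"
  proof (rule ccontr)
    assume no: "\<nexists>n. ?T \<subseteq> span_upto G s n"
    have neq: "s j \<noteq> s i" if "j < i" for i j
      using in_span_upto[of s j i] sc(1) that sp'[of i] no by metis
    have "inj s" by (rule linorder_injI) (use neq in blast)
    moreover have "finite (range s)" using sT fin by (metis finite_subset image_subsetI)
    ultimately show False using finite_imageD by blast
  qed
  then have ex: "\<exists>n. ?T \<subseteq> span_upto G s n" .
  \<comment> \<open>The least such \<open>n\<close> is the dimension of the socle: before it the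
    span is still too small, so each chosen element is nontrivial.\<close>
  define n where "n = (LEAST n. ?T \<subseteq> span_upto G s n)"
  have n: "?T \<subseteq> span_upto G s n" unfolding n_def using ex by (rule LeastI_ex)
  have "s i \<noteq> \<one>" if "i < n" for i
    using sp'[of i] one[of i] not_less_Least[of i "\<lambda>n. ?T \<subseteq> span_upto G s n"] that
    unfolding n_def by metis
  then show ?thesis using ind n sT by blast
qed

text \<open>The \<open>\<chi> i\<close> extend the dual basis of a basis of the socle, which is
  possible because Z(p^infinity) is divisible. The first \<open>n\<close> of them identify the socle
  with (Z/p)^n.\<close>

lemma ex_prufer_coordinates:
  assumes "comm_group N" "finite (tor N (int p))" and p: "Factorial_Ring.prime p"
  shows "\<exists>n \<chi>. (\<forall>i. \<chi> i \<in> hom N (prufer p)) \<and>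
    (\<forall>x\<in>tor N (int p). (\<forall>i<n. \<chi> i x = 0) \<longrightarrow> x = \<one>\<^bsub>N\<^esub>) \<and>
    (\<forall>a :: nat \<Rightarrow> nat. \<exists>x\<in>tor N (int p). \<forall>i<n. \<chi> i x = frac (of_nat (a i) / of_nat p))"
proof -
  interpret N: comm_group N by fact
  interpret C: comm_group "prufer p" by (rule comm_group_prufer)
  have p0: "p > 0" using prime_gt_0_nat[OF p] .
  obtain s n where ind: "independent_mod N {\<one>\<^bsub>N\<^esub>} (\<lambda>i. if s i = \<one>\<^bsub>N\<^esub> then 1 else int p) s"
    and sn: "\<forall>i<n. s i \<noteq> \<one>\<^bsub>N\<^esub>" and T: "tor N (int p) \<subseteq> span_upto N s n" and sT: "\<forall>i. s i \<in> tor N (int p)"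
    using N.ex_socle_basis[OF p assms(2)] by blast
  have sc: "s i \<in> carrier N" "s i [^]\<^bsub>N\<^esub> int p = \<one>\<^bsub>N\<^esub>" for i using sT by (auto simp: tor_def)
  have frac1: "(1 / of_nat p :: rat) \<in> carrier (prufer p)"
    using prime_gt_1_nat[OF p] by (auto simp: in_prufer intro!: exI[of _ "1::nat"])
  \<comment> \<open>The case distinction on \<open>i < n\<close> is forced: the padding elements may
    be trivial and then can only go to 0.\<close>
  have "\<exists>\<chi>\<in>hom N (prufer p). \<forall>j. \<chi> (s j) = (if j = i \<and> i < n then 1 / of_nat p else 0)" for i
  proof (rule divisible_hom_of_independent[OF assms(1) C.comm_group_axioms ind divisible_prufer[OF p]])
    show "(if j = i \<and> i < n then 1 / of_nat p else 0) \<in> carrier (prufer p)" for j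
      using frac1 by simp
    show "(if j = i \<and> i < n then 1 / of_nat p else 0) [^]\<^bsub>prufer p\<^esub> (if s j = \<one>\<^bsub>N\<^esub> then 1 else int p)
        = \<one>\<^bsub>prufer p\<^esub>" for j
      using sn p0 by (auto simp: prufer_int_pow[OF frac1] prufer_int_pow[OF zero_in_prufer])
  qed
  then obtain \<chi> where \<chi>: "\<And>i. \<chi> i \<in> hom N (prufer p)"
    and \<chi>s: "\<And>i j. \<chi> i (s j) = (if j = i \<and> i < n then 1 / of_nat p else 0)" by metis
  have \<chi>lin: "\<chi> i (lincomb N s c n) = frac (of_int (c i) / of_nat p)" if i: "i < n" for i c
  proof -
    have "\<chi> i (lincomb N s c n) = lincomb (prufer p) (\<lambda>j. \<chi> i (s j)) c n"
      by (rule N.hom_lincomb[OF C.comm_group_axioms \<chi> sc(1)])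
    also have "\<dots> = \<chi> i (s i) [^]\<^bsub>prufer p\<^esub> c i"
      by (rule C.lincomb_eq_single)
        (use i frac1 in \<open>auto simp: \<chi>s prufer_int_pow[OF zero_in_prufer]\<close>)
    also have "\<dots> = frac (of_int (c i) / of_nat p)" using i by (simp add: \<chi>s prufer_int_pow[OF frac1])
    finally show ?thesis .
  qed
  have "x = \<one>\<^bsub>N\<^esub>" if x: "x \<in> tor N (int p)" and z: "\<forall>i<n. \<chi> i x = 0" for x
  proof -
    obtain c where c: "x = lincomb N s c n" using x T by (auto simp: span_upto_def)
    have "s i [^]\<^bsub>N\<^esub> c i = \<one>\<^bsub>N\<^esub>" if i: "i < n" for i
    proof -
      have "(of_int (c i) :: rat) / of_int (int p) \<in> \<int>" using z i \<chi>lin[OF i, of c] by (simp add: c)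
      then have "int p dvd c i" using of_int_div_of_int_in_Ints_iff[of "c i" "int p"] p0 by auto
      then show ?thesis by (rule N.int_pow_dvd_one[OF sc])
    qed
    then show ?thesis unfolding c by (rule N.lincomb_one)
  qed
  moreover have "\<exists>x\<in>tor N (int p). \<forall>i<n. \<chi> i x = frac (of_nat (a i) / of_nat p)" for a :: "nat \<Rightarrow> nat"
  proof
    let ?x = "lincomb N s (\<lambda>i. int (a i)) n"
    show "\<forall>i<n. \<chi> i ?x = frac (of_nat (a i) / of_nat p)" using \<chi>lin by simp
    have "s i [^]\<^bsub>N\<^esub> (int (a i) * int p) = \<one>\<^bsub>N\<^esub>" for i
      by (rule N.int_pow_dvd_one[OF sc]) simp
    then show "?x \<in> tor N (int p)"
      using sc(1) by (simp add: tor_def N.lincomb_pow N.lincomb_one)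
  qed
  ultimately show ?thesis using \<chi> by blast
qed

text \<open>A homomorphism between torsion groups that is injective on the socles is injective. If
  it is also onto the socles and its source is divisible, it is onto: induction on the order gives a
  preimage of the \<open>p\<close>-th power of \<open>f\<close>, a \<open>p\<close>-th root
  \<open>z\<close> of it exists, and \<open>f\<close> differs from the image of \<open>z\<close> by
  a socle element only.\<close>

lemma divisible_torsion_iso_prufer_sum:
  fixes N :: "'a monoid"
  assumes "comm_group N" "divisible_group N" "torsion_part N = carrier N" "finite_socles N"
  shows "\<exists>np. N \<cong> prufer_sum np"
proof -
  interpret N: comm_group N by fact
  define ok where "ok p n \<chi> \<longleftrightarrow> (\<forall>i. \<chi> i \<in> hom N (prufer p)) \<and>
    (\<forall>x\<in>tor N (int p). (\<forall>i<n. \<chi> i x = 0) \<longrightarrow> x = \<one>\<^bsub>N\<^esub>) \<and>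
    (\<forall>a :: nat \<Rightarrow> nat. \<exists>x\<in>tor N (int p). \<forall>i<n. \<chi> i x = frac (of_nat (a i) / of_nat p))"
    for p and n :: nat and \<chi> :: "nat \<Rightarrow> 'a \<Rightarrow> rat"
  have "\<exists>n \<chi>. ok p n \<chi>" if p: "Factorial_Ring.prime p" for p
    unfolding ok_def
    by (rule ex_prufer_coordinates[OF assms(1) _ p]) (use assms(4) p in \<open>simp add: finite_socles_def\<close>)
  then obtain np \<chi> where ok: "\<And>p. Factorial_Ring.prime p \<Longrightarrow> ok p (np p) (\<chi> p)" by metis
  have \<chi>: "\<chi> p i \<in> hom N (prufer p)" if "Factorial_Ring.prime p" for p i
    using ok[OF that] by (simp add: ok_def)
  have \<chi>c: "\<chi> p i x \<in> carrier (prufer p)" if "Factorial_Ring.prime p" "x \<in> carrier N" for p i x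
    using hom_in_carrier[OF \<chi>[OF that(1)] that(2)] .
  have \<chi>pow: "\<chi> p i (x [^]\<^bsub>N\<^esub> k) = frac (of_int k * \<chi> p i x)"
    if "Factorial_Ring.prime p" "x \<in> carrier N" for p i x and k :: int
    using hom_int_pow[OF \<chi>[OF that(1)] that(2) N.group_axioms comm_group.axioms(2)[OF comm_group_prufer]]
      prufer_int_pow[OF \<chi>c[OF that]] by simp
  have \<chi>zero: "\<chi> p i x = 0"
    if p: "Factorial_Ring.prime p" and x: "x \<in> carrier N" "x [^]\<^bsub>N\<^esub> m = \<one>\<^bsub>N\<^esub>" and m: "\<not> int p dvd m" for p i x m
  proof -
    have "\<chi> p i \<one>\<^bsub>N\<^esub> = 0"
      using hom_one[OF \<chi>[OF p] N.group_axioms comm_group.axioms(2)[OF comm_group_prufer]] by simp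
    then have "of_int m * \<chi> p i x \<in> \<int>" using \<chi>pow[OF p x(1), of i m] x(2) by simp
    then show ?thesis using prufer_eq_zero[OF \<chi>c[OF p x(1)] p _ m] by simp
  qed
  interpret P: comm_group "prufer_sum np" by (rule comm_group_prufer_sum)
  define \<phi> where "\<phi> x = (\<lambda>p i. if Factorial_Ring.prime p \<and> i < np p then \<chi> p i x else 0)" for x
  have \<phi>c: "\<phi> x \<in> carrier (prufer_sum np)" if x: "x \<in> carrier N" for x
  proof -
    obtain m :: int where m: "m > 0" "x [^]\<^bsub>N\<^esub> m = \<one>\<^bsub>N\<^esub>" using x assms(3) by (auto simp: torsion_part_def)
    \<comment> \<open>This yields finite support: the coordinates at \<open>p\<close> vanish on
      \<open>x\<close> unless \<open>p\<close> divides an exponent of \<open>x\<close>.\<close>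
    have "p dvd nat m" if "Factorial_Ring.prime p" "\<chi> p i x \<noteq> 0" for p i
      using \<chi>zero[OF that(1) x m(2), of i] that(2) m(1) int_dvd_int_iff[of p "nat m"] by auto
    then have "{(p, i). \<phi> x p i \<noteq> 0} \<subseteq> (SIGMA p:{p. p dvd nat m}. {..<np p})"
      by (auto simp: \<phi>_def split: if_splits)
    moreover have "finite (SIGMA p:{p. p dvd nat m}. {..<np p})" using m(1) by simp
    ultimately have "finite {(p, i). \<phi> x p i \<noteq> 0}" by (rule finite_subset)
    then show ?thesis using \<chi>c[OF _ x] by (auto simp: carrier_prufer_sum \<phi>_def)
  qed
  have hom: "\<phi> \<in> hom N (prufer_sum np)"
  proof (rule homI)
    fix x y assume x: "x \<in> carrier N" and y: "y \<in> carrier N"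
    show "\<phi> x \<in> carrier (prufer_sum np)" by (rule \<phi>c[OF x])
    show "\<phi> (x \<otimes>\<^bsub>N\<^esub> y) = \<phi> x \<otimes>\<^bsub>prufer_sum np\<^esub> \<phi> y"
      using hom_mult[OF \<chi> x y] by (auto simp: \<phi>_def intro!: ext)
  qed
  interpret \<phi>: group_hom N "prufer_sum np" \<phi> using hom by unfold_locales
  have "inj_on \<phi> (carrier N)"
    unfolding \<phi>.inj_on_one_iff
  proof (intro allI impI, rule ccontr)
    fix x assume x: "x \<in> carrier N" "\<phi> x = \<one>\<^bsub>prufer_sum np\<^esub>" and "x \<noteq> \<one>\<^bsub>N\<^esub>"
    then obtain p and j :: int where p: "Factorial_Ring.prime p" and nz: "x [^]\<^bsub>N\<^esub> j \<noteq> \<one>\<^bsub>N\<^esub>"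
      and "(x [^]\<^bsub>N\<^esub> j) [^]\<^bsub>N\<^esub> int p = \<one>\<^bsub>N\<^esub>"
      using N.torsion_socle_power[of x] assms(3) by blast
    then have "x [^]\<^bsub>N\<^esub> j \<in> tor N (int p)" using x(1) by (simp add: tor_def)
    moreover have "\<chi> p i (x [^]\<^bsub>N\<^esub> j) = 0" if "i < np p" for i
      using fun_cong[OF fun_cong[OF x(2), of p], of i] p that \<chi>pow[OF p x(1), of i j] by (simp add: \<phi>_def)
    ultimately show False using ok[OF p] nz unfolding ok_def by blast
  qed
  have img: "subgroup (\<phi> ` carrier N) (prufer_sum np)" by (rule \<phi>.img_is_subgroup)
  have socle: "f \<in> \<phi> ` carrier N" if p: "Factorial_Ring.prime p" and f: "f \<in> tor (prufer_sum np) (int p)" for p f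
  proof -
    obtain a where a: "\<And>i. f p i = of_nat (a i) / of_nat p \<and> a i < p"
      using tor_prufer_sum(2)[OF p f] by metis
    obtain x where x: "x \<in> tor N (int p)" and xa: "\<forall>i<np p. \<chi> p i x = frac (of_nat (a i) / of_nat p)"
      using ok[OF p] unfolding ok_def by blast
    have xc: "x \<in> carrier N" "x [^]\<^bsub>N\<^esub> int p = \<one>\<^bsub>N\<^esub>" using x by (auto simp: tor_def)
    have fP: "f \<in> carrier (prufer_sum np)" using f by (simp add: tor_def)
    have "\<phi> x q i = f q i" for q i
    proof (cases "q = p")
      case True
      show ?thesis
      proof (cases "i < np p")
        case i: True
        have "f p i \<in> carrier (prufer p)" using fP by (simp add: carrier_prufer_sum)
        then have "frac (f p i) = f p i" by (simp add: in_prufer frac_eq)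
        then show ?thesis using i p xa a True by (simp add: \<phi>_def)
      next
        case False
        then show ?thesis using fP True by (auto simp: carrier_prufer_sum \<phi>_def)
      qed
    next
      case False
      have "\<chi> q i x = 0" if q: "Factorial_Ring.prime q"
        by (rule \<chi>zero[OF q xc]) (use primes_dvd_imp_eq[OF q p] False in auto)
      then show ?thesis using tor_prufer_sum(1)[OF p f False] by (simp add: \<phi>_def)
    qed
    then have "f = \<phi> x" by (intro ext) simp
    then show ?thesis using xc(1) by blast
  qed
  have "f \<in> \<phi> ` carrier N"
    if "m > 0" "f \<in> carrier (prufer_sum np)" "f [^]\<^bsub>prufer_sum np\<^esub> int m = \<one>\<^bsub>prufer_sum np\<^esub>" for m f
    using that
  proof (induction m arbitrary: f rule: less_induct)
    case (less m)
    show ?case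
    proof (cases "m = 1")
      case True
      then have "f = \<one>\<^bsub>prufer_sum np\<^esub>" using less.prems by (simp del: prufer_sum_simps)
      then show ?thesis using subgroup.one_closed[OF img] by (simp only:)
    next
      case False
      then obtain p where p: "Factorial_Ring.prime p" "p dvd m" using prime_factor_nat by blast
      then obtain m' where m': "m = p * m'" by blast
      have "m' > 0" "m' < m" using less.prems(1) m' prime_gt_1_nat[OF p(1)] by auto
      moreover have "(f [^]\<^bsub>prufer_sum np\<^esub> int p) [^]\<^bsub>prufer_sum np\<^esub> int m' = \<one>\<^bsub>prufer_sum np\<^esub>"
        using less.prems by (simp only: P.int_pow_pow m' of_nat_mult)
      ultimately have "f [^]\<^bsub>prufer_sum np\<^esub> int p \<in> \<phi> ` carrier N"
        using less.IH P.int_pow_closed[OF less.prems(2)] by blast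
      then obtain x where x: "x \<in> carrier N" "f [^]\<^bsub>prufer_sum np\<^esub> int p = \<phi> x" by blast
      obtain z where z: "z \<in> carrier N" "z [^]\<^bsub>N\<^esub> int p = x"
        using assms(2) x(1) prime_gt_0_nat[OF p(1)] unfolding divisible_group_def
        by (metis of_nat_0_less_iff)
      define g where "g = f \<otimes>\<^bsub>prufer_sum np\<^esub> inv\<^bsub>prufer_sum np\<^esub> \<phi> z"
      have gc: "g \<in> carrier (prufer_sum np)"
        unfolding g_def using less.prems(2) \<phi>c[OF z(1)] by (intro P.m_closed P.inv_closed)
      have "g [^]\<^bsub>prufer_sum np\<^esub> int p
          = f [^]\<^bsub>prufer_sum np\<^esub> int p \<otimes>\<^bsub>prufer_sum np\<^esub> inv\<^bsub>prufer_sum np\<^esub> (\<phi> z [^]\<^bsub>prufer_sum np\<^esub> int p)"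
        unfolding g_def using less.prems(2) \<phi>c[OF z(1)]
        by (simp only: P.int_pow_distrib P.inv_closed P.int_pow_inv)
      also have "\<phi> z [^]\<^bsub>prufer_sum np\<^esub> int p = \<phi> x" using \<phi>.hom_int_pow[OF z(1), of "int p"] z(2) by simp
      also have "f [^]\<^bsub>prufer_sum np\<^esub> int p \<otimes>\<^bsub>prufer_sum np\<^esub> inv\<^bsub>prufer_sum np\<^esub> \<phi> x = \<one>\<^bsub>prufer_sum np\<^esub>"
        unfolding x(2) by (rule P.r_inv[OF \<phi>c[OF x(1)]])
      finally have "g \<in> tor (prufer_sum np) (int p)" using gc unfolding tor_def by blast
      then have "g \<in> \<phi> ` carrier N" by (rule socle[OF p(1)])
      then have "g \<otimes>\<^bsub>prufer_sum np\<^esub> \<phi> z \<in> \<phi> ` carrier N"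
        using z(1) by (intro subgroup.m_closed[OF img]) auto
      also have "g \<otimes>\<^bsub>prufer_sum np\<^esub> \<phi> z = f"
        unfolding g_def using less.prems(2) \<phi>c[OF z(1)]
        by (simp only: P.m_assoc P.inv_closed P.l_inv P.r_one)
      finally show ?thesis .
    qed
  qed
  note surj = this
  have "f \<in> \<phi> ` carrier N" if f: "f \<in> carrier (prufer_sum np)" for f
  proof -
    have "f \<in> torsion_part (prufer_sum np)" using f prufer_sum_torsion by simp
    then obtain m :: int where "m > 0" "f [^]\<^bsub>prufer_sum np\<^esub> m = \<one>\<^bsub>prufer_sum np\<^esub>"
      unfolding torsion_part_def by blast
    then show ?thesis using surj[of "nat m" f] f by (simp del: prufer_sum_simps)
  qed
  then have "\<phi> ` carrier N = carrier (prufer_sum np)" using \<phi>c by blast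
  then have "\<phi> \<in> iso N (prufer_sum np)"
    using hom \<open>inj_on \<phi> (carrier N)\<close> by (simp add: iso_def bij_betw_def)
  then show ?thesis by (auto simp: is_iso_def)
qed

text \<open>The identity of the divisible part \<open>N\<close> extends to a retraction
  \<open>\<rho>\<close>, so \<open>N\<close> splits off with complement the kernel \<open>B\<close>.
  The divisible part of \<open>B\<close> lies in \<open>B \<inter> N\<close> and is trivial, which
  by finiteness of the socles makes the primary components of \<open>B\<close> finite.\<close>

lemma ext_BassianI:
  assumes "comm_group G" "torsion_free_rank_finite G" "finite_socles G"
  shows "ext_Bassian G"
proof -
  interpret G: comm_group G by fact
  define N where "N = divisible_part G"
  let ?N = "G\<lparr>carrier := N\<rparr>"
  have subN: "subgroup N G" unfolding N_def by (rule G.subgroup_divisible_part)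
  interpret N: subgroup N G by (rule subN)
  have cN: "comm_group ?N" by (rule G.subgroup_comm_group[OF subN])
  interpret CN: comm_group ?N by (rule cN)
  have divN: "divisible_group ?N" unfolding N_def by (rule G.divisible_divisible_part[OF assms(3)])
  obtain \<rho> where \<rho>: "\<rho> \<in> hom G ?N" and "\<forall>x\<in>N. \<rho> x = x [^]\<^bsub>G\<^esub> (1::int)"
    using divisible_subgroup_extend_int_pow[OF assms(1) subN divN] by blast
  then have \<rho>N: "\<rho> x = x" if "x \<in> N" for x using that by simp
  interpret \<rho>: group_hom G ?N \<rho> using \<rho> by unfold_locales
  define B where "B = kernel G ?N \<rho>"
  have subB: "subgroup B G" unfolding B_def by (rule \<rho>.subgroup_kernel)
  have BN: "B \<inter> N = {\<one>\<^bsub>G\<^esub>}"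
  proof -
    have "B \<inter> N \<subseteq> {\<one>\<^bsub>G\<^esub>}" using \<rho>N by (auto simp: B_def kernel_def)
    then show ?thesis using subgroup.one_closed[OF subB] N.one_closed by blast
  qed
  have "carrier G \<subseteq> B <#>\<^bsub>G\<^esub> N"
  proof
    fix x assume x: "x \<in> carrier G"
    have rx: "\<rho> x \<in> N" using \<rho>.hom_closed[OF x] by simp
    have "\<rho> (x \<otimes>\<^bsub>G\<^esub> inv\<^bsub>G\<^esub> \<rho> x) = \<rho> x \<otimes>\<^bsub>G\<^esub> inv\<^bsub>G\<^esub> \<rho> x"
      using \<rho>.hom_mult[of x "inv\<^bsub>G\<^esub> \<rho> x"] x rx \<rho>N[of "inv\<^bsub>G\<^esub> \<rho> x"] by simp
    then have "x \<otimes>\<^bsub>G\<^esub> inv\<^bsub>G\<^esub> \<rho> x \<in> B" using x rx by (simp add: B_def kernel_def)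
    then have "(x \<otimes>\<^bsub>G\<^esub> inv\<^bsub>G\<^esub> \<rho> x) \<otimes>\<^bsub>G\<^esub> \<rho> x \<in> B <#>\<^bsub>G\<^esub> N" using rx by (rule G.set_mult_memI)
    then show "x \<in> B <#>\<^bsub>G\<^esub> N" using x rx by (simp add: G.m_assoc)
  qed
  then have BNG: "B <#>\<^bsub>G\<^esub> N = carrier G"
    using subgroup.subset[OF G.mult_subgroups[OF subB subN]] by blast
  have BassB: "Bassian (G\<lparr>carrier := B\<rparr>)"
  proof (rule BassianI[OF G.subgroup_comm_group[OF subB] G.torsion_free_rank_finite_subgroup[OF assms(2) subB]])
    interpret CB: comm_group "G\<lparr>carrier := B\<rparr>" by (rule G.subgroup_comm_group[OF subB])
    have "divisible_part (G\<lparr>carrier := B\<rparr>) \<subseteq> B \<inter> N"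
    proof
      fix x assume x: "x \<in> divisible_part (G\<lparr>carrier := B\<rparr>)"
      then have xB: "x \<in> B" using CB.divisible_part_subset by auto
      have "x \<in> torsion_part G"
        using x xB subgroup.mem_carrier[OF subB]
        by (auto simp: divisible_part_def torsion_part_def G.subgroup_int_pow_eq[OF subB])
      moreover have "\<exists>y\<in>carrier G. y [^]\<^bsub>G\<^esub> k = x" if k: "k > 0" for k :: int
      proof -
        obtain y where y: "y \<in> B" "y [^]\<^bsub>G\<lparr>carrier := B\<rparr>\<^esub> k = x"
          using x k by (auto simp: divisible_part_def)
        then show ?thesis
          using G.subgroup_int_pow_eq[OF subB y(1)]
          by (intro bexI[of _ y] subgroup.mem_carrier[OF subB y(1)]) simp
      qed
      ultimately show "x \<in> B \<inter> N" using xB by (simp add: N_def divisible_part_def)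
    qed
    then have triv: "divisible_part (G\<lparr>carrier := B\<rparr>) \<subseteq> {\<one>\<^bsub>G\<^esub>}" using BN by simp
    show "finite_primary_parts (G\<lparr>carrier := B\<rparr>)"
      unfolding finite_primary_parts_def
    proof (intro allI impI, rule ccontr)
      fix p :: nat assume "Factorial_Ring.prime p" "infinite (primary (G\<lparr>carrier := B\<rparr>) p)"
      then have "\<exists>s\<in>divisible_part (G\<lparr>carrier := B\<rparr>). s \<noteq> \<one>\<^bsub>G\<lparr>carrier := B\<rparr>\<^esub> \<and>
          s [^]\<^bsub>G\<lparr>carrier := B\<rparr>\<^esub> int p = \<one>\<^bsub>G\<lparr>carrier := B\<rparr>\<^esub>"
        by (rule CB.infinite_primary_imp_divisible[OF G.finite_socles_subgroup[OF assms(3) subB]])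
      then show False using triv by auto
    qed
  qed
  have "torsion_part ?N = carrier ?N"
  proof
    show "carrier ?N \<subseteq> torsion_part ?N"
    proof
      fix x assume "x \<in> carrier ?N"
      then have x: "x \<in> N" by simp
      then have "x \<in> torsion_part G" by (simp add: N_def divisible_part_def)
      then obtain m :: int where "m > 0" "x [^]\<^bsub>G\<^esub> m = \<one>\<^bsub>G\<^esub>" unfolding torsion_part_def by blast
      then show "x \<in> torsion_part ?N"
        using x G.subgroup_int_pow_eq[OF subN x] by (auto simp: torsion_part_def)
    qed
  qed (auto simp: torsion_part_def)
  then obtain np where "?N \<cong> prufer_sum np"
    using divisible_torsion_iso_prufer_sum[OF cN divN _ G.finite_socles_subgroup[OF assms(3) subN]] by blast
  then show ?thesis
    using assms(1) subB subN BN BNG BassB unfolding ext_Bassian_def by blast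
qed

lemma ext_Bassian_iff:
  "ext_Bassian G \<longleftrightarrow> comm_group G \<and> torsion_free_rank_finite G \<and> finite_socles G"
  using ext_BassianI[of G] ext_Bassian_imp[of G] ext_Bassian_def[of G] by blast

section \<open>Closure under subgroups and the two equalities of classes\<close>

lemma Bassian_subgroup:
  assumes "Bassian G" "subgroup H G"
  shows "Bassian (G\<lparr>carrier := H\<rparr>)"
proof -
  have G: "comm_group G" using assms(1) by (simp add: Bassian_iff)
  show ?thesis
    using assms comm_group.subgroup_comm_group[OF G] comm_group.torsion_free_rank_finite_subgroup[OF G]
      comm_group.finite_primary_parts_subgroup[OF G] by (simp add: Bassian_iff)
qed

lemma ext_Bassian_subgroup:
  assumes "ext_Bassian G" "subgroup H G"
  shows "ext_Bassian (G\<lparr>carrier := H\<rparr>)"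
proof -
  have G: "comm_group G" using assms(1) by (simp add: ext_Bassian_iff)
  show ?thesis
    using assms comm_group.subgroup_comm_group[OF G] comm_group.torsion_free_rank_finite_subgroup[OF G]
      comm_group.finite_socles_subgroup[OF G] by (simp add: ext_Bassian_iff)
qed

theorem theorem4p4:
  fixes C :: "'a monoid \<Rightarrow> bool"
  assumes abelian: "\<And>G. C G \<Longrightarrow> comm_group G"
    and iso_closed: "\<And>G H. C G \<Longrightarrow> comm_group H \<Longrightarrow> G \<cong> H \<Longrightarrow> C H"
  shows "((\<forall>G. ext_Bassian G \<longrightarrow> C G) \<and> (\<forall>G. C G \<longrightarrow> directly_finite G)
            \<longrightarrow> (\<forall>G. hered C G \<longleftrightarrow> ext_Bassian G))
       \<and> ((\<forall>G. Bassian G \<longrightarrow> C G) \<and> (\<forall>G. C G \<longrightarrow> Hopfian G)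
            \<longrightarrow> (\<forall>G. hered C G \<longleftrightarrow> Bassian G))"
proof (intro conjI impI allI iffI; elim conjE)
  fix G :: "'a monoid" assume CD: "\<forall>G. C G \<longrightarrow> directly_finite G" and h: "hered C G"
  have G: "comm_group G" using h abelian by (simp add: hered_def)
  have df: "directly_finite (G\<lparr>carrier := H\<rparr>)" if "subgroup H G" for H
    using h CD that by (simp add: hered_def)
  show "ext_Bassian G"
    by (rule ext_BassianI[OF G hereditarily_directly_finite_imp[OF G df]])
next
  fix G :: "'a monoid" assume "\<forall>G. ext_Bassian G \<longrightarrow> C G" "ext_Bassian G"
  then show "hered C G" unfolding hered_def by (blast intro: ext_Bassian_subgroup)
next
  fix G :: "'a monoid" assume CH: "\<forall>G. C G \<longrightarrow> Hopfian G" and h: "hered C G"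
  have G: "comm_group G" using h abelian by (simp add: hered_def)
  show "Bassian G"
    by (rule hereditarily_Hopfian_imp[OF G]) (use h CH in \<open>simp add: hered_def\<close>)
next
  fix G :: "'a monoid" assume "\<forall>G. Bassian G \<longrightarrow> C G" "Bassian G"
  then show "hered C G" unfolding hered_def by (blast intro: Bassian_subgroup)
qed

end
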